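(* In $\mathbb{Z}[t][[u]]$, \[ \sum_{n=1}^\infty P_{W^n}(t) u^n=\frac{u+1}{2 (t u+1) \sqrt{(u-1)^2-4 t u^2}}-\frac{1}{2 (t u+1)}, \] where the square root is the power series in $u$ with constant term $1$.
   Context: For a matroid $M$ let $L(M)$ be its lattice of flats, $\mathrm{rk}\, M$ its rank, $\chi_M(t)$ its characteristic polynomial; for a flat $F$, $M_F$ is the localization (restriction to $F$) and $M^F$ the contraction at $F$. The Kazhdan–Lusztig polynomial is the unique assignment of $P_M(t)\in\mathbb{Z}[t]$ to each loopless matroid $M$ with: $P_M=1$ if $\mathrm{rk}\, M=0$; $\deg P_M<\frac12\mathrm{rk}\, M$ if $\mathrm{rk}\, M>0$; $t^{\mathrm{rk}\, M}P_M(t^{-1})=\sum_{F\in L(M)}\chi_{M_F}(t)P_{M^F}(t)$. For $n\ge3$ let $W_n$ be the wheel graph (vertices $0,\dots,n$, edges of the cycle $1,2,\dots,n,1$ forming the set $O_n$, and edges $\{0,i\}$), and let the whirl matroid $W^n$ be the matroid on $E(W_n)$ whose independent sets are the edge sets of forests of $W_n$ together with $O_n$. Further, $W^1$ is the graphic matroid of a single edge (the rank-one matroid on one element), and $W^2$ is the matroid obtained from the graphic matroid of the multigraph on $\{0,1,2\}$ with edges $(0,1),(0,2)$ and two parallel edges $e_1,e_2$ between $1$ and $2$ by declaring $\{e_1,e_2\}$ independent; i.e. $W^2$ is the uniform matroid of rank $2$ on $4$ elements. *)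

theory Defs
  imports "HOL-Computational_Algebra.Computational_Algebra"
begin

section \<open>Matroids\<close>

record 'a matroid =
  ground :: "'a set"
  indeps :: "'a set set"

definition matroid :: "'a matroid \<Rightarrow> bool" where
  "matroid M \<longleftrightarrow>
     finite (ground M) \<and>
     (\<forall>I\<in>indeps M. I \<subseteq> ground M) \<and>
     {} \<in> indeps M \<and>
     (\<forall>I\<in>indeps M. \<forall>J. J \<subseteq> I \<longrightarrow> J \<in> indeps M) \<and>
     (\<forall>I\<in>indeps M. \<forall>J\<in>indeps M. card I < card J \<longrightarrow> (\<exists>x\<in>J - I. insert x I \<in> indeps M))"

definition loopless :: "'a matroid \<Rightarrow> bool" where
  "loopless M \<longleftrightarrow> (\<forall>x\<in>ground M. {x} \<in> indeps M)"

definition rank_of :: "'a matroid \<Rightarrow> 'a set \<Rightarrow> nat" where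
  "rank_of M X = Max (card ` {I \<in> indeps M. I \<subseteq> X})"

definition rk :: "'a matroid \<Rightarrow> nat" where
  "rk M = rank_of M (ground M)"

definition flats :: "'a matroid \<Rightarrow> 'a set set" where
  "flats M = {F. F \<subseteq> ground M \<and> (\<forall>x\<in>ground M - F. rank_of M F < rank_of M (insert x F))}"

definition localization :: "'a matroid \<Rightarrow> 'a set \<Rightarrow> 'a matroid" where
  "localization M F = \<lparr>ground = F, indeps = {I \<in> indeps M. I \<subseteq> F}\<rparr>"

definition basis_in :: "'a matroid \<Rightarrow> 'a set \<Rightarrow> 'a set \<Rightarrow> bool" where
  "basis_in M X B \<longleftrightarrow> B \<in> indeps M \<and> B \<subseteq> X \<and> (\<forall>x\<in>X - B. insert x B \<notin> indeps M)"

definition contraction :: "'a matroid \<Rightarrow> 'a set \<Rightarrow> 'a matroid" where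
  "contraction M F =
     \<lparr>ground = ground M - F,
      indeps = {I. I \<subseteq> ground M - F \<and> (\<exists>B. basis_in M F B \<and> I \<union> B \<in> indeps M)}\<rparr>"


section \<open>Characteristic polynomial\<close>

text \<open>The Moebius function of a family \<^term>\<open>L\<close> of finite sets ordered by inclusion. The
  finiteness test only serves termination.\<close>

function moebius :: "'a set set \<Rightarrow> 'a set \<Rightarrow> 'a set \<Rightarrow> int" where
  "moebius L X Y =
     (if finite Y \<and> X \<subset> Y then - (\<Sum>Z\<in>{Z\<in>L. X \<subseteq> Z \<and> Z \<subset> Y}. moebius L X Z)
      else if X = Y then 1 else 0)"
  by pat_completeness auto
termination
  by (relation "measure (\<lambda>(L, X, Y). card Y)") (auto intro: psubset_card_mono)

declare moebius.simps [simp del]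

text \<open>The intersection of all flats is the least flat; for a loopless matroid it is empty.\<close>

definition char_poly :: "'a matroid \<Rightarrow> int poly" where
  "char_poly M =
     (\<Sum>F\<in>flats M. monom (moebius (flats M) (\<Inter>(flats M)) F) (rk M - rank_of M F))"


section \<open>Kazhdan--Lusztig polynomials\<close>

text \<open>\<^term>\<open>poly_rev d p\<close> is \<open>t\<^sup>d p(t\<^sup>-\<^sup>1)\<close>, provided that \<open>degree p \<le> d\<close>.\<close>

definition poly_rev :: "nat \<Rightarrow> int poly \<Rightarrow> int poly" where
  "poly_rev d p = (\<Sum>i\<le>degree p. monom (coeff p i) (d - i))"

definition KL_assignment :: "('a matroid \<Rightarrow> int poly) \<Rightarrow> bool" where
  "KL_assignment P \<longleftrightarrow>
     (\<forall>M. matroid M \<and> loopless M \<longrightarrow>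
        (rk M = 0 \<longrightarrow> P M = 1) \<and>
        (rk M > 0 \<longrightarrow> 2 * degree (P M) < rk M) \<and>
        poly_rev (rk M) (P M) =
          (\<Sum>F\<in>flats M. char_poly (localization M F) * P (contraction M F)))"

text \<open>The assignment is unique on loopless matroids only; the value \<open>0\<close> elsewhere is a
  convention that makes the description definite.\<close>

definition KL_poly :: "'a matroid \<Rightarrow> int poly" where
  "KL_poly = (THE P. KL_assignment P \<and> (\<forall>M. \<not> (matroid M \<and> loopless M) \<longrightarrow> P M = 0))"


section \<open>Graphic matroids and whirl matroids\<close>

text \<open>A multigraph is given by a set of edges and a map sending each edge to its set of end points
  (a singleton for a loop). A cycle of length \<open>1\<close> is a loop and a cycle of length \<open>2\<close> is a pair
  of parallel edges.\<close>

definition graph_cycle :: "('e \<Rightarrow> 'v set) \<Rightarrow> 'v list \<Rightarrow> 'e list \<Rightarrow> bool" where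
  "graph_cycle ends vs es \<longleftrightarrow>
     es \<noteq> [] \<and> length vs = length es \<and> distinct vs \<and> distinct es \<and>
     (\<forall>i<length es. ends (es ! i) = {vs ! i, vs ! (Suc i mod length es)})"

definition forest :: "('e \<Rightarrow> 'v set) \<Rightarrow> 'e set \<Rightarrow> bool" where
  "forest ends A \<longleftrightarrow> \<not> (\<exists>vs es. graph_cycle ends vs es \<and> set es \<subseteq> A)"

definition graphic_matroid :: "'e set \<Rightarrow> ('e \<Rightarrow> 'v set) \<Rightarrow> 'e matroid" where
  "graphic_matroid E ends = \<lparr>ground = E, indeps = {A. A \<subseteq> E \<and> forest ends A}\<rparr>"

text \<open>In the wheel with \<open>n\<close> spokes, \<open>Spoke i\<close> joins the hub \<open>0\<close> to \<open>i\<close>, and \<open>Rim i\<close> joins \<open>i\<close> to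
  its cyclic successor. For \<open>n = 2\<close> this is the multigraph in which \<open>Rim 1\<close> and \<open>Rim 2\<close> are
  parallel edges between \<open>1\<close> and \<open>2\<close>.\<close>

datatype wheel_edge = Spoke nat | Rim nat

fun wheel_ends :: "nat \<Rightarrow> wheel_edge \<Rightarrow> nat set" where
  "wheel_ends n (Spoke i) = {0, i}"
| "wheel_ends n (Rim i) = {i, if i = n then 1 else Suc i}"

definition rim :: "nat \<Rightarrow> wheel_edge set" where
  "rim n = Rim ` {1..n}"

definition wheel_edges :: "nat \<Rightarrow> wheel_edge set" where
  "wheel_edges n = Spoke ` {1..n} \<union> rim n"

text \<open>For \<open>n = 1\<close> the whirl is by convention the graphic matroid of a single edge (the general
  clause would add a second element); the value at \<open>n = 0\<close> is irrelevant.\<close>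

definition whirl :: "nat \<Rightarrow> wheel_edge matroid" where
  "whirl n =
     (if n = 1 then graphic_matroid {Spoke 1} (wheel_ends 1)
      else \<lparr>ground = wheel_edges n,
            indeps = insert (rim n) (indeps (graphic_matroid (wheel_edges n) (wheel_ends n)))\<rparr>)"


section \<open>Square roots of power series\<close>

text \<open>The first argument of \<^const>\<open>fps_radical\<close> prescribes the constant coefficient of the root.\<close>

definition fps_sqrt1 :: "'a::field_char_0 fps \<Rightarrow> 'a fps" where
  "fps_sqrt1 f = fps_radical (\<lambda>_ _. 1) 2 f"

lemma fps_sqrt1_iff:
  assumes "fps_nth f 0 = 1"
  shows "g = fps_sqrt1 f \<longleftrightarrow> g ^ 2 = f \<and> fps_nth g 0 = 1"
proof -
  have sq: "fps_sqrt1 f ^ 2 = f"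
    using power_radical[of f "\<lambda>_ _. 1" 1] assms
    by (simp add: fps_sqrt1_def numeral_2_eq_2)
  have const: "fps_nth (fps_sqrt1 f) 0 = 1"
    by (simp add: fps_sqrt1_def numeral_2_eq_2)
  have "g = fps_sqrt1 f" if "g ^ 2 = f" "fps_nth g 0 = 1"
  proof -
    have "g = fps_sqrt1 f \<or> g = - fps_sqrt1 f"
      using that(1) sq power2_eq_iff[of g "fps_sqrt1 f"] by metis
    moreover have "g \<noteq> - fps_sqrt1 f"
    proof
      assume "g = - fps_sqrt1 f"
      hence "fps_nth g 0 = - 1" using const by simp
      thus False using that(2) by simp
    qed
    ultimately show ?thesis by blast
  qed
  thus ?thesis using sq const by blast
qed

end

theory Submission
  imports Defs
begin

text \<open>
  By Moebius inversion, \<open>P\<^sub>M\<close> is the unique polynomial of degree less than \<open>rk M / 2\<close> for which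
  \<open>Z\<^sub>M(t) = \<Sum>F. t\<^bsup>rk F\<^esup> P\<^bsub>M\<^sup>F\<^esub>(t)\<close> is palindromic of degree \<open>rk M\<close>; in this form existence is
  immediate, and no characteristic polynomial needs to be known.

  Contracting a flat of the whirl that contains no spoke gives a smaller whirl, and contracting any other flat
  gives a direct sum of fans, one for each gap between the vertices joined to the hub (up to parallel
  elements). With Motzkin polynomials as candidates for fans and the coefficients of the claimed series as
  candidates for whirls, the polynomials \<open>Z\<close> have generating functions \<open>(1 + G)(1 + t G)\<close> and
  \<open>G (1 + t + 2 t G) / (1 - t G\<^sup>2)\<close>, where \<open>G = u (1 + G)(1 + t G)\<close>. The substitution
  \<open>t \<mapsto> 1/t\<close>, \<open>u \<mapsto> t u\<close> maps \<open>G\<close> to \<open>t G\<close> and hence fixes both series, which is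
  palindromicity.
\<close>

section \<open>Rank functions of matroids\<close>

text \<open>No contraction is ever identified with a fan or a smaller whirl: uniqueness is applied
  inside a single lattice of flats, with one candidate polynomial per flat. The price is that
  palindromicity has to be shown for the interval above every flat, and this is why arbitrary words
  occur and not only the word of the empty flat. Hub letters split such an interval into a product
  and \<open>Join\<close> letters can be deleted; what is left are words consisting of
  \<open>End\<close> only, the case of the two generating functions. Likewise the whirl is rebuilt
  from an explicit lattice of flats, and the independent sets of its definition are matched against
  this lattice by separating elements by flats. Replacing t by 1/t requires a field: the symmetry is
  checked at every positive real t, where u \<mapsto> t u is a composition of real power series, and
  infinitely many t give back an identity of integer polynomials.\<close>

lemma matroidD:
  assumes "matroid M"
  shows "finite (ground M)" "I \<in> indeps M \<Longrightarrow> I \<subseteq> ground M" "I \<in> indeps M \<Longrightarrow> finite I"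
    "{} \<in> indeps M" "I \<in> indeps M \<Longrightarrow> J \<subseteq> I \<Longrightarrow> J \<in> indeps M"
proof -
  show 1: "finite (ground M)" and 2: "I \<in> indeps M \<Longrightarrow> I \<subseteq> ground M" and "{} \<in> indeps M"
    and "I \<in> indeps M \<Longrightarrow> J \<subseteq> I \<Longrightarrow> J \<in> indeps M"
    using assms unfolding matroid_def by auto
  show "I \<in> indeps M \<Longrightarrow> finite I" using 1 2 finite_subset by auto
qed

lemma matroid_exchange:
  assumes "matroid M" "I \<in> indeps M" "J \<in> indeps M" "card I < card J"
  obtains x where "x \<in> J - I" "insert x I \<in> indeps M"
  using assms unfolding matroid_def by blast

lemma finite_indeps: "matroid M \<Longrightarrow> finite {I \<in> indeps M. I \<subseteq> X}"
  by (rule finite_subset[of _ "Pow (ground M)"]) (auto simp: matroidD(1) dest: matroidD(2))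

lemma ex_card_eq_rank_of:
  assumes "matroid M"
  obtains I where "I \<in> indeps M" "I \<subseteq> X" "card I = rank_of M X"
proof -
  have "rank_of M X \<in> card ` {I \<in> indeps M. I \<subseteq> X}"
    unfolding rank_of_def by (rule Max_in) (use finite_indeps[OF assms] matroidD(4)[OF assms] in auto)
  thus ?thesis using that by auto
qed

lemma card_le_rank_of:
  assumes "matroid M" "I \<in> indeps M" "I \<subseteq> X"
  shows "card I \<le> rank_of M X"
  unfolding rank_of_def by (rule Max_ge) (use finite_indeps[OF assms(1)] assms in auto)

lemma indep_extend:
  assumes M: "matroid M" and "I \<in> indeps M" "I \<subseteq> X"
  obtains B where "B \<in> indeps M" "I \<subseteq> B" "B \<subseteq> X" "card B = rank_of M X"
proof -
  let ?S = "{B \<in> indeps M. I \<subseteq> B \<and> B \<subseteq> X}"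
  have fin: "finite ?S" by (rule finite_subset[OF _ finite_indeps[OF M, of X]]) auto
  have "I \<in> ?S" using assms by auto
  hence "Max (card ` ?S) \<in> card ` ?S" using fin by (intro Max_in) auto
  then obtain B where B0: "B \<in> ?S" "card B = Max (card ` ?S)" by auto
  have B: "card C \<le> card B" if "C \<in> ?S" for C
    using B0 Max_ge[of "card ` ?S" "card C"] fin that by auto
  have "card B = rank_of M X"
  proof (rule ccontr)
    assume ne: "card B \<noteq> rank_of M X"
    have "card B \<le> rank_of M X" by (rule card_le_rank_of[OF M]) (use B0(1) in auto)
    obtain J where J: "J \<in> indeps M" "J \<subseteq> X" "card J = rank_of M X"
      using ex_card_eq_rank_of[OF M] by blast
    have "card B < card J" using ne \<open>card B \<le> _\<close> J by simp
    then obtain x where x: "x \<in> J - B" "insert x B \<in> indeps M"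
      using matroid_exchange[OF M] B0(1) J(1) by blast
    hence "insert x B \<in> ?S" using B0 J by auto
    from B[OF this] show False using x B0(1) matroidD(3)[OF M] by auto
  qed
  thus ?thesis using that B0 by auto
qed

lemma rank_of_mono:
  assumes "matroid M" "X \<subseteq> Y"
  shows "rank_of M X \<le> rank_of M Y"
  by (rule ex_card_eq_rank_of[OF assms(1), of X])
     (metis assms card_le_rank_of subset_trans)

lemma rank_of_insert_le:
  assumes M: "matroid M"
  shows "rank_of M (insert x X) \<le> Suc (rank_of M X)"
proof -
  obtain I where I: "I \<in> indeps M" "I \<subseteq> insert x X" "card I = rank_of M (insert x X)"
    using ex_card_eq_rank_of[OF M] by blast
  have "I - {x} \<in> indeps M" "I - {x} \<subseteq> X" using I matroidD(5)[OF M, of I] by auto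
  hence "card (I - {x}) \<le> rank_of M X" using card_le_rank_of[OF M] by blast
  moreover have "card I \<le> Suc (card (I - {x}))"
    using card_Suc_Diff1[OF matroidD(3)[OF M I(1)], of x] by (cases "x \<in> I") auto
  ultimately show ?thesis using I by linarith
qed

lemma rank_of_empty: "matroid M \<Longrightarrow> rank_of M {} = 0"
  by (rule ex_card_eq_rank_of[of M "{}"]) auto

lemma rank_of_le_card:
  assumes "matroid M" "finite X"
  shows "rank_of M X \<le> card X"
  by (rule ex_card_eq_rank_of[OF assms(1), of X]) (metis assms(2) card_mono)

lemma rank_of_indep: "matroid M \<Longrightarrow> I \<in> indeps M \<Longrightarrow> rank_of M I = card I"
  by (meson card_le_rank_of le_antisym matroidD(3) rank_of_le_card subset_refl)

lemma indep_iff_rank_of: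
  assumes "matroid M" "X \<subseteq> ground M"
  shows "X \<in> indeps M \<longleftrightarrow> rank_of M X = card X"
proof
  assume eq: "rank_of M X = card X"
  obtain I where "I \<in> indeps M" "I \<subseteq> X" "card I = rank_of M X"
    using ex_card_eq_rank_of[OF assms(1)] by blast
  moreover have "finite X" using assms finite_subset matroidD(1) by blast
  ultimately show "X \<in> indeps M" using eq card_subset_eq by metis
qed (use assms rank_of_indep in auto)

text \<open>Monotonicity of closure, expressed by ranks. A basis of \<open>X\<close> is extended to
  one of \<open>Y\<close> and then to one of \<open>insert x Y\<close>; a rank jump would force
  \<open>x\<close> into the last set and make a basis of \<open>X\<close> together with
  \<open>x\<close> independent.\<close>

lemma rank_of_insert_mono:
  assumes M: "matroid M" and eq: "rank_of M (insert x X) = rank_of M X" and sub: "X \<subseteq> Y"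
  shows "rank_of M (insert x Y) = rank_of M Y"
proof (rule ccontr)
  assume ne: "rank_of M (insert x Y) \<noteq> rank_of M Y"
  obtain B where B: "B \<in> indeps M" "B \<subseteq> X" "card B = rank_of M X"
    using ex_card_eq_rank_of[OF M] by blast
  obtain C where C: "C \<in> indeps M" "B \<subseteq> C" "C \<subseteq> Y" "card C = rank_of M Y"
    using indep_extend[OF M B(1), of Y] B sub by auto
  obtain D where D: "D \<in> indeps M" "C \<subseteq> D" "D \<subseteq> insert x Y" "card D = rank_of M (insert x Y)"
    using indep_extend[OF M C(1), of "insert x Y"] C by auto
  have "x \<in> D"
  proof (rule ccontr)
    assume "x \<notin> D"
    hence "D \<subseteq> Y" using D by auto
    from card_le_rank_of[OF M D(1) this] show False
      using D ne rank_of_mono[OF M, of Y "insert x Y"] by auto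
  qed
  have "x \<notin> Y" using ne by (auto simp: insert_absorb)
  have "insert x B \<in> indeps M" using matroidD(5)[OF M D(1), of "insert x B"] \<open>x \<in> D\<close> C D by auto
  from card_le_rank_of[OF M this, of "insert x X"] have "card (insert x B) \<le> rank_of M X"
    using B eq by auto
  moreover have "x \<notin> B" using \<open>x \<notin> Y\<close> B sub by auto
  ultimately show False using B matroidD(3)[OF M B(1)] by auto
qed

lemma rank_of_Un_eq:
  assumes M: "matroid M" and "finite Y" and "\<And>y. y \<in> Y \<Longrightarrow> rank_of M (insert y X) = rank_of M X"
  shows "rank_of M (X \<union> Y) = rank_of M X"
  using assms(2,3)
proof (induction Y rule: finite_induct)
  case (insert y Y)
  have "rank_of M (insert y (X \<union> Y)) = rank_of M (X \<union> Y)"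
    by (rule rank_of_insert_mono[OF M, of _ X]) (use insert in auto)
  thus ?case using insert by auto
qed simp

lemma basis_in_iff:
  assumes M: "matroid M"
  shows "basis_in M X B \<longleftrightarrow> B \<in> indeps M \<and> B \<subseteq> X \<and> card B = rank_of M X"
proof
  assume B: "basis_in M X B"
  then obtain C where C: "C \<in> indeps M" "B \<subseteq> C" "C \<subseteq> X" "card C = rank_of M X"
    using indep_extend[OF M, of B X] unfolding basis_in_def by auto
  have "C = B"
  proof (rule ccontr)
    assume "C \<noteq> B"
    then obtain x where "x \<in> C - B" using C by auto
    moreover have "insert x B \<in> indeps M" using matroidD(5)[OF M C(1), of "insert x B"] C calculation by auto
    ultimately show False using B C unfolding basis_in_def by auto
  qed
  thus "B \<in> indeps M \<and> B \<subseteq> X \<and> card B = rank_of M X" using C by auto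
next
  assume B: "B \<in> indeps M \<and> B \<subseteq> X \<and> card B = rank_of M X"
  have "insert x B \<notin> indeps M" if "x \<in> X - B" for x
  proof
    assume "insert x B \<in> indeps M"
    from card_le_rank_of[OF M this, of X] show False using B that matroidD(3)[OF M, of B] by auto
  qed
  thus "basis_in M X B" using B unfolding basis_in_def by auto
qed

lemma rank_of_basis_Un:
  assumes M: "matroid M" and B: "basis_in M X B" and "X \<subseteq> ground M"
  shows "rank_of M (B \<union> Y) = rank_of M (X \<union> Y)"
proof -
  have fin: "finite X" using assms matroidD(1) finite_subset by blast
  have b: "B \<in> indeps M" "B \<subseteq> X" "card B = rank_of M X" using B basis_in_iff[OF M] by auto
  have "rank_of M (B \<union> Y \<union> X) = rank_of M (B \<union> Y)"
  proof (rule rank_of_Un_eq[OF M fin])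
    fix x assume "x \<in> X"
    hence "rank_of M (insert x B) \<le> rank_of M X" using rank_of_mono[OF M, of "insert x B" X] b by auto
    moreover have "rank_of M B = rank_of M X" using rank_of_indep[OF M] b by auto
    moreover have "rank_of M B \<le> rank_of M (insert x B)" by (rule rank_of_mono[OF M]) auto
    ultimately show "rank_of M (insert x (B \<union> Y)) = rank_of M (B \<union> Y)"
      using rank_of_insert_mono[OF M, of x B "B \<union> Y"] by auto
  qed
  moreover have "B \<union> Y \<union> X = X \<union> Y" using b by auto
  ultimately show ?thesis by simp
qed

text \<open>In place of submodularity, \<open>clos\<close> asks that elements which do not raise the
  rank one at a time do not raise it together. This is easy to check both for contractions and for
  ranks given by a closure operator, and its contrapositive yields the exchange property.\<close>

lemma matroid_of_rank_function:
  assumes fin: "finite E" and zero: "r {} = 0"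
    and unit: "\<And>x X. X \<subseteq> E \<Longrightarrow> x \<in> E \<Longrightarrow> r X \<le> r (insert x X) \<and> r (insert x X) \<le> Suc (r X)"
    and clos: "\<And>X Y. X \<subseteq> Y \<Longrightarrow> Y \<subseteq> E \<Longrightarrow> (\<And>y. y \<in> Y \<Longrightarrow> r (insert y X) = r X) \<Longrightarrow> r Y = r X"
  defines "M \<equiv> \<lparr>ground = E, indeps = {I. I \<subseteq> E \<and> r I = card I}\<rparr>"
  shows "matroid M" and "X \<subseteq> E \<Longrightarrow> rank_of M X = r X"
proof -
  have finE: "finite X" if "X \<subseteq> E" for X using fin that finite_subset by auto
  have grow: "r X \<le> r (X \<union> Y) \<and> r (X \<union> Y) \<le> r X + card Y" if "X \<subseteq> E" "Y \<subseteq> E" for X Y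
  proof -
    have "finite Y" using finE that by auto
    thus ?thesis using that(2)
    proof (induction Y)
      case (insert y Y)
      thus ?case using unit[of "X \<union> Y" y] that by auto
    qed simp
  qed
  have le_card: "r X \<le> card X" if "X \<subseteq> E" for X using grow[of "{}" X] that zero by auto
  have mono: "r X \<le> r Y" if "X \<subseteq> Y" "Y \<subseteq> E" for X Y
  proof -
    have "X \<union> Y = Y" "X \<subseteq> E" using that by auto
    thus ?thesis using grow[of X Y] that by simp
  qed
  have exch: "\<exists>x\<in>Y. r (insert x X) = Suc (r X)" if "X \<subseteq> E" "Y \<subseteq> E" "r X < r Y" for X Y
  proof (rule ccontr)
    assume no: "\<not> ?thesis"
    have "r (insert y X) = r X" if y: "y \<in> X \<union> Y" for y
    proof (cases "y \<in> X")
      case False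
      thus ?thesis using no y unit[of X y] that
        using \<open>X \<subseteq> E\<close> \<open>Y \<subseteq> E\<close> by fastforce
    qed (simp add: insert_absorb)
    hence "r (X \<union> Y) = r X" using clos[of X "X \<union> Y"] that by auto
    moreover have "r Y \<le> r (X \<union> Y)" using mono[of Y "X \<union> Y"] that by auto
    ultimately show False using that by linarith
  qed
  have ind: "I \<in> indeps M \<longleftrightarrow> I \<subseteq> E \<and> r I = card I" for I by (auto simp: M_def)
  have step: "x \<notin> I \<and> insert x I \<in> indeps M"
    if "I \<in> indeps M" "x \<in> E" "r (insert x I) = Suc (r I)" for x I
  proof -
    have "x \<notin> I" using that by (metis insert_absorb n_not_Suc_n)
    thus ?thesis using that finE[of I] by (auto simp: ind)
  qed
  show mat: "matroid M"
    unfolding matroid_def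
  proof (intro conjI ballI allI impI)
    show "finite (ground M)" using fin by (simp add: M_def)
    show "{} \<in> indeps M" using zero by (simp add: ind)
    show "I \<subseteq> ground M" if "I \<in> indeps M" for I using that by (simp add: M_def)
    show "J \<in> indeps M" if "I \<in> indeps M" "J \<subseteq> I" for I J
    proof -
      have "I \<subseteq> E" "r I = card I" using that ind by auto
      hence "J \<subseteq> E" "I - J \<subseteq> E" "J \<union> (I - J) = I" using that by auto
      hence "card I \<le> r J + card (I - J)" using grow[of J "I - J"] \<open>r I = card I\<close> by auto
      moreover have "card (I - J) = card I - card J" "card J \<le> card I"
        using card_Diff_subset[of J I] card_mono[of I J] that finE[of I] finE[of J] \<open>I \<subseteq> E\<close> \<open>J \<subseteq> E\<close> by auto
      ultimately show ?thesis using le_card[OF \<open>J \<subseteq> E\<close>] \<open>J \<subseteq> E\<close> by (auto simp: ind)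
    qed
    show "\<exists>x\<in>J - I. insert x I \<in> indeps M"
      if "I \<in> indeps M" "J \<in> indeps M" "card I < card J" for I J
    proof -
      have "I \<subseteq> E" "J \<subseteq> E" "r I < r J" using that unfolding ind by auto
      then obtain x where "x \<in> J" "r (insert x I) = Suc (r I)" using exch by blast
      moreover have "x \<in> E" using \<open>x \<in> J\<close> \<open>J \<subseteq> E\<close> by auto
      ultimately show ?thesis using step[of I x] that(1) by blast
    qed
  qed
  show "rank_of M X = r X" if X: "X \<subseteq> E"
  proof (rule antisym)
    obtain I where I: "I \<in> indeps M" "I \<subseteq> X" "card I = rank_of M X"
      using ex_card_eq_rank_of[OF mat] by blast
    thus "rank_of M X \<le> r X" using mono[of I X] X by (auto simp: ind)
    have "r X \<le> r I"
    proof (rule ccontr)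
      assume "\<not> r X \<le> r I"
      then obtain x where x: "x \<in> X" "r (insert x I) = Suc (r I)" using exch[of I X] I X by auto
      hence "x \<notin> I" "insert x I \<in> indeps M" using step[of I x] I X by auto
      from card_le_rank_of[OF mat this(2), of X] show False
        using \<open>x \<notin> I\<close> I x matroidD(3)[OF mat I(1)] by auto
    qed
    thus "r X \<le> rank_of M X" using I by (auto simp: ind)
  qed
qed

section \<open>Localization and contraction\<close>

lemma flatsD: "F \<in> flats M \<Longrightarrow> F \<subseteq> ground M"
  by (auto simp: flats_def)

lemma finite_flats: "matroid M \<Longrightarrow> finite (flats M)"
  by (rule finite_subset[of _ "Pow (ground M)"]) (auto simp: flats_def matroidD)

lemma ground_in_flats: "ground M \<in> flats M"
  by (auto simp: flats_def)

lemma rank_of_singleton: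
  assumes "matroid M" "loopless M" "x \<in> ground M"
  shows "rank_of M {x} = 1"
  using assms rank_of_indep[of M "{x}"] by (auto simp: loopless_def)

lemma empty_in_flats: "matroid M \<Longrightarrow> loopless M \<Longrightarrow> {} \<in> flats M"
  by (auto simp: flats_def rank_of_empty rank_of_singleton)

lemma rank_of_flat_less:
  assumes M: "matroid M" and F: "F \<in> flats M" and "F \<subset> X" "X \<subseteq> ground M"
  shows "rank_of M F < rank_of M X"
proof -
  obtain x where "x \<in> X - F" using assms by auto
  hence "rank_of M F < rank_of M (insert x F)" using F assms by (auto simp: flats_def)
  also have "\<dots> \<le> rank_of M X" by (rule rank_of_mono[OF M]) (use assms \<open>x \<in> X - F\<close> in auto)
  finally show ?thesis .
qed

lemma rank_of_localization: "X \<subseteq> F \<Longrightarrow> rank_of (localization M F) X = rank_of M X"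
proof -
  assume "X \<subseteq> F"
  hence "{I \<in> indeps M. I \<subseteq> F \<and> I \<subseteq> X} = {I \<in> indeps M. I \<subseteq> X}" by auto
  thus ?thesis by (simp add: rank_of_def localization_def conj_assoc)
qed

lemma rk_localization: "rk (localization M F) = rank_of M F"
  using rank_of_localization[of F F M] by (simp add: rk_def localization_def)

text \<open>An element outside the flat \<open>F\<close> raises the rank of every subset of
  \<open>F\<close>; otherwise, by monotone closure, it would not raise the rank of \<open>F\<close>
  either. So only elements of \<open>F\<close> have to be tested.\<close>

lemma flats_localization:
  assumes M: "matroid M" and F: "F \<in> flats M"
  shows "flats (localization M F) = {G \<in> flats M. G \<subseteq> F}"
proof -
  have FE: "F \<subseteq> ground M" using F by (rule flatsD)
  have iff: "G \<in> flats (localization M F) \<longleftrightarrow> G \<subseteq> F \<and> (\<forall>x\<in>F - G. rank_of M G < rank_of M (insert x G))" for G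
  proof -
    have "ground (localization M F) = F" by (simp add: localization_def)
    thus ?thesis by (auto simp: flats_def rank_of_localization)
  qed
  have "rank_of M G < rank_of M (insert x G)"
    if "G \<subseteq> F" "x \<in> ground M - F" for G x
  proof (rule ccontr)
    assume "\<not> ?thesis"
    hence "rank_of M (insert x G) = rank_of M G" using rank_of_mono[OF M subset_insertI, of G x] by auto
    hence "rank_of M (insert x F) = rank_of M F" using rank_of_insert_mono[OF M _ that(1), of x] by auto
    moreover have "rank_of M F < rank_of M (insert x F)" using F that(2) by (simp add: flats_def)
    ultimately show False by simp
  qed
  hence "G \<in> flats M" if "G \<subseteq> F" "\<forall>x\<in>F - G. rank_of M G < rank_of M (insert x G)" for G
    using that FE unfolding flats_def by blast
  moreover have "\<forall>x\<in>F - G. rank_of M G < rank_of M (insert x G)" if "G \<in> flats M" for G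
    using that FE unfolding flats_def by auto
  ultimately show ?thesis by (auto simp: iff)
qed

lemma ground_contraction [simp]: "ground (contraction M F) = ground M - F"
  by (simp add: contraction_def)

text \<open>The basis in the definition of contraction may be chosen freely, since the rank of
  \<open>I \<union> B\<close> depends only on the span of \<open>B\<close>, which is that of
  \<open>F\<close>.\<close>

lemma indeps_contraction:
  assumes M: "matroid M" and F: "F \<subseteq> ground M"
  shows "I \<in> indeps (contraction M F) \<longleftrightarrow>
    I \<subseteq> ground M - F \<and> rank_of M (I \<union> F) = rank_of M F + card I"
proof -
  have "(\<exists>B. basis_in M F B \<and> I \<union> B \<in> indeps M) \<longleftrightarrow> rank_of M (I \<union> F) = rank_of M F + card I"
    if I: "I \<subseteq> ground M - F"
  proof -
    have finI: "finite I" using I finite_subset[of I "ground M"] matroidD(1)[OF M] by auto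
    have *: "I \<union> B \<in> indeps M \<longleftrightarrow> rank_of M (I \<union> F) = rank_of M F + card I" if B: "basis_in M F B" for B
    proof -
      have b: "B \<in> indeps M" "B \<subseteq> F" "card B = rank_of M F" using B basis_in_iff[OF M] by auto
      have "I \<union> B \<subseteq> ground M" using b I F by auto
      hence "I \<union> B \<in> indeps M \<longleftrightarrow> rank_of M (I \<union> B) = card (I \<union> B)" by (rule indep_iff_rank_of[OF M])
      also have "rank_of M (I \<union> B) = rank_of M (I \<union> F)"
        using rank_of_basis_Un[OF M B F, of I] by (simp add: Un_commute)
      also have "card (I \<union> B) = card I + rank_of M F"
        using card_Un_disjoint[of I B] b I finI matroidD(3)[OF M b(1)] by auto
      finally show ?thesis by (simp add: add.commute)
    qed
    obtain B where "basis_in M F B"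
      using ex_card_eq_rank_of[OF M, of F] basis_in_iff[OF M] by metis
    with * show ?thesis by blast
  qed
  thus ?thesis unfolding contraction_def by auto
qed

lemma matroid_contraction:
  assumes M: "matroid M" and F: "F \<subseteq> ground M"
  shows "matroid (contraction M F)"
    and "X \<subseteq> ground M - F \<Longrightarrow> rank_of (contraction M F) X = rank_of M (X \<union> F) - rank_of M F"
proof -
  define r where "r X = rank_of M (X \<union> F) - rank_of M F" for X
  have ge: "rank_of M F \<le> rank_of M (X \<union> F)" for X by (rule rank_of_mono[OF M]) auto
  have eq: "contraction M F = \<lparr>ground = ground M - F, indeps = {I. I \<subseteq> ground M - F \<and> r I = card I}\<rparr>"
  proof -
    have "r I = card I \<longleftrightarrow> rank_of M (I \<union> F) = rank_of M F + card I" for I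
      using ge[of I] unfolding r_def by linarith
    hence "indeps (contraction M F) = {I. I \<subseteq> ground M - F \<and> r I = card I}"
      using indeps_contraction[OF assms] by auto
    thus ?thesis by (simp add: contraction_def)
  qed
  have 1: "finite (ground M - F)" using matroidD(1)[OF M] by auto
  have 2: "r {} = 0" by (simp add: r_def)
  have 3: "r X \<le> r (insert x X) \<and> r (insert x X) \<le> Suc (r X)" for x X
    using ge[of X] ge[of "insert x X"] rank_of_insert_le[OF M, of x "X \<union> F"]
      rank_of_mono[OF M subset_insertI, of "X \<union> F" x]
    unfolding r_def by auto
  have 4: "r Y = r X" if "X \<subseteq> Y" "Y \<subseteq> ground M - F" "\<And>y. y \<in> Y \<Longrightarrow> r (insert y X) = r X" for X Y
  proof -
    have "rank_of M (X \<union> F \<union> Y) = rank_of M (X \<union> F)"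
    proof (rule rank_of_Un_eq[OF M])
      show "finite Y" using that(2) 1 finite_subset by blast
      show "rank_of M (insert y (X \<union> F)) = rank_of M (X \<union> F)" if "y \<in> Y" for y
        using \<open>\<And>y. y \<in> Y \<Longrightarrow> r (insert y X) = r X\<close>[OF that] ge[of X] ge[of "insert y X"] unfolding r_def by auto
    qed
    moreover have "X \<union> F \<union> Y = Y \<union> F" using that by auto
    ultimately show ?thesis by (simp add: r_def)
  qed
  note * = matroid_of_rank_function[of "ground M - F" r, OF 1 2 3 4, folded eq]
  show "matroid (contraction M F)" using *(1) .
  show "X \<subseteq> ground M - F \<Longrightarrow> rank_of (contraction M F) X = rank_of M (X \<union> F) - rank_of M F"
    using *(2) unfolding r_def .
qed

lemma rk_contraction:
  assumes "matroid M" "F \<subseteq> ground M"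
  shows "rk (contraction M F) = rk M - rank_of M F"
proof -
  have "ground M - F \<union> F = ground M" using assms by auto
  thus ?thesis using matroid_contraction(2)[OF assms, of "ground M - F"] by (simp add: rk_def)
qed

lemma flats_contraction:
  assumes M: "matroid M" and F: "F \<subseteq> ground M"
  shows "flats (contraction M F) = (\<lambda>G. G - F) ` {G \<in> flats M. F \<subseteq> G}"
proof -
  have ge: "rank_of M F \<le> rank_of M (X \<union> F)" for X by (rule rank_of_mono[OF M]) auto
  have iff: "G \<in> flats (contraction M F) \<longleftrightarrow> G \<union> F \<in> flats M" if G: "G \<subseteq> ground M - F" for G
  proof -
    have "rank_of (contraction M F) G < rank_of (contraction M F) (insert x G) \<longleftrightarrow>
      rank_of M (G \<union> F) < rank_of M (insert x (G \<union> F))" if "x \<in> ground M - F - G" for x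
      using matroid_contraction(2)[OF M F, of G] matroid_contraction(2)[OF M F, of "insert x G"] G that
        ge[of G] ge[of "insert x G"] by auto
    moreover have "ground M - F - G = ground M - (G \<union> F)" by auto
    ultimately show ?thesis using G F by (auto simp: flats_def)
  qed
  show ?thesis
  proof (intro set_eqI iffI)
    fix G assume G: "G \<in> flats (contraction M F)"
    hence "G \<subseteq> ground M - F" using flatsD by fastforce
    thus "G \<in> (\<lambda>G. G - F) ` {G \<in> flats M. F \<subseteq> G}" using iff G by (intro image_eqI[of _ _ "G \<union> F"]) auto
  next
    fix G assume "G \<in> (\<lambda>G. G - F) ` {G \<in> flats M. F \<subseteq> G}"
    then obtain H where H: "H \<in> flats M" "F \<subseteq> H" "G = H - F" by auto
    hence "G \<subseteq> ground M - F" "G \<union> F = H" using flatsD by auto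
    thus "G \<in> flats (contraction M F)" using iff H by auto
  qed
qed

lemma inj_on_Diff_superset: "inj_on (\<lambda>G. G - F) {G \<in> A. F \<subseteq> G}"
  by (rule inj_on_inverseI[of _ "\<lambda>G. G \<union> F"]) auto

lemma loopless_contraction:
  assumes M: "matroid M" and F: "F \<in> flats M"
  shows "loopless (contraction M F)"
  unfolding loopless_def
proof
  fix x assume x: "x \<in> ground (contraction M F)"
  have "rank_of M F < rank_of M (insert x F)" using F x by (auto simp: flats_def)
  hence "rank_of M ({x} \<union> F) = rank_of M F + card {x}" using rank_of_insert_le[OF M, of x F] by auto
  thus "{x} \<in> indeps (contraction M F)"
    using indeps_contraction[OF M flatsD[OF F]] x by auto
qed

lemma contraction_contraction:
  assumes M: "matroid M" and "F \<subseteq> G" "G \<subseteq> ground M"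
  shows "contraction (contraction M F) (G - F) = contraction M G"
proof -
  have F: "F \<subseteq> ground M" using assms by auto
  have ge: "rank_of M F \<le> rank_of M X" if "F \<subseteq> X" for X using that by (rule rank_of_mono[OF M])
  have "indeps (contraction (contraction M F) (G - F)) = indeps (contraction M G)"
  proof (rule set_eqI)
    fix I
    have "I \<in> indeps (contraction (contraction M F) (G - F)) \<longleftrightarrow> I \<subseteq> ground M - G \<and>
      rank_of (contraction M F) (I \<union> (G - F)) = rank_of (contraction M F) (G - F) + card I"
      using indeps_contraction[OF matroid_contraction(1)[OF M F], of "G - F"] assms by auto
    also have "\<dots> \<longleftrightarrow> I \<subseteq> ground M - G \<and> rank_of M (I \<union> G) = rank_of M G + card I"
    proof (rule conj_cong[OF refl])
      assume I: "I \<subseteq> ground M - G"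
      have "I \<union> (G - F) \<union> F = I \<union> G" "G - F \<union> F = G" "I \<union> (G - F) \<subseteq> ground M - F" "G - F \<subseteq> ground M - F"
        using assms I by auto
      thus "(rank_of (contraction M F) (I \<union> (G - F)) = rank_of (contraction M F) (G - F) + card I)
        \<longleftrightarrow> rank_of M (I \<union> G) = rank_of M G + card I"
        using matroid_contraction(2)[OF M F, of "G - F"] matroid_contraction(2)[OF M F, of "I \<union> (G - F)"]
          ge[of G] ge[of "I \<union> G"] assms(2) by (simp add: le_supI2) linarith
    qed
    also have "\<dots> \<longleftrightarrow> I \<in> indeps (contraction M G)"
      using indeps_contraction[OF M assms(3)] by auto
    finally show "I \<in> indeps (contraction (contraction M F) (G - F)) \<longleftrightarrow> I \<in> indeps (contraction M G)" .
  qed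
  moreover have "ground M - F - (G - F) = ground M - G" using assms by auto
  ultimately show ?thesis by (simp add: contraction_def)
qed

lemma contraction_empty:
  assumes M: "matroid M"
  shows "contraction M {} = M"
proof -
  have "indeps (contraction M {}) = indeps M"
    using indeps_contraction[OF M, of "{}"] indep_iff_rank_of[OF M] matroidD(2)[OF M]
    by (auto simp: rank_of_empty[OF M])
  thus ?thesis by (simp add: contraction_def)
qed

section \<open>Kazhdan--Lusztig polynomials by palindromicity\<close>

lemma smult_sum_right: "smult c (\<Sum>i\<in>A. p i) = (\<Sum>i\<in>A. smult c (p i))"
  by (induction A rule: infinite_finite_induct) (simp_all add: smult_add_right)

section \<open>Palindromic polynomials and the half of the coefficients that determines them\<close>

definition palindromic :: "nat \<Rightarrow> int poly \<Rightarrow> bool" where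
  "palindromic d p \<longleftrightarrow> degree p \<le> d \<and> (\<forall>i\<le>d. coeff p i = coeff p (d - i))"

lemma coeff_poly_rev:
  assumes "degree p \<le> d"
  shows "coeff (poly_rev d p) i = (if i \<le> d then coeff p (d - i) else 0)"
proof -
  have "coeff (poly_rev d p) i = (\<Sum>j\<le>degree p. if d - j = i then coeff p j else 0)"
    by (simp add: poly_rev_def coeff_sum)
  also have "\<dots> = (\<Sum>j\<le>degree p. if j = d - i then (if i \<le> d then coeff p (d - i) else 0) else 0)"
    by (rule sum.cong) (use assms in auto)
  also have "\<dots> = (if i \<le> d then coeff p (d - i) else 0)"
    using coeff_eq_0[of p "d - i"] by (auto simp: not_le)
  finally show ?thesis .
qed

lemma poly_rev_sum:
  assumes "\<And>i. i \<in> A \<Longrightarrow> degree (f i) \<le> d"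
  shows "poly_rev d (\<Sum>i\<in>A. f i) = (\<Sum>i\<in>A. poly_rev d (f i))"
proof (cases "finite A")
  case True
  have "degree (\<Sum>i\<in>A. f i) \<le> d" using degree_sum_le[OF True] assms by auto
  thus ?thesis using assms by (intro poly_eqI) (auto simp: coeff_poly_rev coeff_sum)
qed (simp add: poly_rev_def)

lemma poly_rev_monom_mult:
  assumes "degree p + a \<le> d"
  shows "poly_rev d (monom 1 a * p) = poly_rev (d - a) p"
proof -
  have "degree (monom 1 a * p) \<le> d"
    using assms degree_mult_le[of "monom (1::int) a" p] degree_monom_le[of "1::int" a] by linarith
  thus ?thesis using assms
    by (intro poly_eqI) (auto simp: coeff_poly_rev coeff_monom_mult add.commute intro!: coeff_eq_0)
qed

lemma poly_rev_palindromic: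
  assumes "palindromic d p"
  shows "poly_rev d p = p"
proof (rule poly_eqI)
  fix i
  have "degree p \<le> d" "i \<le> d \<Longrightarrow> coeff p (d - i) = coeff p i"
    using assms unfolding palindromic_def by metis+
  thus "coeff (poly_rev d p) i = coeff p i" by (cases "i \<le> d") (simp_all add: coeff_poly_rev coeff_eq_0)
qed

text \<open>Below the middle the mirror coefficients of \<open>p\<close> and \<open>q\<close>
  vanish, so palindromicity expresses their coefficients through \<open>s\<close> alone.\<close>

lemma palindromic_determines:
  assumes pal: "palindromic d (p + s)" "palindromic d (q + s)"
    and deg: "2 * degree p < d" "2 * degree q < d"
  shows "p = q"
proof (rule poly_eqI)
  fix i
  show "coeff p i = coeff q i"
  proof (cases "2 * i < d")
    case True
    hence "coeff p (d - i) = 0" "coeff q (d - i) = 0" using deg by (auto intro!: coeff_eq_0)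
    moreover have "coeff (p + s) i = coeff (p + s) (d - i)" "coeff (q + s) i = coeff (q + s) (d - i)"
      using pal True unfolding palindromic_def by (metis le_add1 le_trans less_imp_le mult_2)+
    ultimately show ?thesis by simp
  qed (use deg in \<open>simp add: coeff_eq_0\<close>)
qed

text \<open>These coefficients are the ones that uniqueness forces: below the middle, the polynomial
  has to make up the difference between two mirror coefficients of \<open>s\<close>.\<close>

definition palindromic_part :: "nat \<Rightarrow> int poly \<Rightarrow> int poly" where
  "palindromic_part d s = (\<Sum>i | 2 * i < d. monom (coeff s (d - i) - coeff s i) i)"

lemma coeff_palindromic_part:
  "coeff (palindromic_part d s) i = (if 2 * i < d then coeff s (d - i) - coeff s i else 0)"
proof -
  have fin: "finite {i. 2 * i < d}" by (rule finite_subset[of _ "{..<d}"]) auto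
  have "coeff (palindromic_part d s) i =
      (\<Sum>j | 2 * j < d. if j = i then coeff s (d - i) - coeff s i else 0)"
    unfolding palindromic_part_def coeff_sum by (rule sum.cong) auto
  thus ?thesis using fin by simp
qed

lemma degree_palindromic_part: "0 < d \<Longrightarrow> 2 * degree (palindromic_part d s) < d"
  using degree_le[of "(d - 1) div 2" "palindromic_part d s"] by (force simp: coeff_palindromic_part)

lemma palindromic_palindromic_part:
  assumes "degree s \<le> d"
  shows "palindromic d (palindromic_part d s + s)"
  unfolding palindromic_def
proof
  have "degree (palindromic_part d s) \<le> d"
    by (rule degree_le) (simp add: coeff_palindromic_part)
  thus "degree (palindromic_part d s + s) \<le> d" using assms by (intro degree_add_le) auto
  show "\<forall>i\<le>d. coeff (palindromic_part d s + s) i = coeff (palindromic_part d s + s) (d - i)"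
  proof (intro allI impI)
    fix i assume i: "i \<le> d"
    consider "2 * i < d" "\<not> 2 * (d - i) < d" | "2 * (d - i) < d" "\<not> 2 * i < d" | "2 * i = d"
      using i by linarith
    thus "coeff (palindromic_part d s + s) i = coeff (palindromic_part d s + s) (d - i)"
    proof cases
      case 3
      hence "d - i = i" by simp
      thus ?thesis by simp
    qed (use i in \<open>auto simp: coeff_palindromic_part\<close>)
  qed
qed

text \<open>The flat \<open>{}\<close> is left out of the sum because its contraction is
  \<open>M\<close> itself; its term is what \<open>palindromic_part\<close> supplies.\<close>

function KL :: "'a matroid \<Rightarrow> int poly" where
  "KL M = (if \<not> (matroid M \<and> loopless M) then 0 else if rk M = 0 then 1
     else palindromic_part (rk M)
       (\<Sum>F\<in>flats M - {{}}. monom 1 (rank_of M F) * KL (contraction M F)))"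
  by pat_completeness auto
termination
proof (relation "measure (\<lambda>M. card (ground M))")
  fix M :: "'a matroid" and F
  assume "\<not> \<not> (matroid M \<and> loopless M)" and F: "F \<in> flats M - {{}}"
  hence "ground M - F \<subset> ground M" using flatsD[of F M] by auto
  thus "(contraction M F, M) \<in> measure (\<lambda>M. card (ground M))"
    using \<open>\<not> \<not> (matroid M \<and> loopless M)\<close> matroidD(1)[of M] psubset_card_mono by auto
qed simp

declare KL.simps [simp del]

definition KL_Z :: "'a matroid \<Rightarrow> int poly" where
  "KL_Z M = (\<Sum>F\<in>flats M. monom 1 (rank_of M F) * KL (contraction M F))"

lemma KL_rk_0: "matroid M \<Longrightarrow> loopless M \<Longrightarrow> rk M = 0 \<Longrightarrow> KL M = 1"
  by (simp add: KL.simps)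

lemma degree_KL: "matroid M \<Longrightarrow> loopless M \<Longrightarrow> 0 < rk M \<Longrightarrow> 2 * degree (KL M) < rk M"
  by (subst KL.simps) (simp add: degree_palindromic_part)

lemma degree_KL_le: "matroid M \<Longrightarrow> loopless M \<Longrightarrow> degree (KL M) \<le> rk M"
  using degree_KL[of M] KL_rk_0[of M] by (cases "rk M = 0") auto

lemma rank_of_le_rk: "matroid M \<Longrightarrow> F \<subseteq> ground M \<Longrightarrow> rank_of M F \<le> rk M"
  unfolding rk_def by (rule rank_of_mono)

lemma degree_KL_contraction:
  assumes "matroid M" "loopless M" "F \<in> flats M"
  shows "degree (KL (contraction M F)) + rank_of M F \<le> rk M"
  using degree_KL_le[of "contraction M F"] matroid_contraction(1)[of M F] loopless_contraction[of M F]
    rk_contraction[of M F] rank_of_le_rk[of M F] flatsD[of F M] assms by auto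

lemma degree_monom_mult_le: "degree p + a \<le> d \<Longrightarrow> degree (monom (1::int) a * p) \<le> d"
  using degree_mult_le[of "monom (1::int) a" p] degree_monom_le[of "1::int" a] by linarith

lemma flats_rk_0:
  assumes "matroid M" "loopless M" "rk M = 0"
  shows "ground M = {}"
proof (rule ccontr)
  assume "ground M \<noteq> {}"
  then obtain x where x: "x \<in> ground M" by auto
  hence "rank_of M {x} \<le> rk M" using rank_of_le_rk assms by blast
  thus False using rank_of_singleton[OF assms(1,2) x] assms(3) by simp
qed

lemma KL_Z_eq:
  assumes "matroid M" "loopless M"
  shows "KL_Z M = KL M + (\<Sum>F\<in>flats M - {{}}. monom 1 (rank_of M F) * KL (contraction M F))"
  unfolding KL_Z_def using assms
  by (subst sum.remove[OF finite_flats empty_in_flats])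
     (auto simp: rank_of_empty contraction_empty)

lemma palindromic_KL_Z:
  assumes M: "matroid M" "loopless M"
  shows "palindromic (rk M) (KL_Z M)"
proof (cases "rk M = 0")
  case True
  have "ground M = {}" by (rule flats_rk_0) (use assms True in auto)
  hence "flats M - {{}} = {}" by (auto simp: flats_def)
  hence "KL_Z M = 1" by (simp only: KL_Z_eq[OF assms] KL_rk_0[OF assms True] sum.empty add_0_right)
  thus ?thesis using True by (simp add: palindromic_def)
next
  case False
  let ?s = "\<Sum>F\<in>flats M - {{}}. monom 1 (rank_of M F) * KL (contraction M F)"
  have "degree ?s \<le> rk M"
    by (rule degree_sum_le) (use assms finite_flats degree_KL_contraction in \<open>auto intro!: degree_monom_mult_le\<close>)
  from palindromic_palindromic_part[OF this] show ?thesis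
    using False assms by (simp add: KL_Z_eq) (subst KL.simps, simp)
qed

lemma KL_Z_contraction:
  assumes M: "matroid M" "loopless M" and F: "F \<in> flats M"
  shows "KL_Z (contraction M F) =
    (\<Sum>G\<in>{G \<in> flats M. F \<subseteq> G}. monom 1 (rank_of M G - rank_of M F) * KL (contraction M G))"
proof -
  have FE: "F \<subseteq> ground M" using F by (rule flatsD)
  have "KL_Z (contraction M F) = (\<Sum>G\<in>{G \<in> flats M. F \<subseteq> G}.
      monom 1 (rank_of (contraction M F) (G - F)) * KL (contraction (contraction M F) (G - F)))"
    unfolding KL_Z_def flats_contraction[OF M(1) FE] by (rule sum.reindex_cong[OF inj_on_Diff_superset]) auto
  also have "\<dots> = (\<Sum>G\<in>{G \<in> flats M. F \<subseteq> G}. monom 1 (rank_of M G - rank_of M F) * KL (contraction M G))"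
  proof (rule sum.cong[OF refl])
    fix G assume G: "G \<in> {G \<in> flats M. F \<subseteq> G}"
    hence "G \<subseteq> ground M" "F \<subseteq> G" using flatsD by auto
    moreover from this have "G - F \<union> F = G" "G - F \<subseteq> ground M - F" by auto
    ultimately show "monom 1 (rank_of (contraction M F) (G - F)) * KL (contraction (contraction M F) (G - F)) =
      monom 1 (rank_of M G - rank_of M F) * KL (contraction M G)"
      using matroid_contraction(2)[OF M(1) FE, of "G - F"] contraction_contraction[OF M(1), of F G] by simp
  qed
  finally show ?thesis .
qed

text \<open>This is palindromicity of the Z-polynomial of the contraction at \<open>F\<close>:
  reversal in degree \<open>rk M - rank_of M F\<close> absorbs the monomials. The summands on the
  left do not mention \<open>F\<close>, which is the form required for Moebius inversion.\<close>

lemma poly_rev_KL_Z: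
  assumes M: "matroid M" "loopless M" and F: "F \<in> flats M"
  shows "(\<Sum>G\<in>{G \<in> flats M. F \<subseteq> G}. poly_rev (rk M - rank_of M G) (KL (contraction M G))) =
    (\<Sum>G\<in>{G \<in> flats M. F \<subseteq> G}. monom 1 (rank_of M G - rank_of M F) * KL (contraction M G))"
proof -
  let ?d = "rk M - rank_of M F"
  have FE: "F \<subseteq> ground M" using F by (rule flatsD)
  have deg: "degree (KL (contraction M G)) + (rank_of M G - rank_of M F) \<le> ?d"
    "rank_of M F \<le> rank_of M G" if "G \<in> flats M" "F \<subseteq> G" for G
    using degree_KL_contraction[OF M, of G] rank_of_mono[OF M(1), of F G] that by auto
  have "palindromic ?d (KL_Z (contraction M F))"
    using palindromic_KL_Z[OF matroid_contraction(1)[OF M(1) FE] loopless_contraction[OF M(1) F]]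
    by (simp add: rk_contraction[OF M(1) FE])
  from poly_rev_palindromic[OF this] have
    "poly_rev ?d (\<Sum>G\<in>{G \<in> flats M. F \<subseteq> G}. monom 1 (rank_of M G - rank_of M F) * KL (contraction M G)) =
     (\<Sum>G\<in>{G \<in> flats M. F \<subseteq> G}. monom 1 (rank_of M G - rank_of M F) * KL (contraction M G))"
    by (simp add: KL_Z_contraction[OF M F])
  moreover have "poly_rev ?d (\<Sum>G\<in>{G \<in> flats M. F \<subseteq> G}. monom 1 (rank_of M G - rank_of M F) * KL (contraction M G)) =
     (\<Sum>G\<in>{G \<in> flats M. F \<subseteq> G}. poly_rev ?d (monom 1 (rank_of M G - rank_of M F) * KL (contraction M G)))"
    by (rule poly_rev_sum) (use deg degree_monom_mult_le in auto)
  moreover have "\<dots> = (\<Sum>G\<in>{G \<in> flats M. F \<subseteq> G}. poly_rev (rk M - rank_of M G) (KL (contraction M G)))"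
    by (rule sum.cong[OF refl]) (use deg poly_rev_monom_mult in auto)
  ultimately show ?thesis by simp
qed

section \<open>Moebius inversion and the defining recursion\<close>

lemma moebius_lower:
  assumes "Y \<subseteq> G"
  shows "moebius {H \<in> L. H \<subseteq> G} X Y = moebius L X Y"
proof (cases "finite Y")
  case True
  thus ?thesis using assms
  proof (induction Y rule: finite_psubset_induct)
    case (psubset Y)
    have "(\<Sum>Z\<in>{Z \<in> {H \<in> L. H \<subseteq> G}. X \<subseteq> Z \<and> Z \<subset> Y}. moebius {H \<in> L. H \<subseteq> G} X Z) =
      (\<Sum>Z\<in>{Z \<in> L. X \<subseteq> Z \<and> Z \<subset> Y}. moebius L X Z)"
      by (rule sum.cong) (use psubset in auto)
    thus ?case by (subst (1 2) moebius.simps) simp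
  qed
qed (simp add: moebius.simps)

lemma sum_moebius:
  assumes fin: "finite L" "finite Y" and "X \<in> L" "Y \<in> L" "X \<subseteq> Y"
  shows "(\<Sum>Z\<in>{Z \<in> L. X \<subseteq> Z \<and> Z \<subseteq> Y}. moebius L X Z) = (if X = Y then 1 else 0)"
proof (cases "X = Y")
  case True
  hence "{Z \<in> L. X \<subseteq> Z \<and> Z \<subseteq> Y} = {X}" using assms by auto
  thus ?thesis using True by (simp add: moebius.simps)
next
  case False
  have "{Z \<in> L. X \<subseteq> Z \<and> Z \<subseteq> Y} = insert Y {Z \<in> L. X \<subseteq> Z \<and> Z \<subset> Y}" using assms False by auto
  hence "(\<Sum>Z\<in>{Z \<in> L. X \<subseteq> Z \<and> Z \<subseteq> Y}. moebius L X Z) =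
    moebius L X Y + (\<Sum>Z\<in>{Z \<in> L. X \<subseteq> Z \<and> Z \<subset> Y}. moebius L X Z)" using fin by simp
  also have "moebius L X Y = - (\<Sum>Z\<in>{Z \<in> L. X \<subseteq> Z \<and> Z \<subset> Y}. moebius L X Z)"
    using assms False by (subst moebius.simps) auto
  finally show ?thesis using False by simp
qed

lemma char_poly_localization:
  assumes M: "matroid M" "loopless M" and F: "F \<in> flats M"
  shows "char_poly (localization M F) =
    (\<Sum>H\<in>{H \<in> flats M. H \<subseteq> F}. monom (moebius (flats M) {} H) (rank_of M F - rank_of M H))"
proof -
  have "{} \<in> {H \<in> flats M. H \<subseteq> F}" using empty_in_flats[OF M] by auto
  hence "\<Inter>{H \<in> flats M. H \<subseteq> F} = {}" by blast
  thus ?thesis unfolding char_poly_def flats_localization[OF M(1) F] rk_localization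
    by (intro sum.cong) (auto simp: moebius_lower rank_of_localization)
qed

lemma KL_recursion:
  assumes M: "matroid M" "loopless M"
  shows "poly_rev (rk M) (KL M) = (\<Sum>F\<in>flats M. char_poly (localization M F) * KL (contraction M F))"
proof -
  let ?L = "flats M" and ?r = "rank_of M" and ?P = "\<lambda>F. KL (contraction M F)"
  let ?mu = "moebius (flats M) {}"
  let ?R = "\<lambda>G. poly_rev (rk M - ?r G) (?P G)"
  have fin: "finite ?L" by (rule finite_flats[OF M(1)])
  have swap: "(\<Sum>F\<in>?L. \<Sum>H\<in>{H \<in> ?L. H \<subseteq> F}. g F H) = (\<Sum>H\<in>?L. \<Sum>F\<in>{F \<in> ?L. H \<subseteq> F}. g F H)"
    for g :: "'a set \<Rightarrow> 'a set \<Rightarrow> int poly"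
    by (rule sum.swap_restrict[OF fin fin])
  have "(\<Sum>F\<in>?L. char_poly (localization M F) * ?P F) =
     (\<Sum>F\<in>?L. \<Sum>H\<in>{H \<in> ?L. H \<subseteq> F}. monom (?mu H) (?r F - ?r H) * ?P F)"
    by (rule sum.cong) (simp_all add: char_poly_localization[OF M] sum_distrib_right)
  \<comment> \<open>Collecting the terms with a common lower flat \<open>H\<close> produces inner
    sums to which palindromicity above \<open>H\<close> applies.\<close>
  also have "\<dots> = (\<Sum>H\<in>?L. \<Sum>F\<in>{F \<in> ?L. H \<subseteq> F}. monom (?mu H) (?r F - ?r H) * ?P F)"
    by (rule swap)
  also have "\<dots> = (\<Sum>H\<in>?L. smult (?mu H) (\<Sum>F\<in>{F \<in> ?L. H \<subseteq> F}. monom 1 (?r F - ?r H) * ?P F))"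
  proof (rule sum.cong[OF refl])
    fix H
    have "monom (?mu H) (?r F - ?r H) * ?P F = smult (?mu H) (monom 1 (?r F - ?r H) * ?P F)" for F
      by (metis mult.right_neutral mult_smult_left smult_monom)
    thus "(\<Sum>F\<in>{F \<in> ?L. H \<subseteq> F}. monom (?mu H) (?r F - ?r H) * ?P F) =
      smult (?mu H) (\<Sum>F\<in>{F \<in> ?L. H \<subseteq> F}. monom 1 (?r F - ?r H) * ?P F)"
      by (simp add: smult_sum_right)
  qed
  also have "\<dots> = (\<Sum>H\<in>?L. smult (?mu H) (\<Sum>F\<in>{F \<in> ?L. H \<subseteq> F}. ?R F))"
    by (rule sum.cong) (simp_all add: poly_rev_KL_Z[OF M])
  also have "\<dots> = (\<Sum>H\<in>?L. \<Sum>F\<in>{F \<in> ?L. H \<subseteq> F}. smult (?mu H) (?R F))"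
    by (simp add: smult_sum_right)
  also have "\<dots> = (\<Sum>F\<in>?L. \<Sum>H\<in>{H \<in> ?L. H \<subseteq> F}. smult (?mu H) (?R F))"
    by (rule swap[symmetric])
  \<comment> \<open>After the second exchange, the Moebius sums over the intervals from
    \<open>{}\<close> to \<open>F\<close> cancel unless \<open>F\<close> is empty.\<close>
  also have "\<dots> = (\<Sum>F\<in>?L. smult (\<Sum>H\<in>{H \<in> ?L. {} \<subseteq> H \<and> H \<subseteq> F}. ?mu H) (?R F))"
    by (simp add: smult_sum)
  also have "\<dots> = (\<Sum>F\<in>?L. if F = {} then ?R {} else 0)"
  proof (rule sum.cong[OF refl])
    fix F assume F: "F \<in> ?L"
    have "finite F" using flatsD[OF F] matroidD(1)[OF M(1)] finite_subset by blast
    thus "smult (\<Sum>H\<in>{H \<in> ?L. {} \<subseteq> H \<and> H \<subseteq> F}. ?mu H) (?R F) = (if F = {} then ?R {} else 0)"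
      using sum_moebius[OF fin _ empty_in_flats[OF M] F] by auto
  qed
  also have "\<dots> = ?R {}" using fin empty_in_flats[OF M] by simp
  also have "\<dots> = poly_rev (rk M) (KL M)"
    by (simp add: contraction_empty[OF M(1)] rank_of_empty[OF M(1)])
  finally show ?thesis by simp
qed

lemma KL_assignment_KL: "KL_assignment KL"
  unfolding KL_assignment_def by (auto simp: KL_rk_0 degree_KL KL_recursion)

text \<open>By induction two assignments agree on contractions at nonempty flats, and the
  localization at \<open>{}\<close> has characteristic polynomial 1. So
  \<open>poly_rev (rk M) (P M) - P M\<close> is the same for both, and the degree bound keeps its
  two terms from overlapping.\<close>

lemma KL_assignment_unique:
  fixes P :: "'a matroid \<Rightarrow> int poly"
  assumes P: "KL_assignment P" and "matroid M" "loopless M"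
  shows "P M = KL M"
  using assms(2,3)
proof (induction "card (ground M)" arbitrary: M rule: less_induct)
  case less
  note M = less.prems
  have E0: "{} \<in> flats M" by (rule empty_in_flats[OF M])
  have rec: "poly_rev (rk M) (Q M) = Q M +
      (\<Sum>F\<in>flats M - {{}}. char_poly (localization M F) * Q (contraction M F))"
    if Q: "KL_assignment Q" for Q :: "'a matroid \<Rightarrow> int poly"
  proof -
    have "{H \<in> flats M. H \<subseteq> {}} = {{}}" using E0 by auto
    hence "char_poly (localization M {}) = 1"
      by (simp add: char_poly_localization[OF M E0] moebius.simps)
    moreover have "poly_rev (rk M) (Q M) = (\<Sum>F\<in>flats M. char_poly (localization M F) * Q (contraction M F))"
      using Q M unfolding KL_assignment_def by blast
    ultimately show ?thesis
      by (simp add: sum.remove[OF finite_flats[OF M(1)] E0] contraction_empty[OF M(1)])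
  qed
  have "P (contraction M F) = KL (contraction M F)" if F: "F \<in> flats M - {{}}" for F
  proof (rule less.hyps)
    have "ground M - F \<subset> ground M" using F flatsD[of F M] by auto
    thus "card (ground (contraction M F)) < card (ground M)"
      using psubset_card_mono matroidD(1)[OF M(1)] by auto
    show "matroid (contraction M F)" "loopless (contraction M F)"
      using F matroid_contraction(1)[OF M(1) flatsD] loopless_contraction[OF M(1)] by auto
  qed
  hence eq: "poly_rev (rk M) (P M) - P M = poly_rev (rk M) (KL M) - KL M"
    by (simp add: rec[OF P] rec[OF KL_assignment_KL])
  show "P M = KL M"
  proof (cases "rk M = 0")
    case True
    thus ?thesis using P M KL_rk_0[OF M] unfolding KL_assignment_def by auto
  next
    case False
    have deg: "2 * degree (P M) < rk M" "2 * degree (KL M) < rk M"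
      using P M False degree_KL[OF M] unfolding KL_assignment_def by auto
    have "coeff (P M) i = coeff (KL M) i" for i
    proof (cases "2 * i < rk M")
      case True
      hence "coeff (P M) (rk M - i) = 0" "coeff (KL M) (rk M - i) = 0"
        using deg by (auto intro!: coeff_eq_0)
      moreover have "coeff (poly_rev (rk M) (P M) - P M) i = coeff (poly_rev (rk M) (KL M) - KL M) i"
        by (simp add: eq)
      moreover have "degree (P M) \<le> rk M" "degree (KL M) \<le> rk M" using deg by auto
      ultimately show ?thesis by (simp add: coeff_poly_rev split: if_splits)
    qed (use deg in \<open>auto simp: coeff_eq_0\<close>)
    thus ?thesis by (rule poly_eqI)
  qed
qed

theorem KL_poly_eq_KL: "KL_poly = KL"
  unfolding KL_poly_def
proof (rule the_equality)
  show "KL_assignment KL \<and> (\<forall>M. \<not> (matroid M \<and> loopless M) \<longrightarrow> KL M = 0)"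
    using KL_assignment_KL by (auto simp: KL.simps)
  show "P = KL" if "KL_assignment P \<and> (\<forall>M. \<not> (matroid M \<and> loopless M) \<longrightarrow> P M = 0)" for P
  proof
    fix M show "P M = KL M"
      using that KL_assignment_unique[of P M] by (cases "matroid M \<and> loopless M") (auto simp: KL.simps)
  qed
qed

text \<open>Candidates are attached to the flats of one matroid, so no isomorphism types enter. The
  induction descends from the top flat: once the candidates above \<open>F\<close> are right,
  \<open>q F\<close> and the true polynomial complete the same sum to a palindromic one.\<close>

lemma KL_contraction_eqI:
  assumes M: "matroid M" "loopless M"
    and top: "q (ground M) = 1"
    and deg: "\<And>F. F \<in> flats M \<Longrightarrow> F \<noteq> ground M \<Longrightarrow> 2 * degree (q F) < rk M - rank_of M F"
    and pal: "\<And>F. F \<in> flats M \<Longrightarrow> palindromic (rk M - rank_of M F)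
      (\<Sum>G\<in>{G \<in> flats M. F \<subseteq> G}. monom 1 (rank_of M G - rank_of M F) * q G)"
    and "F \<in> flats M"
  shows "KL (contraction M F) = q F"
  using assms(6)
proof (induction "card (ground M - F)" arbitrary: F rule: less_induct)
  case less
  note F = less.prems
  have FE: "F \<subseteq> ground M" by (rule flatsD[OF F])
  have C: "matroid (contraction M F)" "loopless (contraction M F)" "rk (contraction M F) = rk M - rank_of M F"
    by (simp_all add: matroid_contraction(1)[OF M(1) FE] loopless_contraction[OF M(1) F] rk_contraction[OF M(1) FE])
  show "KL (contraction M F) = q F"
  proof (cases "F = ground M")
    case True
    thus ?thesis using top KL_rk_0[OF C(1,2)] C(3) by (simp add: rk_def)
  next
    case False
    hence pos: "0 < rk M - rank_of M F"
      using rank_of_flat_less[OF M(1) F, of "ground M"] FE by (auto simp: rk_def)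
    let ?U = "{G \<in> flats M. F \<subseteq> G}"
    let ?s = "\<Sum>G\<in>?U - {F}. monom 1 (rank_of M G - rank_of M F) * q G"
    have fin: "finite ?U" and mem: "F \<in> ?U" using finite_flats[OF M(1)] F by auto
    have "KL (contraction M G) = q G" if G: "G \<in> ?U - {F}" for G
    proof (rule less.hyps)
      show "G \<in> flats M" using G by auto
      have "ground M - G \<subset> ground M - F" using G flatsD[of G M] by auto
      thus "card (ground M - G) < card (ground M - F)"
        using psubset_card_mono matroidD(1)[OF M(1)] by blast
    qed
    hence "KL_Z (contraction M F) = KL (contraction M F) + ?s"
      by (simp add: KL_Z_contraction[OF M F] sum.remove[OF fin mem])
    hence "palindromic (rk M - rank_of M F) (KL (contraction M F) + ?s)"
      using palindromic_KL_Z[OF C(1,2)] C(3) by simp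
    moreover have "palindromic (rk M - rank_of M F) (q F + ?s)"
      using pal[OF F] by (simp add: sum.remove[OF fin mem])
    ultimately show ?thesis
      using deg[OF F False] degree_KL[OF C(1,2)] C(3) pos by (intro palindromic_determines) auto
  qed
qed

section \<open>Matroids from their lattices of flats\<close>

text \<open>\<open>cover\<close> takes the place of the usual axiom on covers in a lattice of flats.
  Independence is phrased as separability of each element from the others by a flat, a form that can
  be compared directly with the cycles of a graph.\<close>

lemma matroid_of_flats:
  fixes L :: "'a set set" and \<rho> :: "'a set \<Rightarrow> nat"
  assumes fin: "finite E" and sub: "\<And>F. F \<in> L \<Longrightarrow> F \<subseteq> E"
    and top: "E \<in> L" and bot: "{} \<in> L" "\<rho> {} = 0"
    and Int: "\<And>F G. F \<in> L \<Longrightarrow> G \<in> L \<Longrightarrow> F \<inter> G \<in> L"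
    and mono: "\<And>F G. F \<in> L \<Longrightarrow> G \<in> L \<Longrightarrow> F \<subset> G \<Longrightarrow> \<rho> F < \<rho> G"
    and cover: "\<And>F x. F \<in> L \<Longrightarrow> x \<in> E - F \<Longrightarrow> \<exists>G\<in>L. insert x F \<subseteq> G \<and> \<rho> G \<le> Suc (\<rho> F)"
  defines "M \<equiv> \<lparr>ground = E, indeps = {I. I \<subseteq> E \<and> (\<forall>x\<in>I. \<exists>F\<in>L. I - {x} \<subseteq> F \<and> x \<notin> F)}\<rparr>"
  shows "matroid M" and "flats M = L" and "F \<in> L \<Longrightarrow> rank_of M F = \<rho> F"
proof -
  define cl where "cl A = \<Inter>{F \<in> L. A \<subseteq> F}" for A
  define r where "r A = \<rho> (cl A)" for A
  have finL: "finite L" using fin sub finite_subset[of L "Pow E"] by auto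
  have Inter: "\<Inter>S \<in> L" if "finite S" "S \<noteq> {}" "S \<subseteq> L" for S
    using that by (induction rule: finite_ne_induct) (auto intro: Int)
  have cl_L: "cl A \<in> L" if "A \<subseteq> E" for A
    unfolding cl_def using finL that top by (intro Inter) auto
  have cl_ge: "A \<subseteq> cl A" for A by (auto simp: cl_def)
  have cl_least: "cl A \<subseteq> F" if "F \<in> L" "A \<subseteq> F" for A F using that by (auto simp: cl_def)
  have cl_eq: "cl F = F" if "F \<in> L" for F using cl_least[OF that] cl_ge by blast
  have cl_mono: "cl A \<subseteq> cl B" if "A \<subseteq> B" for A B using that by (auto simp: cl_def)
  have rho_mono: "\<rho> F \<le> \<rho> G" if "F \<in> L" "G \<in> L" "F \<subseteq> G" for F G
    using mono[OF that(1,2)] that(3) by (cases "F = G") (auto simp: psubset_eq)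
  have r_in: "r (insert x X) = r X" if "X \<subseteq> E" "x \<in> cl X" for x X
  proof -
    have "cl (insert x X) \<subseteq> cl X" using that cl_L cl_ge by (intro cl_least) auto
    hence "cl (insert x X) = cl X" using cl_mono[of X "insert x X"] by auto
    thus ?thesis by (simp add: r_def)
  qed
  have r_notin: "r (insert x X) = Suc (r X)" if X: "X \<subseteq> E" "x \<in> E" "x \<notin> cl X" for x X
  proof -
    obtain G where G: "G \<in> L" "insert x (cl X) \<subseteq> G" "\<rho> G \<le> Suc (\<rho> (cl X))"
      using cover[OF cl_L[OF X(1)], of x] X by auto
    have "cl (insert x X) \<subseteq> G" using G cl_ge[of X] by (intro cl_least) auto
    hence "\<rho> (cl (insert x X)) \<le> Suc (\<rho> (cl X))"
      using rho_mono[of "cl (insert x X)" G] cl_L[of "insert x X"] G that by auto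
    moreover have "cl X \<subset> cl (insert x X)" using cl_mono[of X "insert x X"] cl_ge[of "insert x X"] that by auto
    hence "\<rho> (cl X) < \<rho> (cl (insert x X))" using that by (intro mono cl_L) auto
    ultimately show ?thesis by (simp add: r_def)
  qed
  have 2: "r {} = 0" using cl_eq[OF bot(1)] bot(2) by (simp add: r_def)
  have 3: "r X \<le> r (insert x X) \<and> r (insert x X) \<le> Suc (r X)" if "X \<subseteq> E" "x \<in> E" for x X
    using r_in[OF that(1), of x] r_notin[OF that] by (cases "x \<in> cl X") auto
  have 4: "r Y = r X" if "X \<subseteq> Y" "Y \<subseteq> E" "\<And>y. y \<in> Y \<Longrightarrow> r (insert y X) = r X" for X Y
  proof -
    have "Y \<subseteq> cl X"
    proof
      fix y assume "y \<in> Y"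
      show "y \<in> cl X"
      proof (rule ccontr)
        assume "y \<notin> cl X"
        hence "r (insert y X) = Suc (r X)" using that \<open>y \<in> Y\<close> by (intro r_notin) auto
        thus False using that(3)[OF \<open>y \<in> Y\<close>] by simp
      qed
    qed
    hence "cl Y \<subseteq> cl X" using that cl_L by (intro cl_least) auto
    hence "cl Y = cl X" using cl_mono[OF that(1)] by auto
    thus ?thesis by (simp add: r_def)
  qed
  \<comment> \<open>An element is separable from the rest of \<open>I\<close> by a flat exactly if
    it lies outside their closure. If this holds for all of them, adding the elements in any order
    raises the rank by one each time.\<close>
  have ind: "r I = card I \<longleftrightarrow> (\<forall>x\<in>I. \<exists>F\<in>L. I - {x} \<subseteq> F \<and> x \<notin> F)" if I: "I \<subseteq> E" for I
  proof -
    have finI: "finite I" using I fin finite_subset by auto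
    have le: "r J \<le> card J" if "finite J" "J \<subseteq> E" for J
      using that
    proof (induction J)
      case (insert x J)
      thus ?case using 3[of J x] by auto
    qed (simp add: 2)
    have notin_cl: "(\<exists>F\<in>L. J \<subseteq> F \<and> x \<notin> F) \<longleftrightarrow> x \<notin> cl J" if "J \<subseteq> E" for J x
      using cl_L[OF that] cl_ge[of J] cl_least by blast
    have "(\<forall>x\<in>I. \<exists>F\<in>L. I - {x} \<subseteq> F \<and> x \<notin> F) \<longleftrightarrow> (\<forall>x\<in>I. x \<notin> cl (I - {x}))"
    proof (rule ball_cong[OF refl])
      fix x
      have "I - {x} \<subseteq> E" using I by blast
      thus "(\<exists>F\<in>L. I - {x} \<subseteq> F \<and> x \<notin> F) \<longleftrightarrow> x \<notin> cl (I - {x})" by (rule notin_cl)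
    qed
    also have "\<dots> \<longleftrightarrow> r I = card I"
    proof
      assume *: "\<forall>x\<in>I. x \<notin> cl (I - {x})"
      have "r J = card J" if "J \<subseteq> I" for J
        using finite_subset[OF that finI] that
      proof (induction J)
        case (insert x J)
        hence "J \<subseteq> I - {x}" by auto
        hence "x \<notin> cl J" using * cl_mono[of J "I - {x}"] insert.prems by auto
        thus ?case using insert r_notin[of J x] I by auto
      qed (simp add: 2)
      thus "r I = card I" by auto
    next
      assume *: "r I = card I"
      show "\<forall>x\<in>I. x \<notin> cl (I - {x})"
      proof (intro ballI notI)
        fix x assume x: "x \<in> I" "x \<in> cl (I - {x})"
        hence "r (insert x (I - {x})) = r (I - {x})" using I by (intro r_in) auto
        moreover have "insert x (I - {x}) = I" using x by auto
        ultimately have "card I = r (I - {x})" using * by simp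
        also have "\<dots> \<le> card (I - {x})" using finI I by (intro le) auto
        also have "\<dots> < card I" by (rule card_Diff1_less[OF finI x(1)])
        finally show False by simp
      qed
    qed
    finally show ?thesis by simp
  qed
  have M: "M = \<lparr>ground = E, indeps = {I. I \<subseteq> E \<and> r I = card I}\<rparr>"
    unfolding M_def using ind by auto
  note R = matroid_of_rank_function[of E r, OF fin 2 3 4, folded M]
  show "matroid M" using R(1) .
  have rk: "rank_of M X = r X" if "X \<subseteq> E" for X by (rule R(2)[OF _ _ _ _ _ that])
  show "rank_of M F = \<rho> F" if "F \<in> L" using rk[OF sub[OF that]] cl_eq[OF that] by (simp add: r_def)
  have "F \<in> flats M \<longleftrightarrow> F \<in> L" for F
  proof -
    have "F \<in> flats M \<longleftrightarrow> F \<subseteq> E \<and> (\<forall>x\<in>E - F. r F < r (insert x F))"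
      using rk by (auto simp: flats_def M_def)
    also have "\<dots> \<longleftrightarrow> F \<subseteq> E \<and> (\<forall>x\<in>E - F. x \<notin> cl F)"
      using r_in[of F] r_notin[of F] by (metis Diff_iff lessI less_irrefl)
    also have "\<dots> \<longleftrightarrow> F \<subseteq> E \<and> cl F = F"
      using cl_ge[of F] cl_L[of F] sub[of "cl F"] by blast
    also have "\<dots> \<longleftrightarrow> F \<in> L" using cl_L[of F] cl_eq[of F] sub[of F] by metis
    finally show ?thesis .
  qed
  thus "flats M = L" by blast
qed

section \<open>The flats of the whirl\<close>

definition nxt :: "nat \<Rightarrow> nat \<Rightarrow> nat" where
  "nxt n i = (if i = n then 1 else Suc i)"

lemma nxt_in: "i \<in> {1..n} \<Longrightarrow> nxt n i \<in> {1..n}"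
  by (auto simp: nxt_def)

lemma nxt_inj: "i \<in> {1..n} \<Longrightarrow> j \<in> {1..n} \<Longrightarrow> nxt n i = nxt n j \<Longrightarrow> i = j"
  by (cases "i = n"; cases "j = n") (simp_all add: nxt_def)

lemma funpow_nxt: "i \<in> {1..n} \<Longrightarrow> (nxt n ^^ d) i = Suc ((i - 1 + d) mod n)"
  by (induction d; cases i) (auto simp: nxt_def mod_Suc)

lemma mod_add_cancel_nat:
  fixes a k l n :: nat
  assumes "(a + k) mod n = (a + l) mod n"
  shows "k mod n = l mod n"
proof -
  have "(int a + int k) mod int n = (int a + int l) mod int n" by (metis assms of_nat_add of_nat_mod)
  hence "int k mod int n = int l mod int n" by (simp add: mod_eq_dvd_iff)
  thus ?thesis by (metis of_nat_mod of_nat_eq_iff)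
qed

lemma funpow_nxt_in: "i \<in> {1..n} \<Longrightarrow> (nxt n ^^ d) i \<in> {1..n}"
  by (induction d) (use nxt_in in auto)

text \<open>Induction around the cycle: upwards from \<open>a\<close> to \<open>n\<close>, on to
  \<open>1\<close>, and upwards again.\<close>

lemma nxt_cycle_induct:
  assumes "a \<in> {1..n}" "P a" and step: "\<And>i. i \<in> {1..n} \<Longrightarrow> P i \<Longrightarrow> P (nxt n i)" and "j \<in> {1..n}"
  shows "P j"
proof -
  have up: "P j" if "P i" "i \<in> {1..n}" "i \<le> j" "j \<le> n" for i j
    using that(3,4)
  proof (induction j rule: dec_induct)
    case (step k)
    thus ?case using assms(3)[of k] that by (auto simp: nxt_def split: if_splits)
  qed (use that in auto)
  have "P n" using up[of a n] assms by auto
  hence "P 1" using step[of n] assms by (auto simp: nxt_def)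
  thus ?thesis using up[of 1 j] assms by auto
qed

text \<open>The conditions on triangles and on the ends of rim edges are shared with the wheel. The
  last one reflects the relaxation: the rim is a basis, so a flat containing it is everything, while
  \<open>n - 1\<close> rim edges without spokes now form a flat.\<close>

definition whirl_flats :: "nat \<Rightarrow> wheel_edge set set" where
  "whirl_flats n = {F. F \<subseteq> wheel_edges n \<and>
     (\<forall>i\<in>{1..n}. (Spoke i \<in> F \<and> Spoke (nxt n i) \<in> F \<longrightarrow> Rim i \<in> F) \<and>
        (Rim i \<in> F \<longrightarrow> (Spoke i \<in> F \<longleftrightarrow> Spoke (nxt n i) \<in> F))) \<and>
     (rim n \<subseteq> F \<longrightarrow> Spoke 1 \<in> F)}"

text \<open>For a flat, the indices not counted are the last vertices of the rim paths that are not
  joined to the hub, so this is \<open>n\<close> minus the number of components missing the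
  hub.\<close>

definition whirl_rank :: "nat \<Rightarrow> wheel_edge set \<Rightarrow> nat" where
  "whirl_rank n F = card {i \<in> {1..n}. Spoke i \<in> F \<or> Rim i \<in> F}"

lemma Spoke_in_wheel [simp]: "Spoke i \<in> wheel_edges n \<longleftrightarrow> i \<in> {1..n}"
  and Rim_in_wheel [simp]: "Rim i \<in> wheel_edges n \<longleftrightarrow> i \<in> {1..n}"
  and Rim_in_rim [simp]: "Rim i \<in> rim n \<longleftrightarrow> i \<in> {1..n}"
  and Spoke_in_rim [simp]: "Spoke i \<notin> rim n"
  by (auto simp: wheel_edges_def rim_def)

lemma finite_wheel_edges: "finite (wheel_edges n)"
  by (simp add: wheel_edges_def rim_def)

lemma rim_subset_iff: "rim n \<subseteq> F \<longleftrightarrow> (\<forall>i\<in>{1..n}. Rim i \<in> F)"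
  by (auto simp: rim_def)

lemma whirl_flatsD:
  assumes "F \<in> whirl_flats n"
  shows "F \<subseteq> wheel_edges n"
    and "i \<in> {1..n} \<Longrightarrow> Spoke i \<in> F \<Longrightarrow> Spoke (nxt n i) \<in> F \<Longrightarrow> Rim i \<in> F"
    and "i \<in> {1..n} \<Longrightarrow> Rim i \<in> F \<Longrightarrow> Spoke i \<in> F \<longleftrightarrow> Spoke (nxt n i) \<in> F"
    and "rim n \<subseteq> F \<Longrightarrow> Spoke 1 \<in> F"
  using assms unfolding whirl_flats_def by blast+

lemma whirl_flats_rim:
  assumes F: "F \<in> whirl_flats n" and "rim n \<subseteq> F" and "j \<in> {1..n}"
  shows "Spoke j \<in> F"
proof (rule nxt_cycle_induct[of 1 n "\<lambda>j. Spoke j \<in> F"])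
  show "Spoke (nxt n i) \<in> F" if "i \<in> {1..n}" "Spoke i \<in> F" for i
    using whirl_flatsD(3)[OF F that(1)] that assms(2) by (auto simp: rim_subset_iff)
qed (use assms whirl_flatsD(4)[OF F] in auto)

text \<open>If the same indices were counted, some \<open>Spoke j\<close> would lie in
  \<open>G\<close> but not in \<open>F\<close>, hence \<open>Rim j\<close> in \<open>F\<close>. This
  passes the situation on to the next vertex, so \<open>F\<close> would contain the whole rim and
  therefore \<open>Spoke 1\<close>.\<close>

lemma whirl_rank_strict_mono:
  assumes F: "F \<in> whirl_flats n" and G: "G \<in> whirl_flats n" and "F \<subset> G"
  shows "whirl_rank n F < whirl_rank n G"
proof -
  let ?D = "\<lambda>F. {i \<in> {1..n}. Spoke i \<in> F \<or> Rim i \<in> F}"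
  have "?D F \<noteq> ?D G"
  proof
    assume eq: "?D F = ?D G"
    have D: "Spoke i \<in> F \<or> Rim i \<in> F" if "i \<in> {1..n}" "Spoke i \<in> G \<or> Rim i \<in> G" for i
      using eq that by blast
    obtain x where x: "x \<in> G" "x \<notin> F" using assms(3) by auto
    have "\<exists>j\<in>{1..n}. Spoke j \<in> G \<and> Spoke j \<notin> F"
    proof (cases x)
      case (Rim i)
      hence i: "i \<in> {1..n}" using x whirl_flatsD(1)[OF G] by auto
      hence "Spoke i \<in> F" using D[OF i] x Rim by auto
      hence "Spoke (nxt n i) \<notin> F" using whirl_flatsD(2)[OF F i] x Rim by auto
      moreover have "Spoke (nxt n i) \<in> G"
        using whirl_flatsD(3)[OF G i] x Rim \<open>Spoke i \<in> F\<close> assms(3) by auto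
      ultimately show ?thesis using nxt_in[OF i] by auto
    next
      case (Spoke i)
      hence "i \<in> {1..n}" using x whirl_flatsD(1)[OF G] by auto
      thus ?thesis using Spoke x by blast
    qed
    then obtain j where j: "j \<in> {1..n}" "Spoke j \<in> G \<and> Spoke j \<notin> F" by auto
    have all: "Spoke i \<in> G \<and> Spoke i \<notin> F" if "i \<in> {1..n}" for i
    proof (rule nxt_cycle_induct[where P = "\<lambda>i. Spoke i \<in> G \<and> Spoke i \<notin> F", OF j _ that])
      fix i assume i: "i \<in> {1..n}" "Spoke i \<in> G \<and> Spoke i \<notin> F"
      hence "Rim i \<in> F" using D[of i] by auto
      thus "Spoke (nxt n i) \<in> G \<and> Spoke (nxt n i) \<notin> F"
        using whirl_flatsD(3)[OF G i(1)] whirl_flatsD(3)[OF F i(1)] i assms(3) by auto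
    qed
    hence "rim n \<subseteq> F" unfolding rim_subset_iff using D by blast
    hence "Spoke 1 \<in> F" by (rule whirl_flatsD(4)[OF F])
    thus False using all[of 1] j(1) by auto
  qed
  hence "?D F \<subset> ?D G" using assms(3) by auto
  thus ?thesis unfolding whirl_rank_def by (intro psubset_card_mono) auto
qed

text \<open>The vertices from which rim edges of \<open>F\<close> lead forward to \<open>e\<close>.
  If \<open>Rim e\<close> is missing from \<open>F\<close>, this is the whole rim component with
  last vertex \<open>e\<close>.\<close>

inductive_set rim_ancestors :: "nat \<Rightarrow> wheel_edge set \<Rightarrow> nat \<Rightarrow> nat set"
  for n :: nat and F :: "wheel_edge set" and e :: nat where
  self: "e \<in> rim_ancestors n F e"
| step: "nxt n j \<in> rim_ancestors n F e \<Longrightarrow> j \<in> {1..n} \<Longrightarrow> Rim j \<in> F \<Longrightarrow> j \<in> rim_ancestors n F e"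

text \<open>Joining one component to the hub costs a single unit of rank: each of its vertices other
  than \<open>e\<close> is already counted through its rim edge.\<close>

lemma whirl_flats_add_component:
  assumes F: "F \<in> whirl_flats n" and e: "e \<in> {1..n}" "Spoke e \<notin> F" "Rim e \<notin> F"
  defines "Z \<equiv> {i \<in> {1..n}. Spoke i \<in> F \<or> i \<in> rim_ancestors n F e}"
  defines "G \<equiv> F \<union> Spoke ` Z \<union> Rim ` {i \<in> {1..n}. i \<in> Z \<and> nxt n i \<in> Z}"
  shows "G \<in> whirl_flats n" and "whirl_rank n G \<le> Suc (whirl_rank n F)"
proof -
  let ?R = "rim_ancestors n F e"
  have cases: "i = e \<or> (nxt n i \<in> ?R \<and> Rim i \<in> F)" if "i \<in> ?R" for i
    using that by (cases rule: rim_ancestors.cases) auto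
  have sp: "Spoke i \<in> G \<longleftrightarrow> i \<in> Z" for i
    using whirl_flatsD(1)[OF F] by (auto simp: G_def Z_def)
  have rm: "Rim i \<in> G \<longleftrightarrow> Rim i \<in> F \<or> (i \<in> {1..n} \<and> i \<in> Z \<and> nxt n i \<in> Z)" for i
    by (auto simp: G_def)
  have eq: "i \<in> Z \<longleftrightarrow> nxt n i \<in> Z" if i: "i \<in> {1..n}" "Rim i \<in> F" for i
    using whirl_flatsD(3)[OF F i] cases[of i] e rim_ancestors.step[of n i F e] i nxt_in[OF i(1)]
    by (auto simp: Z_def)
  have eq': "i \<in> Z \<longleftrightarrow> nxt n i \<in> Z" if i: "i \<in> {1..n}" "Rim i \<in> G" for i
    using eq[OF i(1)] i(2) rm by auto
  have "e \<in> Z" using e by (auto simp: Z_def intro: rim_ancestors.self)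
  have "1 \<in> Z" if "rim n \<subseteq> G"
  proof (rule nxt_cycle_induct[of e n "\<lambda>i. i \<in> Z"])
    show "nxt n i \<in> Z" if "i \<in> {1..n}" "i \<in> Z" for i
      using eq'[OF that(1)] that \<open>rim n \<subseteq> G\<close> by (auto simp: rim_subset_iff)
  qed (use e \<open>e \<in> Z\<close> in auto)
  moreover have "G \<subseteq> wheel_edges n" using whirl_flatsD(1)[OF F] by (auto simp: G_def Z_def)
  ultimately show "G \<in> whirl_flats n"
    unfolding whirl_flats_def using eq' rm sp by auto
  have "{i \<in> {1..n}. Spoke i \<in> G \<or> Rim i \<in> G} \<subseteq> insert e {i \<in> {1..n}. Spoke i \<in> F \<or> Rim i \<in> F}"
    using cases by (auto simp: sp rm Z_def)
  hence "whirl_rank n G \<le> card (insert e {i \<in> {1..n}. Spoke i \<in> F \<or> Rim i \<in> F})"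
    unfolding whirl_rank_def by (intro card_mono) auto
  also have "\<dots> \<le> Suc (whirl_rank n F)" unfolding whirl_rank_def by (rule card_insert_le_m1) auto
  finally show "whirl_rank n G \<le> Suc (whirl_rank n F)" .
qed

text \<open>Following rim edges of \<open>F\<close> forward from \<open>i\<close> leads to a vertex
  whose rim edge is missing. Otherwise the whole rim would lie in \<open>F\<close>, and with it
  every spoke.\<close>

lemma whirl_flats_add_spoke:
  assumes F: "F \<in> whirl_flats n" and i: "i \<in> {1..n}" "Spoke i \<notin> F"
  obtains G where "G \<in> whirl_flats n" "insert (Spoke i) F \<subseteq> G" "whirl_rank n G \<le> Suc (whirl_rank n F)"
proof -
  have "\<exists>e\<in>{1..n}. Spoke e \<notin> F \<and> Rim e \<notin> F \<and> i \<in> rim_ancestors n F e"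
  proof (rule ccontr)
    assume no: "\<not> ?thesis"
    let ?P = "\<lambda>j. Spoke j \<notin> F \<and> (\<forall>e\<in>{1..n}. Spoke e \<notin> F \<longrightarrow> Rim e \<notin> F \<longrightarrow> j \<notin> rim_ancestors n F e)"
    have R: "Rim j \<in> F" if "?P j" "j \<in> {1..n}" for j using that rim_ancestors.self by blast
    have all: "?P j" if "j \<in> {1..n}" for j
    proof (rule nxt_cycle_induct[OF i(1) _ _ that])
      show "?P i" using no i by blast
      show "?P (nxt n j)" if "j \<in> {1..n}" "?P j" for j
        using R[OF that(2,1)] that whirl_flatsD(3)[OF F that(1)] rim_ancestors.step[of n j F] by blast
    qed
    hence "rim n \<subseteq> F" unfolding rim_subset_iff using R by blast
    thus False using whirl_flats_rim[OF F _ i(1)] i(2) by blast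
  qed
  then obtain e where e: "e \<in> {1..n}" "Spoke e \<notin> F" "Rim e \<notin> F" "i \<in> rim_ancestors n F e" by blast
  note G = whirl_flats_add_component[OF F e(1-3)]
  show ?thesis by (rule that[OF G(1) _ G(2)]) (use e i in auto)
qed

lemma wheel_edges_in_whirl_flats: "1 \<le> n \<Longrightarrow> wheel_edges n \<in> whirl_flats n"
  using nxt_in by (auto simp: whirl_flats_def)

lemma whirl_rank_wheel_edges: "whirl_rank n (wheel_edges n) = n"
proof -
  have "{i \<in> {1..n}. Spoke i \<in> wheel_edges n \<or> Rim i \<in> wheel_edges n} = {1..n}" by auto
  thus ?thesis unfolding whirl_rank_def by simp
qed

lemma whirl_flats_cover:
  assumes n: "1 \<le> n" and F: "F \<in> whirl_flats n" and x: "x \<in> wheel_edges n - F"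
  shows "\<exists>G\<in>whirl_flats n. insert x F \<subseteq> G \<and> whirl_rank n G \<le> Suc (whirl_rank n F)"
proof (cases x)
  case (Spoke i)
  hence "i \<in> {1..n}" "Spoke i \<notin> F" using x by auto
  then obtain G where "G \<in> whirl_flats n" "insert (Spoke i) F \<subseteq> G" "whirl_rank n G \<le> Suc (whirl_rank n F)"
    by (rule whirl_flats_add_spoke[OF F])
  thus ?thesis using Spoke by blast
next
  case (Rim i)
  hence i: "i \<in> {1..n}" "Rim i \<notin> F" using x by auto
  note ni = nxt_in[OF i(1)]
  consider "Spoke i \<in> F" | "Spoke i \<notin> F" "Spoke (nxt n i) \<in> F" | "Spoke i \<notin> F" "Spoke (nxt n i) \<notin> F"
    by blast
  thus ?thesis
  proof cases
    case 1
    hence "Spoke (nxt n i) \<notin> F" using whirl_flatsD(2)[OF F i(1)] i(2) by auto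
    then obtain G where G: "G \<in> whirl_flats n" "insert (Spoke (nxt n i)) F \<subseteq> G" "whirl_rank n G \<le> Suc (whirl_rank n F)"
      using whirl_flats_add_spoke[OF F ni] by blast
    moreover have "Rim i \<in> G" using whirl_flatsD(2)[OF G(1) i(1)] G(2) 1 by auto
    ultimately show ?thesis using Rim by auto
  next
    case 2
    then obtain G where G: "G \<in> whirl_flats n" "insert (Spoke i) F \<subseteq> G" "whirl_rank n G \<le> Suc (whirl_rank n F)"
      using whirl_flats_add_spoke[OF F i(1)] by blast
    moreover have "Rim i \<in> G" using whirl_flatsD(2)[OF G(1) i(1)] G(2) 2 by auto
    ultimately show ?thesis using Rim by auto
  next
    case 3
    let ?D = "{j \<in> {1..n}. Spoke j \<in> F \<or> Rim j \<in> F}"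
    have iD: "i \<notin> ?D" using 3 i by auto
    \<comment> \<open>Inserting the edge gives a flat unless it completes the rim. In that case
      \<open>F\<close> already has rank at least \<open>n - 1\<close>, and the full ground set
      serves as cover.\<close>
    show ?thesis
    proof (cases "rim n \<subseteq> insert x F \<and> Spoke 1 \<notin> F")
      case True
      hence "{1..n} - {i} \<subseteq> ?D" by (auto simp: rim_subset_iff Rim)
      hence "card ({1..n} - {i}) \<le> card ?D" by (intro card_mono) auto
      hence "n \<le> Suc (whirl_rank n F)" using i by (simp add: whirl_rank_def)
      thus ?thesis
        using wheel_edges_in_whirl_flats[OF n] whirl_flatsD(1)[OF F] x by (intro bexI[of _ "wheel_edges n"]) (auto simp: whirl_rank_wheel_edges)
    next
      case False
      have "insert x F \<in> whirl_flats n"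
        using False 3 Rim x whirl_flatsD[OF F] unfolding whirl_flats_def by auto
      moreover have "{j \<in> {1..n}. Spoke j \<in> insert x F \<or> Rim j \<in> insert x F} = insert i ?D"
        using Rim i by auto
      hence "whirl_rank n (insert x F) = Suc (whirl_rank n F)" using iD by (simp add: whirl_rank_def)
      ultimately show ?thesis by auto
    qed
  qed
qed

section \<open>Cycles of the wheel\<close>

text \<open>A walk of \<open>d\<close> rim edges in the positive direction, which may run around the
  rim several times.\<close>

definition rim_path :: "nat \<Rightarrow> wheel_edge set \<Rightarrow> nat \<Rightarrow> nat \<Rightarrow> nat \<Rightarrow> bool" where
  "rim_path n A d a b \<longleftrightarrow> b = (nxt n ^^ d) a \<and> (\<forall>k<d. Rim ((nxt n ^^ k) a) \<in> A)"

lemma rim_path_0 [simp]: "rim_path n A 0 a b \<longleftrightarrow> b = a"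
  by (auto simp: rim_path_def)

lemma rim_path_Suc: "rim_path n A (Suc d) a b \<longleftrightarrow> Rim a \<in> A \<and> rim_path n A d (nxt n a) b"
  unfolding rim_path_def using less_Suc_eq_0_disj by (auto simp: funpow_swap1)

lemma rim_path_trans: "rim_path n A d a b \<Longrightarrow> rim_path n A e b c \<Longrightarrow> rim_path n A (d + e) a c"
  by (induction d arbitrary: a) (auto simp: rim_path_Suc)

lemma rim_path_mono: "rim_path n A d a b \<Longrightarrow> A \<subseteq> B \<Longrightarrow> rim_path n B d a b"
  by (auto simp: rim_path_def)

lemma rim_path_snoc:
  "rim_path n A (Suc d) a b \<longleftrightarrow> (\<exists>c. rim_path n A d a c \<and> Rim c \<in> A \<and> b = nxt n c)"
  by (induction d arbitrary: a) (auto simp: rim_path_Suc)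

lemma rim_path_short:
  assumes "rim_path n A d a b" "a \<in> {1..n}"
  obtains e where "e < n" "rim_path n A e a b"
proof -
  have "(nxt n ^^ (d mod n)) a = (nxt n ^^ d) a" using assms(2) by (simp only: funpow_nxt mod_add_right_eq)
  hence "rim_path n A (d mod n) a b" using assms(1) unfolding rim_path_def
    by (metis less_le_trans mod_less_eq_dividend)
  moreover have "d mod n < n" using assms(2) by auto
  ultimately show ?thesis using that by blast
qed

text \<open>The cycle leaves the hub along the spoke of \<open>a\<close>, follows the rim to
  \<open>b\<close> and returns. The walk is first shortened to fewer than \<open>n\<close> steps so
  that no vertex repeats.\<close>

lemma not_forest_spokes:
  assumes a: "a \<in> {1..n}" and path: "rim_path n A d a b" and "Spoke a \<in> A" "Spoke b \<in> A" "a \<noteq> b"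
  shows "\<not> forest (wheel_ends n) A"
proof -
  obtain e where e: "e < n" "rim_path n A e a b" using rim_path_short[OF path a] by blast
  have "e \<noteq> 0" using e assms(5) by (intro notI) auto
  let ?f = "\<lambda>k. (nxt n ^^ k) a"
  define vs where "vs = 0 # map ?f [0..<Suc e]"
  define es where "es = Spoke a # map (\<lambda>k. Rim (?f k)) [0..<e] @ [Spoke b]"
  have pos: "?f k \<noteq> 0" "0 \<noteq> ?f k" for k using funpow_nxt_in[OF a, of k] by auto
  have inj: "inj_on ?f {..<n}"
  proof (rule inj_onI)
    fix k l assume kl: "k \<in> {..<n}" "l \<in> {..<n}" "?f k = ?f l"
    hence "(a - 1 + k) mod n = (a - 1 + l) mod n" by (simp add: funpow_nxt[OF a])
    hence "k mod n = l mod n" by (rule mod_add_cancel_nat)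
    thus "k = l" using kl by simp
  qed
  have len: "length vs = e + 2" "length es = e + 2" by (auto simp: vs_def es_def)
  have "distinct vs"
  proof -
    have "inj_on ?f {0..<Suc e}" by (rule inj_on_subset[OF inj]) (use e in auto)
    moreover have "0 \<notin> set (map ?f [0..<Suc e])" using pos(1) by (metis (no_types, lifting) imageE set_map)
    ultimately show ?thesis unfolding vs_def by (simp add: distinct_map del: upt_Suc)
  qed
  moreover have "distinct es"
    unfolding es_def using assms(5) e
    by (auto simp: distinct_map inj_on_def dest!: inj_onD[OF inj])
  moreover have "wheel_ends n (es ! i) = {vs ! i, vs ! (Suc i mod length es)}" if i: "i < length es" for i
  proof -
    consider "i = 0" | k where "i = Suc k" "k < e" | "i = Suc e" using i len by (cases i) (auto simp: less_Suc_eq)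
    thus ?thesis
    proof cases
      case 1
      thus ?thesis by (simp add: len) (simp add: vs_def es_def nth_Cons' del: upt_Suc)
    next
      case 2
      thus ?thesis by (simp add: len) (simp add: vs_def es_def nth_append nxt_def del: upt_Suc)
    next
      case 3
      have "b = ?f e" using e by (simp add: rim_path_def)
      thus ?thesis using 3 by (simp add: len) (auto simp: vs_def es_def nth_append simp del: upt_Suc)
    qed
  qed
  ultimately have "graph_cycle (wheel_ends n) vs es"
    unfolding graph_cycle_def using len by auto
  moreover have "set es \<subseteq> A" using assms e by (auto simp: es_def rim_path_def)
  ultimately show ?thesis unfolding forest_def by blast
qed

lemma not_forest_rim:
  assumes "2 \<le> n" "rim n \<subseteq> A"
  shows "\<not> forest (wheel_ends n) A"
proof -
  have "graph_cycle (wheel_ends n) [1..<Suc n] (map Rim [1..<Suc n])"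
    unfolding graph_cycle_def using assms(1)
    by (auto simp: distinct_map inj_on_def mod_Suc simp del: upt_Suc)
  moreover have "set (map Rim [1..<Suc n]) \<subseteq> A" using assms(2) by (auto simp: rim_def)
  ultimately show ?thesis unfolding forest_def by blast
qed

text \<open>\<open>C\<close> is meant to be a rim component of \<open>A\<close> that no spoke
  touches. Keeping it off the hub separates from \<open>A\<close> both a spoke at \<open>C\<close>
  and a missing rim edge with an end in \<open>C\<close>.\<close>

lemma separating_whirl_flat:
  assumes n: "1 \<le> n" and A: "A \<subseteq> wheel_edges n" "\<not> rim n \<subseteq> A"
    and C: "\<And>j. j \<in> C \<Longrightarrow> Spoke j \<notin> A"
      "\<And>j. j \<in> {1..n} \<Longrightarrow> Rim j \<in> A \<Longrightarrow> j \<in> C \<longleftrightarrow> nxt n j \<in> C"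
  shows "\<exists>F\<in>whirl_flats n. A \<subseteq> F \<and> (\<forall>j\<in>C. Spoke j \<notin> F) \<and>
    (\<forall>j. Rim j \<notin> A \<longrightarrow> j \<in> C \<or> nxt n j \<in> C \<longrightarrow> Rim j \<notin> F)"
proof -
  \<comment> \<open>the flat joins exactly the vertices outside \<open>C\<close> to the hub\<close>
  define F where "F = Spoke ` ({1..n} - C) \<union> {Rim j |j. j \<in> {1..n} \<and> (Rim j \<in> A \<or> j \<notin> C \<and> nxt n j \<notin> C)}"
  have sp: "Spoke j \<in> F \<longleftrightarrow> j \<in> {1..n} \<and> j \<notin> C" for j by (auto simp: F_def)
  have rm: "Rim j \<in> F \<longleftrightarrow> j \<in> {1..n} \<and> (Rim j \<in> A \<or> j \<notin> C \<and> nxt n j \<notin> C)" for j by (auto simp: F_def)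
  have eq: "j \<in> C \<longleftrightarrow> nxt n j \<in> C" if "Rim j \<in> F" for j using that C(2)[of j] by (auto simp: rm)
  have "1 \<notin> C" if r: "rim n \<subseteq> F"
  proof
    assume "1 \<in> C"
    have "j \<in> C" if "j \<in> {1..n}" for j
      by (rule nxt_cycle_induct[of 1 n "\<lambda>j. j \<in> C"]) (use \<open>1 \<in> C\<close> n that r eq in \<open>auto simp: rim_subset_iff\<close>)
    hence "rim n \<subseteq> A" using r by (auto simp: rim_subset_iff rm)
    thus False using A by blast
  qed
  moreover have "F \<subseteq> wheel_edges n" by (auto simp: F_def)
  moreover have "Spoke i \<in> F \<longleftrightarrow> Spoke (nxt n i) \<in> F" if "i \<in> {1..n}" "Rim i \<in> F" for i
    using eq[OF that(2)] nxt_in[OF that(1)] that(1) by (simp add: sp)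
  moreover have "Rim i \<in> F" if "i \<in> {1..n}" "Spoke i \<in> F" "Spoke (nxt n i) \<in> F" for i
    using that by (simp add: sp rm)
  moreover have "Spoke 1 \<in> F \<longleftrightarrow> 1 \<notin> C" using n by (simp add: sp)
  ultimately have "F \<in> whirl_flats n"
    unfolding whirl_flats_def by blast
  moreover have "A \<subseteq> F"
  proof
    fix x assume "x \<in> A"
    thus "x \<in> F" using A(1) C(1) by (cases x) (auto simp: sp rm)
  qed
  moreover have "(\<forall>j\<in>C. Spoke j \<notin> F) \<and> (\<forall>j. Rim j \<notin> A \<longrightarrow> j \<in> C \<or> nxt n j \<in> C \<longrightarrow> Rim j \<notin> F)"
    by (simp add: sp rm)
  ultimately show ?thesis by blast
qed

text \<open>Connected parts of the rim are arcs, so of two vertices in the same part one is reached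
  from the other in the positive direction; walks that change direction add nothing.\<close>

definition rim_component :: "nat \<Rightarrow> wheel_edge set \<Rightarrow> nat \<Rightarrow> nat set" where
  "rim_component n A v = {j \<in> {1..n}. \<exists>d. rim_path n A d v j \<or> rim_path n A d j v}"

lemma rim_component_self: "v \<in> {1..n} \<Longrightarrow> v \<in> rim_component n A v"
  unfolding rim_component_def using rim_path_0 by blast

text \<open>A walk of positive length starting at \<open>j\<close> begins with \<open>Rim j\<close>,
  and one arriving at the successor of \<open>j\<close> ends with it, because \<open>nxt n\<close>
  is injective. Such walks are shortened, all others are prolonged by \<open>Rim j\<close>.\<close>

lemma rim_component_closed:
  assumes v: "v \<in> {1..n}" and j: "j \<in> {1..n}" "Rim j \<in> A"
  shows "j \<in> rim_component n A v \<longleftrightarrow> nxt n j \<in> rim_component n A v"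
proof
  assume "j \<in> rim_component n A v"
  then obtain d where "rim_path n A d v j \<or> rim_path n A d j v" by (auto simp: rim_component_def)
  moreover have "rim_path n A (Suc d) v (nxt n j)" if "rim_path n A d v j"
    using that j by (auto simp: rim_path_snoc)
  moreover have "\<exists>d. rim_path n A d v (nxt n j) \<or> rim_path n A d (nxt n j) v" if "rim_path n A d j v"
  proof (cases d)
    case 0
    hence "rim_path n A (Suc 0) v (nxt n j)" using that j by (auto simp: rim_path_Suc)
    thus ?thesis by blast
  next
    case (Suc e)
    thus ?thesis using that by (auto simp: rim_path_Suc)
  qed
  ultimately show "nxt n j \<in> rim_component n A v" using nxt_in[OF j(1)] unfolding rim_component_def by blast
next
  assume "nxt n j \<in> rim_component n A v"
  then obtain d where "rim_path n A d v (nxt n j) \<or> rim_path n A d (nxt n j) v" by (auto simp: rim_component_def)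
  moreover have "rim_path n A (Suc d) j v" if "rim_path n A d (nxt n j) v"
    using that j by (auto simp: rim_path_Suc)
  moreover have "\<exists>d. rim_path n A d v j \<or> rim_path n A d j v" if p: "rim_path n A d v (nxt n j)"
  proof (cases d)
    case 0
    hence "rim_path n A (Suc 0) j v" using p j by (auto simp: rim_path_Suc)
    thus ?thesis by blast
  next
    case (Suc e)
    then obtain c where c: "rim_path n A e v c" "nxt n j = nxt n c" using p by (auto simp: rim_path_snoc)
    have "c \<in> {1..n}" using c(1) funpow_nxt_in[OF v] by (auto simp: rim_path_def)
    hence "j = c" using nxt_inj c(2) j(1) by blast
    thus ?thesis using c by blast
  qed
  ultimately show "j \<in> rim_component n A v" using j unfolding rim_component_def by blast
qed

text \<open>After \<open>x\<close> is removed, the rim component of an end of \<open>x\<close>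
  contains no spoke: of its rim vertex if \<open>x\<close> is a spoke, of at least one of its two
  ends if \<open>x\<close> is a rim edge. Otherwise \<open>x\<close> would close a cycle. This
  component is then kept off the hub.\<close>

lemma whirl_indep_separated:
  assumes n: "2 \<le> n" and I: "I \<subseteq> wheel_edges n" "I = rim n \<or> forest (wheel_ends n) I" and x: "x \<in> I"
  shows "\<exists>F\<in>whirl_flats n. I - {x} \<subseteq> F \<and> x \<notin> F"
proof -
  let ?A = "I - {x}"
  have n1: "1 \<le> n" using n by simp
  have A: "?A \<subseteq> wheel_edges n" using I by auto
  have nr: "\<not> rim n \<subseteq> ?A"
  proof
    assume r: "rim n \<subseteq> ?A"
    hence "I \<noteq> rim n" using x by auto
    thus False using not_forest_rim[OF n, of I] r I(2) by auto
  qed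
  have no: "\<not> rim_path n I d a b" if "a \<in> {1..n}" "Spoke a \<in> I" "Spoke b \<in> I" "a \<noteq> b" for a b d
  proof -
    have "I \<noteq> rim n" using that by auto
    thus ?thesis using not_forest_spokes[of a n I d b] that I(2) by auto
  qed
  have pathI: "rim_path n ?A d a b \<Longrightarrow> rim_path n I d a b" for d a b by (erule rim_path_mono) auto
  show ?thesis
  proof (cases x)
    case (Spoke i)
    hence i: "i \<in> {1..n}" using x I by auto
    let ?C = "rim_component n ?A i"
    have C: "Spoke j \<notin> ?A" if jC: "j \<in> ?C" for j
    proof
      assume j: "Spoke j \<in> ?A"
      hence "j \<noteq> i" using Spoke by auto
      moreover obtain d where "rim_path n I d i j \<or> rim_path n I d j i" "j \<in> {1..n}"
        using jC pathI unfolding rim_component_def by blast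
      ultimately show False using no[of i j d] no[of j i d] i j x Spoke by auto
    qed
    obtain F where "F \<in> whirl_flats n" "?A \<subseteq> F" "\<forall>j\<in>?C. Spoke j \<notin> F"
      using separating_whirl_flat[OF n1 A nr C rim_component_closed[OF i]] by blast
    thus ?thesis using rim_component_self[OF i] Spoke by blast
  next
    case (Rim i)
    hence i: "i \<in> {1..n}" using x I by auto
    note ni = nxt_in[OF i]
    let ?C = "rim_component n ?A i" and ?C' = "rim_component n ?A (nxt n i)"
    have "(\<forall>j\<in>?C. Spoke j \<notin> ?A) \<or> (\<forall>j\<in>?C'. Spoke j \<notin> ?A)"
    proof (rule ccontr)
      assume "\<not> ?thesis"
      then obtain j k where j: "j \<in> ?C" "Spoke j \<in> ?A" and k: "k \<in> ?C'" "Spoke k \<in> ?A" by blast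
      have jk: "j \<in> {1..n}" "k \<in> {1..n}" using j k unfolding rim_component_def by auto
      have "\<exists>d. rim_path n ?A d j i"
      proof -
        obtain d where "rim_path n ?A d i j \<or> rim_path n ?A d j i" using j unfolding rim_component_def by blast
        \<comment> \<open>A longer walk out of \<open>i\<close> would begin with the removed
          edge.\<close>
        moreover have "rim_path n ?A 0 j i" if "rim_path n ?A d i j"
          using that Rim by (cases d) (auto simp: rim_path_Suc)
        ultimately show ?thesis by blast
      qed
      then obtain d1 where d1: "rim_path n I d1 j i" using pathI by blast
      have "\<exists>d. rim_path n ?A d (nxt n i) k"
      proof -
        obtain d where d: "rim_path n ?A d (nxt n i) k \<or> rim_path n ?A d k (nxt n i)"
          using k unfolding rim_component_def by blast
        \<comment> \<open>A longer walk into the successor of \<open>i\<close> would end with the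
          removed edge.\<close>
        have "rim_path n ?A 0 (nxt n i) k" if p: "rim_path n ?A d k (nxt n i)"
        proof (cases d)
          case (Suc e)
          then obtain c where c: "rim_path n ?A e k c" "Rim c \<in> ?A" "nxt n i = nxt n c"
            using p by (auto simp: rim_path_snoc)
          have "c \<in> {1..n}" using c(2) A by auto
          hence "i = c" using nxt_inj[OF i] c(3) by blast
          thus ?thesis using c(2) Rim by simp
        qed (use p in auto)
        thus ?thesis using d by blast
      qed
      then obtain d2 where d2: "rim_path n I d2 (nxt n i) k" using pathI by blast
      have "rim_path n I (Suc d2) i k" using d2 x Rim by (auto simp: rim_path_Suc)
      from rim_path_trans[OF d1 this] have p: "rim_path n I (d1 + Suc d2) j k" .
      show False
      proof (cases "j = k")
        case False
        thus False using no[of j k] p j k jk by auto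
      next
        case True
        \<comment> \<open>The two spokes coincide, so the walk is closed. Its length is positive and
          divisible by \<open>n\<close>; hence it covers the whole rim, and the spoke at
          \<open>j\<close> shows that \<open>I\<close> is larger than the rim.\<close>
        have "(nxt n ^^ (d1 + Suc d2)) j = j" using p True by (simp add: rim_path_def)
        hence "Suc ((j - 1 + (d1 + Suc d2)) mod n) = j" using funpow_nxt[OF jk(1)] by metis
        hence "(j - 1 + (d1 + Suc d2)) mod n = j - 1" by (metis diff_Suc_1)
        moreover have "(j - 1 + 0) mod n = j - 1" using jk(1) by auto
        ultimately have "(d1 + Suc d2) mod n = 0 mod n" by (metis mod_add_cancel_nat)
        hence "n dvd d1 + Suc d2" by (simp add: mod_eq_0_iff_dvd del: add_Suc_right)
        hence "n \<le> d1 + Suc d2" by (rule dvd_imp_le) simp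
        hence R: "Rim ((nxt n ^^ e) j) \<in> I" if "e < n" for e using p that unfolding rim_path_def by auto
        have "Rim l \<in> I" if "l \<in> {1..n}" for l
        proof -
          have "(nxt n ^^ ((l + n - j) mod n)) j = l"
          proof -
            have "(j - 1 + (l + n - j) mod n) mod n = (j - 1 + (l + n - j)) mod n" by (simp add: mod_simps)
            also have "j - 1 + (l + n - j) = l - 1 + n" using jk(1) that by auto
            also have "(l - 1 + n) mod n = l - 1" using that by (simp only: mod_add_self2) auto
            finally show ?thesis using that by (simp add: funpow_nxt[OF jk(1)])
          qed
          thus ?thesis using R[of "(l + n - j) mod n"] n by auto
        qed
        hence "rim n \<subseteq> I" by (auto simp: rim_subset_iff)
        moreover have "I \<noteq> rim n" using j(2) by auto
        ultimately show False using not_forest_rim[OF n, of I] I(2) by auto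
      qed
    qed
    then obtain v where v: "v = i \<or> v = nxt n i" "\<And>j. j \<in> rim_component n ?A v \<Longrightarrow> Spoke j \<notin> ?A" by blast
    have vn: "v \<in> {1..n}" using v(1) i ni by auto
    obtain F where F: "F \<in> whirl_flats n" "?A \<subseteq> F"
      "\<forall>j. Rim j \<notin> ?A \<longrightarrow> j \<in> rim_component n ?A v \<or> nxt n j \<in> rim_component n ?A v \<longrightarrow> Rim j \<notin> F"
      using separating_whirl_flat[OF n1 A nr v(2) rim_component_closed[OF vn]] by blast
    have "Rim i \<notin> F" using F(3) rim_component_self[OF vn] v(1) Rim by auto
    thus ?thesis using F Rim by blast
  qed
qed

text \<open>A vertex of a cycle meets the edge with its own index and the cyclically preceding one;
  the length is added before 1 is subtracted so that index 0 is not truncated.\<close>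

lemma graph_cycle_edges:
  assumes cyc: "graph_cycle ends vs es" and i: "i < length es"
  shows "vs ! i \<in> ends (es ! i)" "vs ! i \<in> ends (es ! ((i + length es - 1) mod length es))"
    "1 < length es \<Longrightarrow> es ! i \<noteq> es ! ((i + length es - 1) mod length es)"
proof -
  let ?m = "length es"
  define j where "j = (i + ?m - 1) mod ?m"
  have "0 < ?m" using i by linarith
  hence j: "j < ?m" unfolding j_def by (rule mod_less_divisor)
  have "Suc j mod ?m = i"
    using i by (cases i) (auto simp: j_def mod_Suc)
  thus "vs ! i \<in> ends (es ! i)" "vs ! i \<in> ends (es ! ((i + ?m - 1) mod ?m))"
    using cyc i j unfolding graph_cycle_def j_def[symmetric] by auto
  assume "1 < ?m"
  hence "i \<noteq> j" using i by (cases i) (auto simp: j_def)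
  thus "es ! i \<noteq> es ! ((i + ?m - 1) mod ?m)"
    using cyc i j unfolding graph_cycle_def j_def[symmetric] by (simp add: nth_eq_iff_index_eq)
qed

text \<open>A cycle in \<open>I\<close> contradicts separability. Without spokes the cycle is the
  whole rim; a flat containing it contains every spoke, so no further element of \<open>I\<close>
  can be separated. With spokes, it is the spoke by which the cycle leaves the hub that cannot be
  separated.\<close>

lemma separated_imp_whirl_indep:
  assumes n: "2 \<le> n" and I: "I \<subseteq> wheel_edges n"
    and sep: "\<And>x. x \<in> I \<Longrightarrow> \<exists>F\<in>whirl_flats n. I - {x} \<subseteq> F \<and> x \<notin> F"
  shows "I = rim n \<or> forest (wheel_ends n) I"
proof (rule ccontr)
  assume no: "\<not> ?thesis"
  then obtain vs es where cyc: "graph_cycle (wheel_ends n) vs es" and es: "set es \<subseteq> I"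
    unfolding forest_def by blast
  let ?m = "length es"
  have c: "es \<noteq> []" "length vs = ?m" "distinct vs" "distinct es"
    "\<And>i. i < ?m \<Longrightarrow> wheel_ends n (es ! i) = {vs ! i, vs ! (Suc i mod ?m)}"
    using cyc unfolding graph_cycle_def by auto
  have mpos: "0 < ?m" using c(1) by auto
  have edge: "es ! i \<in> I" "es ! i \<in> wheel_edges n" if "i < ?m" for i using es I nth_mem[OF that] by auto
  have ends_eq: "wheel_ends n (Rim i) = {i, nxt n i}" for i by (simp add: nxt_def)
  have two: "1 < ?m"
  proof (rule ccontr)
    assume "\<not> 1 < ?m"
    hence "?m = 1" using mpos by linarith
    hence "wheel_ends n (es ! 0) = {vs ! 0}" using c(5)[of 0] by simp
    moreover have "\<not> (\<exists>v. wheel_ends n e = {v})" if "e \<in> wheel_edges n" for e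
      using that n by (cases e) (auto simp: doubleton_eq_iff split: if_splits)
    ultimately show False using edge(2)[of 0] \<open>?m = 1\<close> by auto
  qed
  show False
  proof (cases "\<exists>i. Spoke i \<in> set es")
    case False
    have rimv: "Rim v \<in> set es" if v: "v \<in> set vs" for v
    proof -
      obtain i where i: "i < ?m" "vs ! i = v" using v c(2) by (auto simp: in_set_conv_nth)
      define j where "j = (i + ?m - 1) mod ?m"
      have j: "j < ?m" using mpos by (simp add: j_def)
      note * = graph_cycle_edges[OF cyc i(1), folded j_def]
      obtain a b where ab: "es ! i = Rim a" "es ! j = Rim b"
        using False nth_mem[OF i(1)] nth_mem[OF j] by (metis wheel_edge.exhaust)
      have "a \<in> {1..n}" "b \<in> {1..n}" "a \<noteq> b" using ab edge(2)[OF i(1)] edge(2)[OF j] *(3)[OF two] by auto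
      moreover have "v = a \<or> v = nxt n a" "v = b \<or> v = nxt n b" using *(1,2) ab i ends_eq by auto
      \<comment> \<open>By injectivity of \<open>nxt n\<close>, two different rim edges cannot both
        have \<open>v\<close> as their second end.\<close>
      ultimately have "v = a \<or> v = b" using nxt_inj by blast
      thus ?thesis using ab nth_mem[OF i(1)] nth_mem[OF j] by auto
    qed
    have nx: "nxt n v \<in> set vs" if v: "v \<in> set vs" for v
    proof -
      obtain i where i: "i < ?m" "es ! i = Rim v" using rimv[OF v] by (auto simp: in_set_conv_nth)
      have "nxt n v \<in> {vs ! i, vs ! (Suc i mod ?m)}" using c(5)[OF i(1)] i(2) ends_eq by auto
      thus ?thesis using i c(2) mpos by auto
    qed
    have v0: "vs ! 0 \<in> set vs" using mpos c(2) by auto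
    have "vs ! 0 \<in> {1..n}" using rimv[OF v0] es I by auto
    hence all: "v \<in> set vs" if "v \<in> {1..n}" for v
      using nxt_cycle_induct[of "vs ! 0" n "\<lambda>v. v \<in> set vs"] v0 nx that by blast
    hence r: "rim n \<subseteq> I" using rimv es by (auto simp: rim_subset_iff)
    then obtain x where x: "x \<in> I" "x \<notin> rim n" using no by auto
    then obtain j where j: "x = Spoke j" "j \<in> {1..n}" using I by (cases x) auto
    obtain F where F: "F \<in> whirl_flats n" "I - {x} \<subseteq> F" "x \<notin> F" using sep[OF x(1)] by blast
    have "rim n \<subseteq> F" using r F x by auto
    thus False using whirl_flats_rim[OF F(1) _ j(2)] F(3) j(1) by auto
  next
    case True
    then obtain i0 b where "i0 < ?m" "es ! i0 = Spoke b" by (auto simp: in_set_conv_nth)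
    moreover from this have "{0, b} = {vs ! i0, vs ! (Suc i0 mod ?m)}" using c(5)[of i0] by simp
    hence "0 = vs ! i0 \<or> 0 = vs ! (Suc i0 mod ?m)" by blast
    moreover have "Suc i0 mod ?m < ?m" using mpos by simp
    ultimately obtain a where a: "a < ?m" "vs ! a = 0" by metis
    let ?v = "\<lambda>k. vs ! ((a + k) mod ?m)" and ?e = "\<lambda>k. es ! ((a + k) mod ?m)"
    have lt: "(a + k) mod ?m < ?m" for k using mpos by simp
    have ends: "wheel_ends n (?e k) = {?v k, ?v (Suc k)}" for k using c(5)[OF lt, of k] by (simp add: mod_simps)
    have inj: "(a + k) mod ?m \<noteq> (a + l) mod ?m" if "k < ?m" "l < ?m" "k \<noteq> l" for k l
    proof
      assume "(a + k) mod ?m = (a + l) mod ?m"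
      hence "k mod ?m = l mod ?m" by (metis mod_add_cancel_nat)
      thus False using that by simp
    qed
    have v0: "?v 0 = 0" "?v ?m = 0" using a by auto
    have vk: "?v k \<noteq> 0" if "0 < k" "k < ?m" for k
    proof
      assume "?v k = 0"
      hence "vs ! ((a + k) mod ?m) = vs ! a" using a by simp
      hence "(a + k) mod ?m = a" using nth_eq_iff_index_eq[OF c(3)] lt[of k] a(1) c(2) by simp
      thus False using inj[of k 0] that mpos a(1) by simp
    qed
    have ee: "?e k \<noteq> ?e 0" if "0 < k" "k < ?m" for k
      using inj[of k 0] that c(4) lt mpos by (simp add: nth_eq_iff_index_eq)
    have spoke: "e = Spoke v" if "e \<in> wheel_edges n" "wheel_ends n e = {0, v}" "v \<noteq> 0" for e v
      using that by (cases e) (auto simp: doubleton_eq_iff split: if_splits)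
    define i where "i = ?v 1"
    have x: "?e 0 = Spoke i"
      by (rule spoke) (use edge(2)[OF lt, of 0] ends[of 0] v0 vk[of 1] two in \<open>auto simp: i_def\<close>)
    obtain F where F: "F \<in> whirl_flats n" "I - {Spoke i} \<subseteq> F" "Spoke i \<notin> F"
      using sep[of "Spoke i"] edge(1)[OF lt, of 0] x by auto
    have inF: "?e k \<in> F" if "0 < k" "k < ?m" for k using ee[OF that] F(2) edge(1)[OF lt, of k] x by auto
    \<comment> \<open>Backwards around the cycle from the hub: the last edge is a spoke in
      \<open>F\<close>, and every rim edge in \<open>F\<close> passes membership of spokes on to the
      preceding vertex. This ends at the spoke that \<open>F\<close> was chosen to avoid.\<close>
    have "Spoke (?v (?m - k)) \<in> F" if "0 < k" "k < ?m" for k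
      using that
    proof (induction k)
      case (Suc k)
      let ?l = "?m - Suc k"
      have l: "0 < ?l" "?l < ?m" using Suc.prems by auto
      have Sl: "Suc ?l = ?m - k" using Suc.prems by auto
      show ?case
      proof (cases "k = 0")
        case True
        hence "Suc ?l = ?m" using Suc.prems by simp
        hence "wheel_ends n (?e ?l) = {?v ?l, ?v ?m}" using ends[of ?l] by metis
        hence "wheel_ends n (?e ?l) = {0, ?v ?l}" by (metis v0(2) insert_commute)
        hence "?e ?l = Spoke (?v ?l)" by (rule spoke[OF edge(2)[OF lt] _ vk[OF l]])
        thus ?thesis using inF[OF l] by simp
      next
        case False
        hence IH: "Spoke (?v (Suc ?l)) \<in> F" using Suc Sl by simp
        have "0 < Suc ?l" "Suc ?l < ?m" using False Suc.prems by auto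
        hence ne: "?v ?l \<noteq> 0" "?v (Suc ?l) \<noteq> 0" using vk[OF l] vk by blast+
        obtain w where w: "?e ?l = Rim w"
        proof (cases "?e ?l")
          case (Spoke w)
          hence "0 \<in> wheel_ends n (?e ?l)" by simp
          hence "0 \<in> {?v ?l, ?v (Suc ?l)}" by (simp only: ends)
          thus ?thesis using ne by (simp only: insert_iff empty_iff) metis
        qed (use that in auto)
        have "w \<in> {1..n}" using edge(2)[OF lt, of ?l] w by auto
        hence "Spoke w \<in> F \<longleftrightarrow> Spoke (nxt n w) \<in> F"
          using whirl_flatsD(3)[OF F(1)] inF[OF l] w by auto
        moreover have "{w, nxt n w} = {?v ?l, ?v (Suc ?l)}" using ends[of ?l] w ends_eq by simp
        ultimately show ?thesis using IH by (metis doubleton_eq_iff)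
      qed
    qed simp
    from this[of "?m - 1"] have "Spoke i \<in> F" using two by (simp add: i_def)
    thus False using F(3) by simp
  qed
qed

section \<open>The whirl matroid\<close>

text \<open>Brings the definition of the whirl into the form produced by
  \<open>matroid_of_flats\<close>.\<close>

lemma whirl_eq:
  assumes n: "2 \<le> n"
  shows "whirl n = \<lparr>ground = wheel_edges n,
    indeps = {I. I \<subseteq> wheel_edges n \<and> (\<forall>x\<in>I. \<exists>F\<in>whirl_flats n. I - {x} \<subseteq> F \<and> x \<notin> F)}\<rparr>"
proof -
  have "rim n \<subseteq> wheel_edges n" by (auto simp: wheel_edges_def)
  hence "insert (rim n) (indeps (graphic_matroid (wheel_edges n) (wheel_ends n))) =
    {I. I \<subseteq> wheel_edges n \<and> (I = rim n \<or> forest (wheel_ends n) I)}"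
    by (auto simp: graphic_matroid_def)
  also have "\<dots> = {I. I \<subseteq> wheel_edges n \<and> (\<forall>x\<in>I. \<exists>F\<in>whirl_flats n. I - {x} \<subseteq> F \<and> x \<notin> F)}"
    using whirl_indep_separated[OF n] separated_imp_whirl_indep[OF n] by (intro Collect_cong) metis
  finally show ?thesis using n by (simp add: whirl_def)
qed

lemma empty_in_whirl_flats: "1 \<le> n \<Longrightarrow> {} \<in> whirl_flats n"
  by (auto simp: whirl_flats_def rim_def)

lemma whirl_matroid:
  assumes n: "2 \<le> n"
  shows "matroid (whirl n)" "loopless (whirl n)" "ground (whirl n) = wheel_edges n"
    and "flats (whirl n) = whirl_flats n"
    and "F \<in> whirl_flats n \<Longrightarrow> rank_of (whirl n) F = whirl_rank n F"
    and "rk (whirl n) = n"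
proof -
  have n1: "1 \<le> n" using n by simp
  have Int: "F \<inter> G \<in> whirl_flats n" if "F \<in> whirl_flats n" "G \<in> whirl_flats n" for F G
    using that unfolding whirl_flats_def by auto
  have z: "whirl_rank n {} = 0" by (simp add: whirl_rank_def)
  note * = matroid_of_flats[of "wheel_edges n" "whirl_flats n" "whirl_rank n", folded whirl_eq[OF n],
    OF finite_wheel_edges whirl_flatsD(1) wheel_edges_in_whirl_flats[OF n1] empty_in_whirl_flats[OF n1] z
      Int whirl_rank_strict_mono whirl_flats_cover[OF n1]]
  show 1: "matroid (whirl n)" and 2: "flats (whirl n) = whirl_flats n"
    and 3: "F \<in> whirl_flats n \<Longrightarrow> rank_of (whirl n) F = whirl_rank n F" for F
    using * by auto
  show 4: "ground (whirl n) = wheel_edges n" by (simp add: whirl_eq[OF n])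
  show "loopless (whirl n)"
    unfolding loopless_def whirl_eq[OF n] using empty_in_whirl_flats[OF n1] by auto
  show "rk (whirl n) = n"
    using 3[OF wheel_edges_in_whirl_flats[OF n1]] 4 by (simp add: rk_def whirl_rank_wheel_edges)
qed

lemma whirl_1: "whirl 1 = \<lparr>ground = {Spoke 1}, indeps = Pow {Spoke 1}\<rparr>"
proof -
  have "forest (wheel_ends 1) A" if "A \<subseteq> {Spoke 1}" for A
    unfolding forest_def
  proof
    assume "\<exists>vs es. graph_cycle (wheel_ends 1) vs es \<and> set es \<subseteq> A"
    then obtain vs es where c: "graph_cycle (wheel_ends 1) vs es" "set es \<subseteq> {Spoke 1}"
      using \<open>A \<subseteq> {Spoke 1}\<close> by (meson subset_trans)
    hence "es \<noteq> []" "distinct es" unfolding graph_cycle_def by auto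
    hence "es = [Spoke 1]" using c(2) by (cases es; cases "tl es") auto
    hence "wheel_ends 1 (Spoke 1) = {vs ! 0}" using c(1) unfolding graph_cycle_def by simp
    thus False by (auto simp: doubleton_eq_iff)
  qed
  thus ?thesis by (auto simp: whirl_def graphic_matroid_def)
qed

section \<open>Generating functions of fans and whirls\<close>

text \<open>The Kazhdan--Lusztig polynomial of the fan of rank \<open>k + 1\<close>.\<close>

fun motzkin :: "nat \<Rightarrow> int poly" where
  "motzkin 0 = 1"
| "motzkin (Suc n) = motzkin n + [:0, 1:] * (\<Sum>i<n. motzkin i * motzkin (n - 1 - i))"

text \<open>Indexed by the rank, which for a gap is its number of components; an empty gap
  contributes the factor 1.\<close>

definition fan_poly :: "nat \<Rightarrow> int poly" where
  "fan_poly k = (if k = 0 then 1 else motzkin (k - 1))"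

abbreviation motzkin_fps :: "int poly fps" where
  "motzkin_fps \<equiv> Abs_fps motzkin"

abbreviation T_fps :: "int poly fps" where
  "T_fps \<equiv> fps_const [:0, 1:]"

lemma motzkin_fps_eq: "motzkin_fps = 1 + fps_X * motzkin_fps + T_fps * fps_X ^ 2 * motzkin_fps ^ 2"
proof (rule fps_ext)
  fix n
  have conv: "T_fps * fps_X ^ 2 * motzkin_fps ^ 2 = fps_X * (fps_X * (T_fps * motzkin_fps ^ 2))"
    by (simp add: power2_eq_square mult_ac)
  show "motzkin_fps $ n = (1 + fps_X * motzkin_fps + T_fps * fps_X ^ 2 * motzkin_fps ^ 2) $ n"
  proof (cases n)
    case (Suc m)
    have "(fps_X * (fps_X * (T_fps * motzkin_fps ^ 2))) $ Suc m = [:0, 1:] * (\<Sum>i<m. motzkin i * motzkin (m - 1 - i))"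
    proof (cases m)
      case l: (Suc l)
      have "(fps_X * (fps_X * F)) $ Suc (Suc l) = F $ l" for F :: "int poly fps" by simp
      moreover have "(T_fps * motzkin_fps ^ 2) $ l = [:0, 1:] * (\<Sum>i\<le>l. motzkin i * motzkin (l - i))"
        by (subst fps_mult_left_const_nth) (simp only: power2_eq_square fps_mult_nth atLeast0AtMost fps_nth_Abs_fps)
      ultimately show ?thesis by (simp only: l lessThan_Suc_atMost diff_Suc_1)
    qed simp
    thus ?thesis unfolding conv by (simp add: Suc)
  qed (simp add: conv)
qed

section \<open>Degree bounds for the coefficients of power series\<close>

definition half_degree :: "int poly fps \<Rightarrow> bool" where
  "half_degree f \<longleftrightarrow> (\<forall>n. 2 * degree (f $ n) \<le> n)"

lemma degree_sum_le_half:
  fixes f :: "'a \<Rightarrow> int poly"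
  shows "finite A \<Longrightarrow> (\<And>i. i \<in> A \<Longrightarrow> 2 * degree (f i) \<le> n) \<Longrightarrow> 2 * degree (\<Sum>i\<in>A. f i) \<le> n"
proof (induction A rule: finite_induct)
  case (insert i A)
  thus ?case using degree_add_le_max[of "f i" "sum f A"] by fastforce
qed simp

lemma half_degree_mult:
  assumes "half_degree f" "half_degree g"
  shows "half_degree (f * g)"
  unfolding half_degree_def fps_mult_nth
proof (intro allI degree_sum_le_half)
  fix n i :: nat assume i: "i \<in> {0..n}"
  have "2 * degree (f $ i) \<le> i" "2 * degree (g $ (n - i)) \<le> n - i"
    using assms unfolding half_degree_def by auto
  thus "2 * degree (f $ i * g $ (n - i)) \<le> n" using degree_mult_le[of "f $ i" "g $ (n - i)"] i by auto
qed simp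

lemma half_degree_power: "half_degree f \<Longrightarrow> half_degree (f ^ k)"
  by (induction k) (auto intro: half_degree_mult, simp add: half_degree_def)

text \<open>Comparing coefficients in \<open>f * g = 1\<close> expresses each coefficient of
  \<open>g\<close> by earlier ones, in products whose indices add up to \<open>n\<close>.\<close>

lemma half_degree_inverse:
  assumes f: "half_degree f" "f $ 0 = 1" and fg: "f * g = 1"
  shows "half_degree g"
  unfolding half_degree_def
proof
  fix n show "2 * degree (g $ n) \<le> n"
  proof (induction n rule: less_induct)
    case (less n)
    show ?case
    proof (cases "n = 0")
      case True
      have "(f * g) $ 0 = 1" by (simp add: fg)
      thus ?thesis using f(2) True by simp
    next
      case False
      have "0 = (f * g) $ n" using False by (simp add: fg)
      also have "\<dots> = g $ n + (\<Sum>i\<in>{1..n}. f $ i * g $ (n - i))"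
        using f(2) by (simp add: fps_mult_nth sum.atLeast_Suc_atMost)
      finally have eq: "g $ n = - (\<Sum>i\<in>{1..n}. f $ i * g $ (n - i))" by (simp add: eq_neg_iff_add_eq_0)
      have "2 * degree (\<Sum>i\<in>{1..n}. f $ i * g $ (n - i)) \<le> n"
      proof (rule degree_sum_le_half)
        fix i assume i: "i \<in> {1..n}"
        have "2 * degree (f $ i) \<le> i" using f unfolding half_degree_def by auto
        moreover have "2 * degree (g $ (n - i)) \<le> n - i" using less.IH[of "n - i"] i by auto
        ultimately show "2 * degree (f $ i * g $ (n - i)) \<le> n"
          using degree_mult_le[of "f $ i" "g $ (n - i)"] i by auto
      qed simp
      thus ?thesis unfolding eq by simp
    qed
  qed
qed

lemma degree_motzkin: "2 * degree (motzkin n) \<le> n"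
proof (induction n rule: less_induct)
  case (less n)
  show ?case
  proof (cases n)
    case (Suc m)
    have "2 * degree (\<Sum>i<m. motzkin i * motzkin (m - 1 - i)) \<le> m - 1"
    proof (rule degree_sum_le_half)
      fix i assume i: "i \<in> {..<m}"
      have "2 * degree (motzkin i) \<le> i" "2 * degree (motzkin (m - 1 - i)) \<le> m - 1 - i"
        using i Suc by (intro less.IH; simp)+
      thus "2 * degree (motzkin i * motzkin (m - 1 - i)) \<le> m - 1"
        using degree_mult_le[of "motzkin i" "motzkin (m - 1 - i)"] i by auto
    qed simp
    hence "2 * degree ([:0, 1:] * (\<Sum>i<m. motzkin i * motzkin (m - 1 - i))) \<le> Suc m"
    proof (cases "m = 0")
      case False
      thus ?thesis using \<open>2 * degree (\<Sum>i<m. motzkin i * motzkin (m - 1 - i)) \<le> m - 1\<close>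
        degree_mult_le[of "[:0, 1:]" "\<Sum>i<m. motzkin i * motzkin (m - 1 - i)"] by auto
    qed simp
    moreover have "2 * degree (motzkin m) \<le> Suc m" using less.IH[of m] Suc by auto
    ultimately show ?thesis unfolding Suc motzkin.simps
      using degree_add_le_max[of "motzkin m" "[:0, 1:] * (\<Sum>i<m. motzkin i * motzkin (m - 1 - i))"] by linarith
  qed simp
qed

lemma degree_fan_poly: "2 * degree (fan_poly k) \<le> k" "0 < k \<Longrightarrow> 2 * degree (fan_poly k) < k"
  using degree_motzkin[of "k - 1"] by (auto simp: fan_poly_def)

text \<open>With \<open>Y = u M\<close> the claimed generating function equals
  \<open>Y (1 + Y + t Y\<^sup>2) / ((1 + Y) (1 - t Y\<^sup>2)) = u M\<^sup>2 / ((1 + u M) (1 - t u\<^sup>2 M\<^sup>2))\<close>;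
  the last form makes the degree bound visible.\<close>

definition whirl_fps :: "int poly fps" where
  "whirl_fps = fps_X * (motzkin_fps ^ 2 * fps_right_inverse (1 + fps_X * motzkin_fps) 1 *
     fps_right_inverse (1 - T_fps * fps_X ^ 2 * motzkin_fps ^ 2) 1)"

definition whirl_poly :: "nat \<Rightarrow> int poly" where
  "whirl_poly n = whirl_fps $ n"

lemma whirl_fps_eq:
  "whirl_fps * ((1 + fps_X * motzkin_fps) * (1 - T_fps * fps_X ^ 2 * motzkin_fps ^ 2)) = fps_X * motzkin_fps ^ 2"
proof -
  let ?a = "1 + fps_X * motzkin_fps" and ?b = "1 - T_fps * fps_X ^ 2 * motzkin_fps ^ 2"
  have "?a * fps_right_inverse ?a 1 = 1" "?b * fps_right_inverse ?b 1 = 1"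
    by (rule fps_right_inverse, simp)+
  moreover have "whirl_fps * (?a * ?b) =
    fps_X * motzkin_fps ^ 2 * (?a * fps_right_inverse ?a 1) * (?b * fps_right_inverse ?b 1)"
    unfolding whirl_fps_def by (simp only: mult_ac)
  ultimately show ?thesis by simp
qed

lemma whirl_poly_0: "whirl_poly 0 = 0"
  by (simp add: whirl_poly_def whirl_fps_def)

lemma half_degree_X_mult: "half_degree f \<Longrightarrow> half_degree (fps_X * f)"
  unfolding half_degree_def by (auto intro: le_trans[OF _ diff_le_self])

lemma half_degree_T_X2_mult:
  assumes "half_degree f"
  shows "half_degree (T_fps * fps_X ^ 2 * f)"
  unfolding half_degree_def
proof
  fix n
  have "T_fps * fps_X ^ 2 * f = fps_X * (fps_X * (T_fps * f))" by (simp add: power2_eq_square mult_ac)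
  moreover have "2 * degree ((fps_X * (fps_X * (T_fps * f))) $ n) \<le> n"
  proof (cases "n \<le> 1")
    case False
    define m where "m = n - 2"
    have m: "n = Suc (Suc m)" using False by (simp add: m_def)
    have "degree ([:0, 1:] * f $ m) \<le> degree [:0, 1::int:] + degree (f $ m)" by (rule degree_mult_le)
    moreover have "2 * degree (f $ m) \<le> m" using assms unfolding half_degree_def by blast
    ultimately have "2 * degree ([:0, 1:] * f $ m) \<le> Suc (Suc m)" by simp
    thus ?thesis by (simp add: m del: mult_pCons_left)
  qed (cases n; auto)
  ultimately show "2 * degree ((T_fps * fps_X ^ 2 * f) $ n) \<le> n" by metis
qed

text \<open>The leading factor \<open>fps_X\<close> shifts the index by one, which makes the bound
  given by \<open>half_degree\<close> strict.\<close>

lemma degree_whirl_poly: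
  assumes "0 < n"
  shows "2 * degree (whirl_poly n) < n"
proof -
  let ?a = "1 + fps_X * motzkin_fps" and ?b = "1 - T_fps * fps_X ^ 2 * motzkin_fps ^ 2"
  have M: "half_degree motzkin_fps" by (simp add: half_degree_def degree_motzkin)
  have one: "half_degree 1" by (simp add: half_degree_def)
  have add: "half_degree (f + g)" if "half_degree f" "half_degree g" for f g
    unfolding half_degree_def
  proof
    fix n
    have "2 * degree (f $ n) \<le> n" "2 * degree (g $ n) \<le> n" using that unfolding half_degree_def by auto
    thus "2 * degree ((f + g) $ n) \<le> n" using degree_add_le_max[of "f $ n" "g $ n"] by simp
  qed
  have min: "half_degree (- g)" if "half_degree g" for g
    using that unfolding half_degree_def by simp
  have "half_degree ?a" using add[OF one half_degree_X_mult[OF M]] .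
  hence a: "half_degree (fps_right_inverse ?a 1)"
    by (rule half_degree_inverse) (simp, rule fps_right_inverse, simp)
  have "half_degree ?b"
    using add[OF one min[OF half_degree_T_X2_mult[OF half_degree_power[OF M, of 2]]]] by simp
  hence b: "half_degree (fps_right_inverse ?b 1)"
    by (rule half_degree_inverse) (simp, rule fps_right_inverse, simp)
  have "half_degree (motzkin_fps ^ 2 * fps_right_inverse ?a 1 * fps_right_inverse ?b 1)"
    by (intro half_degree_mult half_degree_power M a b)
  hence "2 * degree ((motzkin_fps ^ 2 * fps_right_inverse ?a 1 * fps_right_inverse ?b 1) $ (n - 1)) \<le> n - 1"
    unfolding half_degree_def by blast
  thus ?thesis using assms unfolding whirl_poly_def whirl_fps_def by simp
qed

subsection \<open>Specialisation of the coefficients\<close>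

text \<open>Two instances are used: evaluation at a real number, where t can be inverted, and the
  embedding into the fraction field, where the final identity lives.\<close>

locale coeff_hom =
  fixes h :: "int poly \<Rightarrow> 'b::field"
  assumes h_add: "h (p + q) = h p + h q" and h_mult: "h (p * q) = h p * h q" and h_1: "h 1 = 1"
begin

definition fps_map :: "int poly fps \<Rightarrow> 'b fps" where
  "fps_map f = Abs_fps (\<lambda>n. h (f $ n))"

lemma h_0: "h 0 = 0"
  by (metis add.right_neutral add_left_cancel h_add)

lemma h_minus: "h (- p) = - h p"
  using h_add[of p "- p"] by (simp add: h_0 add_eq_0_iff2)

lemma h_sum: "h (sum f A) = (\<Sum>i\<in>A. h (f i))"
  by (induction A rule: infinite_finite_induct) (simp_all add: h_0 h_add)

lemma fps_map_add: "fps_map (f + g) = fps_map f + fps_map g"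
  by (rule fps_ext) (simp add: fps_map_def h_add)

lemma fps_map_diff: "fps_map (f - g) = fps_map f - fps_map g"
  by (rule fps_ext) (use h_add[of _ "- _"] in \<open>simp add: fps_map_def h_minus\<close>)

lemma fps_map_mult: "fps_map (f * g) = fps_map f * fps_map g"
  by (rule fps_ext) (simp add: fps_map_def h_sum h_mult fps_mult_nth)

lemma fps_map_X: "fps_map fps_X = fps_X"
  by (rule fps_ext) (simp add: fps_map_def h_0 h_1)

lemma fps_map_const: "fps_map (fps_const c) = fps_const (h c)"
  by (rule fps_ext) (simp add: fps_map_def h_0)

lemma fps_map_1: "fps_map 1 = 1"
  by (rule fps_ext) (simp add: fps_map_def h_0 h_1)

lemma fps_map_power: "fps_map (f ^ n) = fps_map f ^ n"
  by (induction n) (simp_all add: fps_map_1 fps_map_mult)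

lemmas fps_map_simps = fps_map_add fps_map_diff fps_map_mult fps_map_X fps_map_const fps_map_1 fps_map_power

abbreviation (input) tt :: "'b fps" where
  "tt \<equiv> fps_const (h [:0, 1:])"

definition Y :: "'b fps" where
  "Y = fps_X * fps_map motzkin_fps"

lemma Y_eq: "Y = fps_X * (1 + Y + tt * Y ^ 2)"
proof -
  have "fps_map motzkin_fps = 1 + fps_X * fps_map motzkin_fps + tt * fps_X ^ 2 * fps_map motzkin_fps ^ 2"
    using arg_cong[OF motzkin_fps_eq, of fps_map] by (simp only: fps_map_simps)
  hence "Y = fps_X * (1 + fps_X * fps_map motzkin_fps + tt * fps_X ^ 2 * fps_map motzkin_fps ^ 2)"
    by (simp only: Y_def)
  thus ?thesis by (simp add: Y_def power_mult_distrib mult.assoc)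
qed

lemma Y_0: "Y $ 0 = 0"
  by (simp add: Y_def)

lemma fan_fps_eq: "fps_map (Abs_fps fan_poly) = 1 + Y"
proof -
  have "Abs_fps fan_poly = 1 + fps_X * motzkin_fps"
    by (rule fps_ext) (simp add: fan_poly_def)
  thus ?thesis by (simp add: fps_map_simps Y_def)
qed

lemma whirl_fps_Y: "fps_X * fps_map whirl_fps * ((1 + Y) * (1 - tt * Y ^ 2)) = Y ^ 2"
proof -
  let ?M = "fps_map motzkin_fps"
  have "fps_map whirl_fps * ((1 + fps_X * ?M) * (1 - tt * fps_X ^ 2 * ?M ^ 2)) = fps_X * ?M ^ 2"
    using arg_cong[OF whirl_fps_eq, of fps_map] by (simp only: fps_map_simps)
  hence "fps_X * (fps_map whirl_fps * ((1 + Y) * (1 - tt * Y ^ 2))) = fps_X * (fps_X * ?M ^ 2)"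
    by (simp add: Y_def power_mult_distrib mult.assoc)
  thus ?thesis by (simp add: Y_def power2_eq_square mult_ac)
qed

end

definition poly_val :: "real \<Rightarrow> int poly \<Rightarrow> real" where
  "poly_val t p = poly (map_poly of_int p) t"

lemma map_poly_of_int_add: "map_poly of_int (p + q) = (map_poly of_int p + map_poly of_int q :: real poly)"
  by (rule poly_eqI) (simp add: coeff_map_poly)

lemma map_poly_of_int_mult: "map_poly of_int (p * q) = (map_poly of_int p * map_poly of_int q :: real poly)"
  by (rule poly_eqI) (simp add: coeff_map_poly coeff_mult)

interpretation ev: coeff_hom "poly_val t" for t
  by unfold_locales (simp_all add: poly_val_def map_poly_of_int_add map_poly_of_int_mult)

interpretation fract: coeff_hom to_fract
  by unfold_locales simp_all

lemma poly_val_T [simp]: "poly_val t [:0, 1:] = t"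
  by (simp add: poly_val_def map_poly_pCons)

text \<open>The substitution \<open>x = u / (1 - t u)\<close> accounts for the contracted rim edges.\<close>

definition inv1 :: "real \<Rightarrow> real fps" where
  "inv1 t = inverse (1 - fps_const t * fps_X)"

definition xsub :: "real \<Rightarrow> real fps" where
  "xsub t = fps_X * inv1 t"

text \<open>The series G of the overview: the fan series in which every component may be enlarged by
  contracted rim edges of weight \<open>t\<close>.\<close>

definition gap_gf :: "real \<Rightarrow> real fps" where
  "gap_gf t = ev.Y t oo xsub t"

lemma inv1: "(1 - fps_const t * fps_X) * inv1 t = 1"
  unfolding inv1_def by (rule inverse_mult_eq_1') simp

lemma xsub_0: "xsub t $ 0 = 0"
  by (simp add: xsub_def)

lemmas xsub_compose = fps_compose_mult_distrib[OF xsub_0] fps_compose_add_distrib fps_compose_sub_distrib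
  fps_X_fps_compose_startby0[OF xsub_0]

lemma gap_gf_x: "gap_gf t = xsub t * (1 + gap_gf t + fps_const t * gap_gf t ^ 2)"
proof -
  have "ev.Y t oo xsub t = (fps_X * (1 + ev.Y t + fps_const t * ev.Y t ^ 2)) oo xsub t"
    using arg_cong[OF ev.Y_eq[of t], of "\<lambda>f. f oo xsub t"] by simp
  thus ?thesis
    by (simp add: gap_gf_def xsub_compose fps_compose_power[OF xsub_0])
qed

lemma gap_gf_eq: "gap_gf t = fps_X * (1 + gap_gf t) * (1 + fps_const t * gap_gf t)"
proof -
  have "(1 - fps_const t * fps_X) * gap_gf t =
    (1 - fps_const t * fps_X) * inv1 t * fps_X * (1 + gap_gf t + fps_const t * gap_gf t ^ 2)"
    by (subst (1) gap_gf_x) (simp only: xsub_def mult_ac)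
  hence "(1 - fps_const t * fps_X) * gap_gf t = fps_X * (1 + gap_gf t + fps_const t * gap_gf t ^ 2)"
    by (simp add: inv1)
  thus ?thesis by (simp add: algebra_simps power2_eq_square)
qed

lemma gap_gf_0: "gap_gf t $ 0 = 0"
  by (simp add: gap_gf_def ev.Y_0)

text \<open>The difference of two solutions is annihilated by a series with constant term 1.\<close>

lemma gap_gf_unique:
  assumes "H = fps_X * (1 + H) * (1 + fps_const t * H)"
  shows "H = gap_gf t"
proof -
  define A B where "A = H" and "B = gap_gf t"
  have "(A - B) * (1 - fps_X * (1 + fps_const t + fps_const t * (A + B))) =
    (A - fps_X * (1 + A) * (1 + fps_const t * A)) - (B - fps_X * (1 + B) * (1 + fps_const t * B))"
    by (simp add: algebra_simps)
  also have "\<dots> = 0" using assms gap_gf_eq[of t] by (simp add: A_def B_def)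
  finally have "A = B \<or> 1 - fps_X * (1 + fps_const t + fps_const t * (A + B)) = 0" by simp
  moreover have "(1 - fps_X * (1 + fps_const t + fps_const t * (A + B))) $ 0 \<noteq> 0" by simp
  ultimately show ?thesis by (metis A_def B_def fps_zero_nth)
qed

lemma gap_gf_nonzero: "gap_gf t \<noteq> 0"
  using gap_gf_eq[of t] by auto

text \<open>Divided by \<open>t\<close>, the substituted series solves the equation that
  characterizes \<open>gap_gf t\<close>; the factors \<open>1 + G\<close> and \<open>1 + t G\<close>
  change places.\<close>

lemma gap_gf_inversion:
  assumes "t \<noteq> 0"
  shows "gap_gf (1 / t) oo (fps_const t * fps_X) = fps_const t * gap_gf t"
proof -
  let ?c = "fps_const t * fps_X :: real fps"
  define K where "K = gap_gf (1 / t) oo ?c"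
  have c0: "?c $ 0 = 0" by simp
  have K: "K = ?c * (1 + K) * (1 + fps_const (1 / t) * K)"
    using arg_cong[OF gap_gf_eq[of "1 / t"], of "\<lambda>f. f oo ?c"]
    by (simp add: K_def fps_compose_mult_distrib[OF c0] fps_compose_add_distrib fps_X_fps_compose_startby0[OF c0])
  define H where "H = fps_const (1 / t) * K"
  have tt: "fps_const (1 / t) * fps_const t = (1 :: real fps)" using assms by simp
  have KH: "K = fps_const t * H" using assms by (simp add: H_def mult.assoc[symmetric])
  have "H = (fps_const (1 / t) * fps_const t) * fps_X * (1 + K) * (1 + H)"
    unfolding H_def by (subst K) (simp only: mult_ac)
  hence "H = fps_X * (1 + H) * (1 + fps_const t * H)" unfolding tt KH by (simp only: mult_ac mult_1_left)
  hence "H = gap_gf t" by (rule gap_gf_unique)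
  thus ?thesis using KH by (simp add: K_def)
qed

subsection \<open>Transfer recursions\<close>

abbreviation fan_val :: "real \<Rightarrow> nat \<Rightarrow> real" where
  "fan_val t k \<equiv> poly_val t (fan_poly k)"

abbreviation whirl_val :: "real \<Rightarrow> nat \<Rightarrow> real" where
  "whirl_val t k \<equiv> poly_val t (whirl_poly k)"

text \<open>Weighted counts of flats, read from left to right: \<open>m\<close> vertices remain to be decided,
  the current gap contains \<open>k\<close> components so far, and \<open>e\<close> further ones are to be added to the
  last gap. The primed version excludes that the next vertex is joined to the hub.\<close>

fun path_sum path_sum' :: "real \<Rightarrow> nat \<Rightarrow> nat \<Rightarrow> nat \<Rightarrow> real" where
  "path_sum t e k 0 = fan_val t (k + e)"
| "path_sum t e k (Suc m) = t * fan_val t k * path_sum t e 0 m + path_sum t e (Suc k) m + t * path_sum' t e k m"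
| "path_sum' t e k 0 = (if e = 0 then 0 else fan_val t (k + e))"
| "path_sum' t e k (Suc m) = path_sum t e (Suc k) m + t * path_sum' t e k m"

text \<open>Cyclic words with at least one \<open>Hub\<close>, cut open: \<open>k\<close> counts the
  components before the first \<open>Hub\<close>. They belong to the gap that wraps around, hence
  \<open>k\<close> becomes the parameter \<open>e\<close> of \<open>path_sum\<close>. Words without
  \<open>Hub\<close> are left to \<open>rim_sum\<close>, hence the value 0 at the end.\<close>

fun cycle_sum cycle_sum' :: "real \<Rightarrow> nat \<Rightarrow> nat \<Rightarrow> real" where
  "cycle_sum t k 0 = 0"
| "cycle_sum t k (Suc m) = t * path_sum t k 0 m + cycle_sum t (Suc k) m + t * cycle_sum' t k m"
| "cycle_sum' t k 0 = 0"
| "cycle_sum' t k (Suc m) = cycle_sum t (Suc k) m + t * cycle_sum' t k m"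

text \<open>Words without \<open>Hub\<close>: \<open>k\<close> counts the components, which are the
  vertices on the rim of the smaller whirl.\<close>

fun rim_sum :: "real \<Rightarrow> nat \<Rightarrow> nat \<Rightarrow> real" where
  "rim_sum t k 0 = whirl_val t k"
| "rim_sum t k (Suc m) = rim_sum t (Suc k) m + t * rim_sum t k m"

text \<open>Although the recursion in \<open>k\<close> has no base case, it has only one solution:
  repeated unrolling makes the difference of two solutions divisible by every power of
  \<open>x\<close>.\<close>

lemma fps_unroll_unique:
  fixes A B :: "nat \<Rightarrow> real fps"
  assumes x: "x $ 0 = 0" and A: "\<And>k. A k = c k + x * A (Suc k)" and B: "\<And>k. B k = c k + x * B (Suc k)"
  shows "A k = B k"
proof (rule fps_ext)
  define D where "D k = A k - B k" for k
  have D: "D k = x * D (Suc k)" for k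
    unfolding D_def by (subst A, subst B) (simp add: algebra_simps)
  fix n
  have "D k $ n = 0"
  proof (induction n arbitrary: k rule: less_induct)
    case (less n)
    have "D k $ n = (\<Sum>i=0..n. x $ i * D (Suc k) $ (n - i))" by (subst D) (simp add: fps_mult_nth)
    also have "\<dots> = 0"
    proof (rule sum.neutral, rule ballI)
      fix i assume "i \<in> {0..n}"
      thus "x $ i * D (Suc k) $ (n - i) = 0" using x less[of "n - i" "Suc k"] by (cases "i = 0") auto
    qed
    finally show ?case .
  qed
  thus "A k $ n = B k $ n" by (simp add: D_def)
qed

definition tail_fps :: "real \<Rightarrow> nat \<Rightarrow> (nat \<Rightarrow> real) \<Rightarrow> real fps" where
  "tail_fps t k g = Abs_fps (\<lambda>j. g (k + j)) oo xsub t"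

lemma tail_fps_unroll: "tail_fps t k g = fps_const (g k) + xsub t * tail_fps t (Suc k) g"
proof -
  have "Abs_fps (\<lambda>j. g (k + j)) = fps_const (g k) + fps_X * Abs_fps (\<lambda>j. g (Suc k + j))"
    by (rule fps_ext) (auto simp: gr0_conv_Suc)
  thus ?thesis
    by (simp add: tail_fps_def xsub_compose)
qed

text \<open>\<open>C\<close> and \<open>C'\<close> are constant in \<open>k\<close> but may contain
  \<open>A 0\<close>; the conclusion is then a linear equation for \<open>A 0\<close>.\<close>

lemma unroll_tail_fps:
  assumes "\<And>k. A k = C * fps_const (g (d + k)) + C' * fps_const (g k) + xsub t * A (Suc k)"
  shows "A 0 = C * tail_fps t d g + C' * tail_fps t 0 g"
proof -
  have "A 0 = C * tail_fps t (d + 0) g + C' * tail_fps t 0 g"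
  proof (rule fps_unroll_unique[OF xsub_0])
    fix k
    show "A k = (C * fps_const (g (d + k)) + C' * fps_const (g k)) + xsub t * A (Suc k)"
      by (rule assms)
    show "C * tail_fps t (d + k) g + C' * tail_fps t k g =
      (C * fps_const (g (d + k)) + C' * fps_const (g k)) +
      xsub t * (C * tail_fps t (d + Suc k) g + C' * tail_fps t (Suc k) g)"
      by (subst (1) tail_fps_unroll, subst (2) tail_fps_unroll) (simp add: algebra_simps)
  qed
  thus ?thesis by simp
qed

section \<open>Closed forms of the weighted counts\<close>

lemma tail_fan: "tail_fps t 0 (fan_val t) = 1 + gap_gf t"
proof -
  have "Abs_fps (fan_val t) = ev.fps_map t (Abs_fps fan_poly)" by (simp add: ev.fps_map_def)
  thus ?thesis
    unfolding tail_fps_def by (simp add: ev.fan_fps_eq fps_compose_add_distrib gap_gf_def)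
qed

text \<open>A \<open>Join\<close> carries the weight \<open>t u\<close> and returns to the same
  state; the geometric series of such letters is \<open>inv1 t\<close>.\<close>

lemma inv1_solve:
  assumes "A = c + fps_X * (B + fps_const t * A)"
  shows "A = inv1 t * c + xsub t * B"
proof -
  have "(1 - fps_const t * fps_X) * A = c + fps_X * B"
    using assms by (simp add: algebra_simps)
  hence "((1 - fps_const t * fps_X) * inv1 t) * A = inv1 t * (c + fps_X * B)"
    by (simp add: mult.assoc mult.left_commute[of _ "inv1 t"])
  thus ?thesis unfolding inv1 by (simp add: xsub_def algebra_simps)
qed

text \<open>Each \<open>Hub\<close> carries \<open>t u\<close> and the gap before it
  \<open>1 + G\<close>, so words with any number of hub vertices lead to
  \<open>1 / (1 - t u (1 + G))\<close>; the equation for G evaluates this to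
  \<open>1 + t G\<close>.\<close>

lemma gap_gf_key: "(1 - fps_const t * fps_X * (1 + gap_gf t)) * (1 + fps_const t * gap_gf t) = 1"
proof -
  have "(1 - fps_const t * fps_X * (1 + gap_gf t)) * (1 + fps_const t * gap_gf t) =
    1 + fps_const t * gap_gf t - fps_const t * (fps_X * (1 + gap_gf t) * (1 + fps_const t * gap_gf t))"
    by (simp add: algebra_simps)
  thus ?thesis by (simp add: gap_gf_eq[symmetric])
qed

text \<open>For \<open>e = 0\<close> a hub vertex follows the word, which excludes
  \<open>Join\<close> letters at its end; for \<open>e > 0\<close> they are allowed and produce the
  extra factor \<open>inv1 t\<close>.\<close>

lemma path_sum_gf:
  shows "Abs_fps (path_sum t 0 0) = (1 + fps_const t * gap_gf t) * (1 + gap_gf t)"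
    and "0 < e \<Longrightarrow> Abs_fps (path_sum t e 0) = inv1 t * (1 + fps_const t * gap_gf t) * tail_fps t e (fan_val t)"
proof -
  let ?T = "fps_const t" and ?f = "fan_val t"
  define b where "b e k = (if e = 0 then 0 else ?f (k + e))" for e k
  define A where "A e k = Abs_fps (path_sum t e k)" for e k
  define A' where "A' e k = Abs_fps (path_sum' t e k)" for e k
  have "A' e k = fps_const (b e k) + fps_X * (A e (Suc k) + ?T * A' e k)" for e k
  proof (rule fps_ext)
    fix n show "A' e k $ n = (fps_const (b e k) + fps_X * (A e (Suc k) + ?T * A' e k)) $ n"
      by (cases n) (simp_all add: A_def A'_def b_def)
  qed
  hence A': "A' e k = inv1 t * fps_const (b e k) + xsub t * A e (Suc k)" for e k
    by (rule inv1_solve)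
  \<comment> \<open>For \<open>e = 0\<close> the empty word counts in \<open>path_sum\<close> but
    not in \<open>path_sum'\<close>; the second summand restores its value.\<close>
  have A: "A e k = A' e k + fps_const (?f (k + e) - b e k) + ?T * fps_X * fps_const (?f k) * A e 0" for e k
  proof (rule fps_ext)
    fix n
    have "(?T * fps_X * fps_const (?f k) * A e 0) = fps_X * (?T * fps_const (?f k) * A e 0)"
      by (simp only: mult_ac)
    thus "A e k $ n = (A' e k + fps_const (?f (k + e) - b e k) + ?T * fps_X * fps_const (?f k) * A e 0) $ n"
      by (cases n) (simp_all add: A_def A'_def b_def fps_mult_left_const_nth mult.assoc)
  qed
  have solve: "B = c * (1 + ?T * gap_gf t)" if "B = c + ?T * fps_X * B * (1 + gap_gf t)" for B c
  proof -
    have "B - ?T * fps_X * B * (1 + gap_gf t) = c" using that by (metis add_diff_cancel_right')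
    hence "B * (1 - ?T * fps_X * (1 + gap_gf t)) = c" by (simp add: algebra_simps)
    hence "B * ((1 - ?T * fps_X * (1 + gap_gf t)) * (1 + ?T * gap_gf t)) = c * (1 + ?T * gap_gf t)"
      by (simp only: mult.assoc[symmetric])
    thus ?thesis by (simp add: gap_gf_key)
  qed
  have "A 0 0 = 0 * tail_fps t 0 ?f + (1 + ?T * fps_X * A 0 0) * tail_fps t 0 ?f"
  proof (rule unroll_tail_fps[where A = "A 0"])
    fix k show "A 0 k = 0 * fps_const (?f (0 + k)) + (1 + ?T * fps_X * A 0 0) * fps_const (?f k) + xsub t * A 0 (Suc k)"
      by (subst (1) A, subst A') (simp add: b_def algebra_simps)
  qed
  hence "A 0 0 = (1 + gap_gf t) + ?T * fps_X * A 0 0 * (1 + gap_gf t)"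
    by (simp add: tail_fan algebra_simps)
  from solve[OF this] show "Abs_fps (path_sum t 0 0) = (1 + ?T * gap_gf t) * (1 + gap_gf t)"
    by (simp add: A_def mult.commute)
  assume e: "0 < e"
  have "A e 0 = inv1 t * tail_fps t e ?f + (?T * fps_X * A e 0) * tail_fps t 0 ?f"
  proof (rule unroll_tail_fps[where A = "A e"])
    fix k show "A e k = inv1 t * fps_const (?f (e + k)) + ?T * fps_X * A e 0 * fps_const (?f k) + xsub t * A e (Suc k)"
      using e by (subst (1) A, subst A') (simp add: b_def algebra_simps)
  qed
  hence "A e 0 = inv1 t * tail_fps t e ?f + ?T * fps_X * A e 0 * (1 + gap_gf t)"
    by (simp add: tail_fan)
  from solve[OF this] show "Abs_fps (path_sum t e 0) = inv1 t * (1 + ?T * gap_gf t) * tail_fps t e ?f"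
    by (simp add: A_def mult_ac)
qed

lemma rim_sum_gf: "Abs_fps (rim_sum t 0) = inv1 t * (ev.fps_map t whirl_fps oo xsub t)"
proof -
  define A where "A k = Abs_fps (rim_sum t k)" for k
  have "A k = fps_const (whirl_val t k) + fps_X * (A (Suc k) + fps_const t * A k)" for k
  proof (rule fps_ext)
    fix n show "A k $ n = (fps_const (whirl_val t k) + fps_X * (A (Suc k) + fps_const t * A k)) $ n"
      by (cases n) (simp_all add: A_def)
  qed
  hence A: "A k = inv1 t * fps_const (whirl_val t k) + xsub t * A (Suc k)" for k
    by (rule inv1_solve)
  have "A 0 = inv1 t * tail_fps t 0 (whirl_val t) + 0 * tail_fps t 0 (whirl_val t)"
    by (rule unroll_tail_fps) (subst A, simp)
  moreover have "Abs_fps (whirl_val t) = ev.fps_map t whirl_fps"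
    by (simp add: ev.fps_map_def whirl_poly_def)
  ultimately show ?thesis by (simp add: A_def tail_fps_def)
qed

text \<open>The gap at the cut is split into \<open>k\<close> components before and the others after
  it. Summing over the splittings with \<open>k > 0\<close> weights a gap of \<open>i\<close>
  components by \<open>i\<close>, which is where the derivative of \<open>Y\<close> comes
  from.\<close>

lemma cycle_sum_gf:
  "Abs_fps (cycle_sum t 0) = fps_const t * fps_X * (1 + fps_const t * gap_gf t) *
    (1 + gap_gf t + xsub t * inv1 t * (fps_deriv (ev.Y t) oo xsub t))"
proof -
  let ?T = "fps_const t" and ?f = "fan_val t"
  define A where "A k = Abs_fps (cycle_sum t k)" for k
  define A' where "A' k = Abs_fps (cycle_sum' t k)" for k
  define P where "P k = Abs_fps (path_sum t k 0)" for k
  have "A' k = 0 + fps_X * (A (Suc k) + ?T * A' k)" for k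
  proof (rule fps_ext)
    fix n show "A' k $ n = (0 + fps_X * (A (Suc k) + ?T * A' k)) $ n"
      by (cases n) (simp_all add: A_def A'_def)
  qed
  hence A': "A' k = inv1 t * 0 + xsub t * A (Suc k)" for k
    by (rule inv1_solve)
  have A0: "A k = A' k + fps_X * (?T * P k)" for k
  proof (rule fps_ext)
    fix n show "A k $ n = (A' k + fps_X * (?T * P k)) $ n"
      by (cases n) (simp_all add: A_def A'_def P_def)
  qed
  have A: "A k = ?T * fps_X * P k + xsub t * A (Suc k)" for k
    by (subst A0, subst A') (simp add: mult_ac)
  define W where "W = ?T * fps_X * (inv1 t * (1 + ?T * gap_gf t))"
  define S where "S k = Abs_fps (\<lambda>i. of_nat (Suc i) * ?f (Suc (k + i))) oo xsub t" for k
  have S: "S k = tail_fps t (Suc k) ?f + xsub t * S (Suc k)" for k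
  proof -
    have "Abs_fps (\<lambda>i. of_nat (Suc i) * ?f (Suc (k + i))) =
      Abs_fps (\<lambda>i. ?f (Suc k + i)) + fps_X * Abs_fps (\<lambda>i. of_nat (Suc i) * ?f (Suc (Suc k + i)))"
    proof (rule fps_ext)
      fix n show "Abs_fps (\<lambda>i. of_nat (Suc i) * ?f (Suc (k + i))) $ n =
        (Abs_fps (\<lambda>i. ?f (Suc k + i)) + fps_X * Abs_fps (\<lambda>i. of_nat (Suc i) * ?f (Suc (Suc k + i)))) $ n"
        by (cases n) (simp_all add: algebra_simps)
    qed
    thus ?thesis
      by (simp add: S_def tail_fps_def xsub_compose)
  qed
  have "A (Suc 0) = W * S 0"
  proof (rule fps_unroll_unique[OF xsub_0, where A = "\<lambda>k. A (Suc k)" and B = "\<lambda>k. W * S k"])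
    fix k
    show "A (Suc k) = W * tail_fps t (Suc k) ?f + xsub t * A (Suc (Suc k))"
      by (subst A) (simp add: P_def path_sum_gf(2) W_def mult.assoc)
    show "W * S k = W * tail_fps t (Suc k) ?f + xsub t * (W * S (Suc k))"
      by (subst S) (simp add: algebra_simps)
  qed
  moreover have "S 0 = fps_deriv (ev.Y t) oo xsub t"
  proof -
    have "Abs_fps (\<lambda>i. of_nat (Suc i) * ?f (Suc i)) = fps_deriv (ev.fps_map t (Abs_fps fan_poly))"
      by (rule fps_ext) (simp add: ev.fps_map_def)
    thus ?thesis by (simp add: S_def ev.fan_fps_eq)
  qed
  moreover have "P 0 = (1 + ?T * gap_gf t) * (1 + gap_gf t)" by (simp add: P_def path_sum_gf(1))
  ultimately have "A 0 = ?T * fps_X * ((1 + ?T * gap_gf t) * (1 + gap_gf t)) + xsub t * (W * (fps_deriv (ev.Y t) oo xsub t))"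
    by (subst A) simp
  thus ?thesis by (simp add: A_def W_def algebra_simps)
qed

lemma inv1_gap_gf: "(1 + gap_gf t + fps_const t * gap_gf t ^ 2) * inv1 t = (1 + gap_gf t) * (1 + fps_const t * gap_gf t)"
proof -
  let ?T = "fps_const t"
  have "(1 - ?T * fps_X) * ((1 + gap_gf t) * (1 + ?T * gap_gf t)) =
    (1 + gap_gf t) * (1 + ?T * gap_gf t) - ?T * (fps_X * (1 + gap_gf t) * (1 + ?T * gap_gf t))" by (simp add: algebra_simps)
  also have "\<dots> = 1 + gap_gf t + ?T * gap_gf t ^ 2"
    by (simp only: gap_gf_eq[symmetric]) (simp add: algebra_simps power2_eq_square)
  finally have "(1 + gap_gf t + ?T * gap_gf t ^ 2) * inv1 t =
    ((1 - ?T * fps_X) * inv1 t) * ((1 + gap_gf t) * (1 + ?T * gap_gf t))" by (simp only: mult_ac)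
  thus ?thesis by (simp add: inv1)
qed

text \<open>Everything is rewritten in terms of G: the relations \<open>x * q = g\<close>,
  \<open>q * i = (1 + g) * (1 + ?T * g)\<close> and the equation for G eliminate the substitution,
  and the factor \<open>d\<close> clears the remaining denominators.\<close>

lemma whirl_sum_gf:
  "(Abs_fps (rim_sum t 0) + Abs_fps (cycle_sum t 0)) * (1 - fps_const t * gap_gf t ^ 2) =
    gap_gf t * (1 + fps_const t + 2 * fps_const t * gap_gf t)"
proof -
  let ?T = "fps_const t"
  define g q d x i u where "g = gap_gf t" and "q = 1 + g + ?T * g ^ 2" and "d = 1 - ?T * g ^ 2"
    and "x = xsub t" and "i = inv1 t" and "u = (fps_X :: real fps)"
  define Q where "Q = (ev.fps_map t whirl_fps oo x)"
  define D where "D = (fps_deriv (ev.Y t) oo x)"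
  have xq: "x * q = g" using gap_gf_x[of t] by (simp add: x_def q_def g_def)
  have qi: "q * i = (1 + g) * (1 + ?T * g)" using inv1_gap_gf[of t] by (simp add: i_def q_def g_def)
  have ug: "u * (1 + g) * (1 + ?T * g) = g" using gap_gf_eq[of t] by (simp add: u_def g_def)
  have xi: "x = u * i" by (simp add: x_def xsub_def u_def i_def)
  have g0: "g \<noteq> 0" by (simp add: g_def gap_gf_nonzero)
  have g1: "1 + g \<noteq> 0"
  proof
    assume "1 + g = 0"
    hence "(1 + g) $ 0 = 0" by simp
    thus False by (simp add: g_def gap_gf_0)
  qed
  have "x * Q * ((1 + g) * d) = g ^ 2"
    using arg_cong[OF ev.whirl_fps_Y[of t], of "\<lambda>f. f oo xsub t"]
    by (simp add: xsub_compose fps_compose_power[OF xsub_0] x_def Q_def g_def gap_gf_def d_def)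
  moreover have "(x * q) * Q * ((1 + g) * d) = (x * Q * ((1 + g) * d)) * q" by (simp only: mult_ac)
  ultimately have "g * (Q * ((1 + g) * d)) = g * (g * q)" by (simp only: xq power2_eq_square mult.assoc)
  hence Q1: "Q * ((1 + g) * d) = g * q" using g0 by simp
  have "(1 + g) * (i * Q * d) = (Q * ((1 + g) * d)) * i" by (simp only: mult_ac)
  hence "(1 + g) * (i * Q * d) = g * (q * i)" by (simp only: Q1 mult.assoc)
  hence "(1 + g) * (i * Q * d) = (1 + g) * (g * (1 + ?T * g))" by (simp only: qi mult.left_commute)
  hence rim: "i * Q * d = g * (1 + ?T * g)" using g1 by simp
  \<comment> \<open>Implicit differentiation of the equation for \<open>Y\<close>; after the
    substitution it becomes \<open>D * d = q * q\<close>.\<close>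
  have "fps_deriv (ev.Y t) = (1 + ev.Y t + ?T * ev.Y t ^ 2) + fps_X * (fps_deriv (ev.Y t) * (1 + 2 * ?T * ev.Y t))"
    using arg_cong[OF ev.Y_eq[of t], of fps_deriv]
    by (simp add: power2_eq_square algebra_simps)
  from arg_cong[OF this, of "\<lambda>f. f oo xsub t"] have "D = q + x * (D * (1 + 2 * ?T * g))"
    by (simp add: xsub_compose power2_eq_square x_def D_def g_def gap_gf_def q_def)
  hence "q * D = q * (q + x * (D * (1 + 2 * ?T * g)))" by (rule arg_cong)
  also have "\<dots> = q * q + (x * q) * (D * (1 + 2 * ?T * g))" by (simp only: distrib_left[of q] mult_ac)
  finally have "q * D - g * (D * (1 + 2 * ?T * g)) = q * q" by (simp only: xq add_diff_cancel_right')
  moreover have "D * (q - g * w) = q * D - g * (D * w)" for w by (simp add: algebra_simps)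
  ultimately have "D * (q - g * (1 + 2 * ?T * g)) = q * q" by simp
  moreover have "q - g * (1 + 2 * ?T * g) = d" by (simp add: q_def d_def algebra_simps power2_eq_square)
  ultimately have D: "D * d = q * q" by simp
  have "(?T * u * (1 + ?T * g) * (1 + g + x * i * D)) * d =
    ?T * (u * (1 + g) * (1 + ?T * g)) * d + ?T * u * (1 + ?T * g) * x * i * (D * d)" by (simp add: algebra_simps)
  also have "\<dots> = ?T * g * d + ?T * u * (1 + ?T * g) * (x * q) * (q * i)" by (simp only: ug D) (simp add: mult_ac)
  also have "\<dots> = ?T * g * d + ?T * (1 + ?T * g) * g * (u * (1 + g) * (1 + ?T * g))" by (simp only: xq qi) (simp add: mult_ac)
  also have "\<dots> = ?T * g * d + ?T * (1 + ?T * g) * g * g" by (simp only: ug)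
  finally have cyc: "(?T * u * (1 + ?T * g) * (1 + g + x * i * D)) * d = ?T * g * d + ?T * (1 + ?T * g) * g * g" .
  have "(Abs_fps (rim_sum t 0) + Abs_fps (cycle_sum t 0)) * d = i * Q * d + (?T * u * (1 + ?T * g) * (1 + g + x * i * D)) * d"
    unfolding rim_sum_gf cycle_sum_gf by (simp add: i_def Q_def x_def u_def g_def D_def algebra_simps)
  also have "\<dots> = g * (1 + ?T + 2 * ?T * g)"
    unfolding rim cyc by (simp add: d_def algebra_simps power2_eq_square)
  finally show ?thesis by (simp add: d_def g_def)
qed

text \<open>Under the inversion G becomes \<open>t G\<close>, which exchanges the two factors of the
  generating function.\<close>

lemma path_sum_palindromic:
  assumes "t \<noteq> 0"
  shows "t ^ m * path_sum (1 / t) 0 0 m = path_sum t 0 0 m"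
proof -
  let ?c = "fps_const t * fps_X :: real fps"
  have c0: "?c $ 0 = 0" by simp
  have tt: "fps_const (1 / t) * (fps_const t * gap_gf t) = gap_gf t" using assms by (simp add: mult.assoc[symmetric])
  have "Abs_fps (path_sum (1 / t) 0 0) oo ?c = Abs_fps (path_sum t 0 0)"
    unfolding path_sum_gf(1)
    by (simp only: fps_compose_mult_distrib[OF c0] fps_compose_add_distrib gap_gf_inversion[OF assms] tt
      fps_const_compose fps_compose_1) (rule mult.commute)
  from arg_cong[OF this, of "\<lambda>f. f $ m"] show ?thesis by simp
qed

lemma whirl_sum_palindromic:
  assumes "t \<noteq> 0"
  shows "t ^ m * (rim_sum (1 / t) 0 m + cycle_sum (1 / t) 0 m) = rim_sum t 0 m + cycle_sum t 0 m"
proof -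
  let ?c = "fps_const t * fps_X :: real fps" and ?s = "fps_const (1 / t)" and ?T = "fps_const t"
  have c0: "?c $ 0 = 0" by simp
  have tt: "?s * ?T = 1" using assms by simp
  define Z where "Z t = Abs_fps (rim_sum t 0) + Abs_fps (cycle_sum t 0)" for t
  have gf: "Z t * (1 - fps_const t * gap_gf t ^ 2) = gap_gf t * (1 + fps_const t + 2 * fps_const t * gap_gf t)" for t
    unfolding Z_def by (rule whirl_sum_gf)
  have "(Z (1 / t) oo ?c) * (1 - ?s * (?T * gap_gf t) ^ 2) = ?T * gap_gf t * (1 + ?s + 2 * ?s * (?T * gap_gf t))"
    using arg_cong[OF gf[of "1 / t"], of "\<lambda>f. f oo ?c"]
    by (simp only: fps_compose_mult_distrib[OF c0] fps_compose_add_distrib fps_compose_sub_distrib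
      power2_eq_square gap_gf_inversion[OF assms] fps_const_compose fps_compose_1 numeral_compose)
  \<comment> \<open>The inversion fixes \<open>t G ^ 2\<close>, and also the numerator once the
    factor \<open>t\<close> is distributed.\<close>
  moreover have "?s * (?T * gap_gf t) ^ 2 = (?s * ?T) * ?T * gap_gf t ^ 2" by (simp only: power2_eq_square mult_ac)
  moreover have "?T * gap_gf t * (1 + ?s + 2 * ?s * (?T * gap_gf t)) = gap_gf t * (?T + ?s * ?T + 2 * (?s * ?T) * (?T * gap_gf t))"
    by (simp only: distrib_left mult_1_right mult_1_left mult_ac)
  ultimately have "(Z (1 / t) oo ?c) * (1 - ?T * gap_gf t ^ 2) = Z t * (1 - ?T * gap_gf t ^ 2)"
    by (simp only: tt gf mult_1_left mult_1_right add.commute[of 1] mult.assoc)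
  moreover have "1 - ?T * gap_gf t ^ 2 \<noteq> 0"
  proof
    assume "1 - ?T * gap_gf t ^ 2 = 0"
    hence "(1 - ?T * gap_gf t ^ 2) $ 0 = 0" by simp
    thus False by (simp add: power2_eq_square gap_gf_0)
  qed
  ultimately have "Z (1 / t) oo ?c = Z t" by simp
  from arg_cong[OF this, of "\<lambda>f. f $ m"] show ?thesis by (simp add: Z_def)
qed

section \<open>Words encoding flats\<close>

text \<open>A flat of the whirl is encoded by a cyclic word: \<open>Hub\<close> marks the vertices whose spoke belongs
  to the flat, \<open>Join\<close> the remaining vertices whose rim edge does, and \<open>End\<close> all others. The predicate
  \<open>up nx v w\<close> expresses that \<open>w\<close> encodes a flat above the one encoded by \<open>v\<close> if the letter
  \<open>nx\<close> follows \<open>w\<close>.\<close>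

datatype letter = Hub | Join | End

text \<open>\<open>a\<close> may grow to \<open>b\<close> if \<open>c\<close> follows
  \<open>b\<close> in the upper word. A rim edge has to persist, so \<open>Join\<close> turns into
  \<open>Hub\<close> only in front of a \<open>Hub\<close>. The last clause is validity of the upper
  word: a rim edge leading to a hub vertex makes its first end a hub vertex.\<close>

definition letter_le :: "letter \<Rightarrow> letter \<Rightarrow> letter \<Rightarrow> bool" where
  "letter_le a b c \<longleftrightarrow> (a = Hub \<longrightarrow> b = Hub) \<and> (a = Join \<longrightarrow> b = Join \<or> (b = Hub \<and> c = Hub)) \<and>
     (b = Join \<longrightarrow> c \<noteq> Hub)"

fun up :: "letter \<Rightarrow> letter list \<Rightarrow> letter list \<Rightarrow> bool" where
  "up nx [] [] \<longleftrightarrow> True"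
| "up nx (a # v) (b # w) \<longleftrightarrow> letter_le a b (hd (w @ [nx])) \<and> up nx v w"
| "up nx _ _ \<longleftrightarrow> False"

definition ends :: "letter list \<Rightarrow> nat" where
  "ends w = length (filter (\<lambda>a. a = End) w)"

lemma ends_simps [simp]:
  "ends [] = 0" "ends (Hub # w) = ends w" "ends (Join # w) = ends w" "ends (End # w) = Suc (ends w)"
  "ends (v @ w) = ends v + ends w"
  by (simp_all add: ends_def)

lemma ends_replicate [simp]: "ends (replicate m End) = m"
  by (induction m) simp_all

lemma up_length: "up nx v w \<Longrightarrow> length w = length v"
  by (induction nx v w rule: up.induct) auto

lemma up_ends: "up nx v w \<Longrightarrow> ends w \<le> ends v"
proof (induction nx v w rule: up.induct)
  case (2 nx a v b w)
  thus ?case by (cases a; cases b) (auto simp: letter_le_def)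
qed auto

lemma up_snoc: "up nx (v @ [a]) (w @ [b]) \<longleftrightarrow> up b v w \<and> letter_le a b nx"
proof (induction nx v w rule: up.induct)
  case (2 nx a v b w)
  thus ?case by (cases w) auto
next
  case ("3_1" nx a v)
  thus ?case using up_length[of nx "a # v @ [a]"] by (cases v) auto
next
  case ("3_2" nx b w)
  thus ?case by (cases w) auto
qed auto

lemma up_cong: "(nx = Hub \<longleftrightarrow> nx' = Hub) \<Longrightarrow> up nx v w = up nx' v w"
proof (induction nx v w rule: up.induct)
  case (2 nx a v b w)
  thus ?case by (cases w) (auto simp: letter_le_def)
qed auto

lemma finite_letter_lists: "finite {w :: letter list. length w = n \<and> P w}"
proof -
  have "finite {w. set w \<subseteq> {Hub, Join, End} \<and> length w = n}" by (rule finite_lists_length_eq) simp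
  moreover have "{w :: letter list. length w = n \<and> P w} \<subseteq> {w. set w \<subseteq> {Hub, Join, End} \<and> length w = n}"
  proof -
    have "a \<in> {Hub, Join, End}" for a by (cases a) auto
    thus ?thesis by blast
  qed
  ultimately show ?thesis by (rule rev_finite_subset)
qed

definition ups :: "letter \<Rightarrow> letter list \<Rightarrow> letter list set" where
  "ups nx v = {w. up nx v w}"

lemma finite_ups [simp]: "finite (ups nx v)"
  by (rule finite_subset[OF _ finite_letter_lists[of "length v" "\<lambda>_. True"]]) (auto simp: ups_def up_length)

lemma ups_Nil: "ups nx [] = {[]}"
proof -
  have "up nx [] w \<longleftrightarrow> w = []" for w by (cases w) auto
  thus ?thesis by (auto simp: ups_def)
qed

lemma ups_Hub: "ups nx (Hub # v) = (#) Hub ` ups nx v"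
proof -
  have "up nx (Hub # v) w \<longleftrightarrow> (\<exists>w'. w = Hub # w' \<and> up nx v w')" for w
    by (cases w) (auto simp: letter_le_def)
  thus ?thesis by (auto simp: ups_def)
qed

text \<open>A contracted rim edge leaves no choice: its first end is joined to the hub exactly if
  its second end is.\<close>

lemma ups_Join:
  "ups nx (Join # v) = (\<lambda>w. (if hd (w @ [nx]) = Hub then Hub else Join) # w) ` ups nx v"
proof -
  have "up nx (Join # v) w \<longleftrightarrow> (\<exists>w'. w = (if hd (w' @ [nx]) = Hub then Hub else Join) # w' \<and> up nx v w')" for w
    by (cases w) (auto simp: letter_le_def)
  thus ?thesis by (auto simp: ups_def)
qed

lemma ups_End:
  "ups nx (End # v) = (#) Hub ` ups nx v \<union> (#) End ` ups nx v \<union> (#) Join ` {w \<in> ups nx v. hd (w @ [nx]) \<noteq> Hub}"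
proof -
  have "up nx (End # v) w \<longleftrightarrow> (\<exists>w'. up nx v w' \<and> (w = Hub # w' \<or> w = End # w' \<or> (w = Join # w' \<and> hd (w' @ [nx]) \<noteq> Hub)))" for w
  proof (cases w)
    case (Cons b w')
    thus ?thesis by (cases b) (auto simp: letter_le_def)
  qed auto
  thus ?thesis by (auto simp: ups_def)
qed

subsection \<open>Products over gaps\<close>

text \<open>The polynomial of the contraction at the flat encoded by \<open>w\<close> is a product over the gaps
  between hub vertices.\<close>

fun gap_prod :: "nat \<Rightarrow> nat \<Rightarrow> letter list \<Rightarrow> int poly" where
  "gap_prod e k [] = fan_poly (k + e)"
| "gap_prod e k (Hub # w) = fan_poly k * gap_prod e 0 w"
| "gap_prod e k (Join # w) = gap_prod e k w"
| "gap_prod e k (End # w) = gap_prod e (Suc k) w"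

text \<open>The word is cut open behind its first \<open>Hub\<close>; rotation invariance shows that
  this choice is immaterial. Without \<open>Hub\<close> the candidate is that of a smaller
  whirl.\<close>

definition cyc_prod :: "letter list \<Rightarrow> int poly" where
  "cyc_prod w = (if Hub \<in> set w
     then gap_prod 0 0 (tl (dropWhile (\<lambda>a. a \<noteq> Hub) w) @ takeWhile (\<lambda>a. a \<noteq> Hub) w)
     else whirl_poly (ends w))"

text \<open>A suffix without \<open>Hub\<close> only enlarges the last gap, which is what
  \<open>e\<close> records; in a cyclic word it is the part that wraps around.\<close>

lemma gap_prod_no_hub: "Hub \<notin> set p \<Longrightarrow> gap_prod e k (w @ p) = gap_prod (e + ends p) k w"
proof (induction e k w rule: gap_prod.induct)
  case (1 e k)
  thus ?case
  proof (induction p arbitrary: k)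
    case (Cons a p)
    thus ?case using Cons.IH[of "Suc k"] by (cases a) auto
  qed simp
qed auto

lemma gap_prod_hub: "gap_prod e k (v @ Hub # w) = gap_prod 0 k v * gap_prod e 0 w"
  by (induction e k v rule: gap_prod.induct) (auto simp: mult.assoc)

lemma cyc_prod_split: "Hub \<notin> set p \<Longrightarrow> cyc_prod (p @ Hub # w) = gap_prod 0 0 (w @ p)"
  by (simp add: cyc_prod_def takeWhile_append dropWhile_append)

lemma cyc_prod_no_hub: "Hub \<notin> set w \<Longrightarrow> cyc_prod w = whirl_poly (ends w)"
  by (simp add: cyc_prod_def)

lemma cyc_prod_snoc_hub: "cyc_prod (w @ [Hub]) = gap_prod 0 0 w"
proof (cases "Hub \<in> set w")
  case True
  then obtain p q where w: "w = p @ Hub # q" "Hub \<notin> set p" by (metis split_list_first)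
  have "cyc_prod (w @ [Hub]) = gap_prod 0 0 (q @ Hub # p)" using cyc_prod_split[OF w(2), of "q @ [Hub]"] by (simp add: w)
  thus ?thesis by (simp add: w gap_prod_hub mult.commute)
qed (use cyc_prod_split[of w "[]"] in simp)

lemma ends_rotate1: "ends (rotate1 w) = ends w"
  by (cases w; cases "hd w") auto

text \<open>Moving a letter across the cut leaves it in the gap that wraps around, or moves a
  \<open>Hub\<close> and thereby only permutes the factors.\<close>

lemma cyc_prod_rotate1: "cyc_prod (rotate1 w) = cyc_prod w"
proof (cases w)
  case (Cons a v)
  show ?thesis
  proof (cases "Hub \<in> set v")
    case True
    then obtain p q where v: "v = p @ Hub # q" "Hub \<notin> set p" by (metis split_list_first)
    show ?thesis
    proof (cases "a = Hub")
      case True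
      hence "cyc_prod w = gap_prod 0 0 v" using cyc_prod_split[of "[]" v] Cons by simp
      thus ?thesis using Cons True by (simp add: cyc_prod_snoc_hub)
    next
      case False
      hence "cyc_prod w = gap_prod 0 0 (q @ a # p)"
        using cyc_prod_split[of "a # p" q] Cons v by simp
      moreover have "cyc_prod (rotate1 w) = gap_prod 0 0 ((q @ [a]) @ p)"
        using cyc_prod_split[OF v(2), of "q @ [a]"] Cons v by simp
      ultimately show ?thesis by simp
    qed
  next
    case False
    show ?thesis
    proof (cases "a = Hub")
      case True
      thus ?thesis using cyc_prod_split[of "[]" v] Cons by (simp add: cyc_prod_snoc_hub)
    next
      case F: False
      thus ?thesis using False Cons ends_rotate1[of w] by (simp add: cyc_prod_no_hub)
    qed
  qed
qed simp

lemma degree_gap_prod: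
  "2 * degree (gap_prod e k w) \<le> k + e + ends w \<and>
   (0 < k + e + ends w \<longrightarrow> 2 * degree (gap_prod e k w) < k + e + ends w)"
proof (induction e k w rule: gap_prod.induct)
  case (2 e k w)
  thus ?case
    using degree_mult_le[of "fan_poly k" "gap_prod e 0 w"] degree_fan_poly[of k] by (cases "k = 0") auto
qed (use degree_fan_poly in simp_all)

lemma degree_cyc_prod:
  assumes "0 < ends w"
  shows "2 * degree (cyc_prod w) < ends w"
proof (cases "Hub \<in> set w")
  case True
  then obtain p q where w: "w = p @ Hub # q" "Hub \<notin> set p" by (metis split_list_first)
  thus ?thesis using degree_gap_prod[of 0 0 "q @ p"] assms by (auto simp: cyc_prod_split add.commute)
qed (use assms in \<open>simp add: cyc_prod_no_hub degree_whirl_poly\<close>)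

lemma degree_cyc_prod_le: "2 * degree (cyc_prod w) \<le> ends w"
proof (cases "ends w = 0")
  case True
  show ?thesis
  proof (cases "Hub \<in> set w")
    case H: True
    then obtain p q where w: "w = p @ Hub # q" "Hub \<notin> set p" by (metis split_list_first)
    thus ?thesis using degree_gap_prod[of 0 0 "q @ p"] by (auto simp: cyc_prod_split add.commute)
  qed (use True in \<open>simp add: cyc_prod_no_hub whirl_poly_0\<close>)
qed (use degree_cyc_prod[of w] in simp)

subsection \<open>Sums over the words above a linear word\<close>

text \<open>The letter after the word: a hub vertex if nothing is added to the last gap. Otherwise
  any other letter would do, since \<open>up\<close> only asks whether it is
  \<open>Hub\<close>.\<close>

definition last_letter :: "nat \<Rightarrow> letter" where
  "last_letter e = (if e = 0 then Hub else End)"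

definition up_sum :: "real \<Rightarrow> nat \<Rightarrow> nat \<Rightarrow> letter list \<Rightarrow> real" where
  "up_sum t e k v = (\<Sum>w\<in>ups (last_letter e) v. t ^ (ends v - ends w) * poly_val t (gap_prod e k w))"

definition up_sum' :: "real \<Rightarrow> nat \<Rightarrow> nat \<Rightarrow> letter list \<Rightarrow> real" where
  "up_sum' t e k v = (\<Sum>w\<in>{w \<in> ups (last_letter e) v. hd (w @ [last_letter e]) \<noteq> Hub}.
     t ^ (ends v - ends w) * poly_val t (gap_prod e k w))"

lemma up_sum_Nil: "up_sum t e k [] = fan_val t (k + e)"
  by (simp add: up_sum_def ups_Nil)

lemma up_sum'_Nil: "up_sum' t e k [] = (if e = 0 then 0 else fan_val t (k + e))"
proof -
  have "{w \<in> ups (last_letter e) []. hd (w @ [last_letter e]) \<noteq> Hub} = (if e = 0 then {} else {[]})"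
    by (auto simp: ups_Nil last_letter_def)
  thus ?thesis by (simp add: up_sum'_def)
qed

lemma up_sum_Hub: "up_sum t e k (Hub # v) = fan_val t k * up_sum t e 0 v"
  unfolding up_sum_def ups_Hub
  by (simp add: sum.reindex sum_distrib_left ev.h_mult mult_ac)

lemma up_sum'_Hub: "up_sum' t e k (Hub # v) = 0"
proof -
  have "{w \<in> ups (last_letter e) (Hub # v). hd (w @ [last_letter e]) \<noteq> Hub} = {}"
    by (auto simp: ups_Hub)
  thus ?thesis by (simp only: up_sum'_def sum.empty)
qed

text \<open>Two consecutive hub vertices enclose an empty gap, with factor 1.\<close>

lemma gap_prod_doubled:
  "hd (w @ [last_letter e]) = Hub \<Longrightarrow> gap_prod e k (Hub # w) = gap_prod e k w"
  by (cases w) (auto simp: last_letter_def fan_poly_def split: if_splits)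

lemma up_sum_Join: "up_sum t e k (Join # v) = up_sum t e k v"
  unfolding up_sum_def ups_Join
  by (subst sum.reindex) (auto simp: inj_on_def gap_prod_doubled simp del: gap_prod.simps(2) intro!: sum.cong)

lemma up_sum'_Join: "up_sum' t e k (Join # v) = up_sum' t e k v"
proof -
  have "{w \<in> ups (last_letter e) (Join # v). hd (w @ [last_letter e]) \<noteq> Hub} =
    (#) Join ` {w \<in> ups (last_letter e) v. hd (w @ [last_letter e]) \<noteq> Hub}"
    by (auto simp: ups_Join)
  thus ?thesis by (simp add: up_sum'_def sum.reindex)
qed

lemma Suc_diff_ends: "w \<in> ups nx v \<Longrightarrow> Suc (ends v) - ends w = Suc (ends v - ends w)"
  by (simp add: ups_def Suc_diff_le up_ends)

lemma up_sum'_End: "up_sum' t e k (End # v) = up_sum t e (Suc k) v + t * up_sum' t e k v"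
proof -
  let ?U = "ups (last_letter e) v" and ?U' = "{w \<in> ups (last_letter e) v. hd (w @ [last_letter e]) \<noteq> Hub}"
  let ?g = "\<lambda>w. t ^ (Suc (ends v) - ends w) * poly_val t (gap_prod e k w)"
  have "{w \<in> ups (last_letter e) (End # v). hd (w @ [last_letter e]) \<noteq> Hub} = (#) End ` ?U \<union> (#) Join ` ?U'"
    by (auto simp: ups_End)
  hence "up_sum' t e k (End # v) = sum ?g ((#) End ` ?U \<union> (#) Join ` ?U')"
    by (simp add: up_sum'_def)
  also have "\<dots> = sum ?g ((#) End ` ?U) + sum ?g ((#) Join ` ?U')"
    by (rule sum.union_disjoint) auto
  also have "sum ?g ((#) End ` ?U) = up_sum t e (Suc k) v" by (simp add: sum.reindex up_sum_def)
  also have "sum ?g ((#) Join ` ?U') = t * up_sum' t e k v"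
    unfolding up_sum'_def sum_distrib_left
    by (subst sum.reindex) (auto simp: Suc_diff_ends intro!: sum.cong)
  finally show ?thesis .
qed

text \<open>An \<open>End\<close> may become \<open>Hub\<close>, stay, or become
  \<open>Join\<close>; the last option excludes a following \<open>Hub\<close>, hence the primed
  sum. The first and the last lower \<open>ends\<close> by one, hence the factors
  \<open>t\<close>.\<close>

lemma up_sum_End: "up_sum t e k (End # v) =
  t * fan_val t k * up_sum t e 0 v + up_sum t e (Suc k) v + t * up_sum' t e k v"
proof -
  let ?U = "ups (last_letter e) v"
  let ?A = "{w \<in> ups (last_letter e) (End # v). hd (w @ [last_letter e]) \<noteq> Hub}"
  let ?g = "\<lambda>w. t ^ (Suc (ends v) - ends w) * poly_val t (gap_prod e k w)"
  have "ups (last_letter e) (End # v) = (#) Hub ` ?U \<union> ?A" by (auto simp: ups_End)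
  hence "up_sum t e k (End # v) = sum ?g ((#) Hub ` ?U \<union> ?A)" by (simp add: up_sum_def)
  also have "\<dots> = sum ?g ((#) Hub ` ?U) + sum ?g ?A" by (rule sum.union_disjoint) auto
  also have "sum ?g ?A = up_sum' t e k (End # v)" by (simp add: up_sum'_def)
  also have "sum ?g ((#) Hub ` ?U) = (\<Sum>w\<in>?U. t * fan_val t k * (t ^ (ends v - ends w) * poly_val t (gap_prod e 0 w)))"
    by (subst sum.reindex) (auto simp: ev.h_mult Suc_diff_ends intro!: sum.cong)
  also have "\<dots> = t * fan_val t k * up_sum t e 0 v" by (simp add: up_sum_def sum_distrib_left)
  finally show ?thesis by (simp add: up_sum'_End)
qed

lemma up_sum_replicate:
  "up_sum t e k (replicate m End) = path_sum t e k m"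
  "up_sum' t e k (replicate m End) = path_sum' t e k m"
  by (induction m arbitrary: k) (simp_all add: up_sum_Nil up_sum'_Nil up_sum_End up_sum'_End)

fun first_gap :: "letter list \<Rightarrow> nat" where
  "first_gap [] = 0"
| "first_gap (Hub # v) = 0"
| "first_gap (Join # v) = first_gap v"
| "first_gap (End # v) = Suc (first_gap v)"

fun later_gaps :: "real \<Rightarrow> letter list \<Rightarrow> real" where
  "later_gaps t [] = 1"
| "later_gaps t (Hub # v) = path_sum t 0 0 (first_gap v) * later_gaps t v"
| "later_gaps t (Join # v) = later_gaps t v"
| "later_gaps t (End # v) = later_gaps t v"

text \<open>At a \<open>Hub\<close> of \<open>v\<close> the recursion starts anew with an empty gap,
  so the interval above \<open>v\<close> contributes one factor per gap of \<open>v\<close>.\<close>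

lemma up_sum_gaps:
  "up_sum t 0 k v = path_sum t 0 k (first_gap v) * later_gaps t v \<and>
   up_sum' t 0 k v = path_sum' t 0 k (first_gap v) * later_gaps t v"
proof (induction v arbitrary: k)
  case (Cons a v)
  show ?case
    using Cons.IH[of k] Cons.IH[of 0] Cons.IH[of "Suc k"]
    by (cases a) (simp_all add: up_sum_Hub up_sum'_Hub up_sum_Join up_sum'_Join up_sum_End up_sum'_End algebra_simps)
qed (simp add: up_sum_Nil up_sum'_Nil)

text \<open>The true exponent is \<open>ends v - first_gap v\<close>, as the first gap has no factor
  here; powers on both sides avoid the subtraction.\<close>

lemma later_gaps_palindromic:
  assumes "t \<noteq> 0"
  shows "t ^ ends v * later_gaps (1 / t) v = t ^ first_gap v * later_gaps t v"
proof (induction v)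
  case (Cons a v)
  show ?case
  proof (cases a)
    case Hub
    have "t ^ ends v * (path_sum (1 / t) 0 0 (first_gap v) * later_gaps (1 / t) v) =
      path_sum (1 / t) 0 0 (first_gap v) * (t ^ ends v * later_gaps (1 / t) v)" by (simp only: mult_ac)
    also have "\<dots> = (t ^ first_gap v * path_sum (1 / t) 0 0 (first_gap v)) * later_gaps t v"
      by (simp only: Cons.IH mult_ac)
    finally show ?thesis using path_sum_palindromic[OF assms, of "first_gap v"] Hub by simp
  qed (use Cons.IH in \<open>simp_all add: mult.assoc\<close>)
qed simp

lemma up_sum_palindromic:
  assumes "t \<noteq> 0"
  shows "t ^ ends v * up_sum (1 / t) 0 0 v = up_sum t 0 0 v"
proof -
  have "t ^ ends v * up_sum (1 / t) 0 0 v =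
    path_sum (1 / t) 0 0 (first_gap v) * (t ^ ends v * later_gaps (1 / t) v)" by (simp add: up_sum_gaps)
  also have "\<dots> = (t ^ first_gap v * path_sum (1 / t) 0 0 (first_gap v)) * later_gaps t v"
    by (simp only: later_gaps_palindromic[OF assms] mult_ac)
  also have "\<dots> = up_sum t 0 0 v" using path_sum_palindromic[OF assms] by (simp add: up_sum_gaps)
  finally show ?thesis .
qed

subsection \<open>Sums over the words above a cyclic word\<close>

text \<open>The word of all \<open>Join\<close> would encode the rim without spokes, which is not a
  flat of the whirl.\<close>

definition cyc_ups :: "letter list \<Rightarrow> letter list set" where
  "cyc_ups v = {w. up (hd w) v w \<and> (\<exists>a\<in>set w. a \<noteq> Join)}"

definition cyc_sum :: "real \<Rightarrow> letter list \<Rightarrow> real" where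
  "cyc_sum t v = (\<Sum>w\<in>cyc_ups v. t ^ (ends v - ends w) * poly_val t (cyc_prod w))"

lemma finite_cyc_ups [simp]: "finite (cyc_ups v)"
  by (rule finite_subset[OF _ finite_letter_lists[of "length v" "\<lambda>_. True"]]) (auto simp: cyc_ups_def up_length)

section \<open>Rotation of cyclic words\<close>

lemma up_rotate1: "up (hd (rotate1 w)) (rotate1 v) (rotate1 w) \<longleftrightarrow> up (hd w) v w"
proof (cases "length v = length w")
  case True
  show ?thesis
  proof (cases v)
    case (Cons a v')
    then obtain b w' where "w = b # w'" using True by (cases w) auto
    thus ?thesis using Cons by (simp add: up_snoc conj_commute)
  qed (use True in simp)
next
  case False
  thus ?thesis using up_length[of _ v w] up_length[of _ "rotate1 v" "rotate1 w"] by auto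
qed

lemma rotate1_surj: "\<exists>v. w = rotate1 v"
proof (cases w rule: rev_cases)
  case (snoc v a)
  hence "w = rotate1 (a # v)" by simp
  thus ?thesis by blast
qed (metis rotate1.simps(1))

lemma inj_rotate1: "inj rotate1"
proof (rule injI)
  fix v w :: "'a list" assume eq: "rotate1 v = rotate1 w"
  thus "v = w" by (cases v; cases w) auto
qed

lemma cyc_ups_rotate1: "cyc_ups (rotate1 v) = rotate1 ` cyc_ups v"
proof (intro set_eqI iffI)
  fix w assume w: "w \<in> cyc_ups (rotate1 v)"
  obtain w' where "w = rotate1 w'" using rotate1_surj by blast
  thus "w \<in> rotate1 ` cyc_ups v" using w by (auto simp: cyc_ups_def up_rotate1)
qed (auto simp: cyc_ups_def up_rotate1)

lemma cyc_sum_rotate1: "cyc_sum t (rotate1 v) = cyc_sum t v"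
  unfolding cyc_sum_def cyc_ups_rotate1
  by (subst sum.reindex) (auto simp: ends_rotate1 cyc_prod_rotate1 intro: inj_on_subset[OF inj_rotate1])

lemma cyc_sum_append: "cyc_sum t (v @ w) = cyc_sum t (w @ v)"
proof -
  have "cyc_sum t (rotate n u) = cyc_sum t u" for n u
    by (induction n) (simp_all add: cyc_sum_rotate1)
  from this[of "length v" "v @ w"] show ?thesis by (simp add: rotate_append)
qed

text \<open>A \<open>Hub\<close> of the lower word remains a \<open>Hub\<close>, so all upper words
  can be cut at the same place.\<close>

lemma cyc_sum_snoc_hub: "cyc_sum t (v @ [Hub]) = up_sum t 0 0 v"
proof -
  have "up (hd w) (v @ [Hub]) w \<longleftrightarrow> (\<exists>w'. w = w' @ [Hub] \<and> up Hub v w')" for w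
    by (cases w rule: rev_cases) (auto simp: up_snoc letter_le_def dest: up_length)
  hence "cyc_ups (v @ [Hub]) = (\<lambda>w. w @ [Hub]) ` ups Hub v"
    by (auto simp: cyc_ups_def ups_def)
  thus ?thesis by (simp add: cyc_sum_def up_sum_def last_letter_def sum.reindex inj_on_def cyc_prod_snoc_hub)
qed

text \<open>The letter above a \<open>Join\<close> is determined by the next one, so deleting it is
  a bijection between the words above. It changes neither \<open>ends\<close> nor the product, since
  at most an empty gap disappears.\<close>

lemma cyc_sum_Join:
  assumes "v \<noteq> []"
  shows "cyc_sum t (Join # v) = cyc_sum t v"
proof -
  let ?c = "\<lambda>w. (if hd w = Hub then Hub else Join) # w"
  have ne: "w \<noteq> []" if "up nx v w" for nx w using that assms up_length by fastforce
  have up: "up (hd (b # w)) (Join # v) (b # w) \<longleftrightarrow> b = (if hd w = Hub then Hub else Join) \<and> up (hd w) v w" for b w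
  proof -
    have "up b v w = up (hd w) v w" if "b = (if hd w = Hub then Hub else Join)"
      by (rule up_cong) (simp add: that)
    moreover have "letter_le Join b (hd (w @ [b])) \<longleftrightarrow> b = (if hd w = Hub then Hub else Join)" if "w \<noteq> []"
      using that by (auto simp: letter_le_def)
    ultimately show ?thesis using ne by auto
  qed
  have "cyc_ups (Join # v) = ?c ` cyc_ups v"
  proof (intro set_eqI iffI)
    fix w assume w: "w \<in> cyc_ups (Join # v)"
    then obtain b w' where bw: "w = b # w'" by (cases w) (auto simp: cyc_ups_def)
    hence *: "b = (if hd w' = Hub then Hub else Join)" "up (hd w') v w'"
      using w up[of b w'] by (auto simp: cyc_ups_def)
    have "\<exists>a\<in>set w'. a \<noteq> Join"
    proof (cases "hd w' = Hub")
      case True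
      thus ?thesis using ne[OF *(2)] hd_in_set by fastforce
    next
      case False
      thus ?thesis using w bw *(1) by (auto simp: cyc_ups_def)
    qed
    thus "w \<in> ?c ` cyc_ups v" using * bw by (auto simp: cyc_ups_def)
  next
    fix w assume "w \<in> ?c ` cyc_ups v"
    then obtain w' where w': "w = ?c w'" "w' \<in> cyc_ups v" by auto
    thus "w \<in> cyc_ups (Join # v)"
      using up[of "if hd w' = Hub then Hub else Join" w'] by (auto simp: cyc_ups_def)
  qed
  moreover have "cyc_prod (?c w) = cyc_prod w" if "w \<in> cyc_ups v" for w
  proof -
    have "w \<noteq> []" using that ne by (auto simp: cyc_ups_def)
    show ?thesis
    proof (cases "hd w = Hub")
      case True
      then obtain w' where w': "w = Hub # w'" using \<open>w \<noteq> []\<close> by (cases w) auto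
      show ?thesis using cyc_prod_split[of "[]" w'] cyc_prod_split[of "[]" "Hub # w'"]
        by (simp add: w' fan_poly_def)
    next
      case False
      show ?thesis
      proof (cases "Hub \<in> set w")
        case True
        then obtain p q where w: "w = p @ Hub # q" "Hub \<notin> set p" by (metis split_list_first)
        have "gap_prod 0 0 (q @ Join # p) = gap_prod 0 0 (q @ p)"
          using gap_prod_no_hub[of "Join # p" 0 0 q] gap_prod_no_hub[of p 0 0 q] w by simp
        thus ?thesis using cyc_prod_split[OF w(2), of q] cyc_prod_split[of "Join # p" q] w False by simp
      qed (use False in \<open>simp add: cyc_prod_no_hub\<close>)
    qed
  qed
  moreover have "ends (?c w) = ends w" for w by simp
  moreover have "inj_on ?c (cyc_ups v)" by (auto simp: inj_on_def)
  ultimately show ?thesis unfolding cyc_sum_def by (simp add: sum.reindex)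
qed

text \<open>Words with a \<open>Hub\<close>, scanned up to the first one in step with
  \<open>cycle_sum\<close>, where \<open>k\<close> counts the \<open>End\<close> letters passed.
  Since \<open>Join\<close> never precedes \<open>Hub\<close>, a scan from 0 that meets its first
  \<open>Hub\<close> with \<open>k = 0\<close> has met it at once; so \<open>k\<close> decides which
  letter follows the word cyclically.\<close>

fun hub_word :: "nat \<Rightarrow> letter list \<Rightarrow> bool" where
  "hub_word k [] \<longleftrightarrow> False"
| "hub_word k (Hub # w) \<longleftrightarrow> up (last_letter k) (replicate (length w) End) w"
| "hub_word k (End # w) \<longleftrightarrow> hub_word (Suc k) w"
| "hub_word k (Join # w) \<longleftrightarrow> hub_word k w \<and> hd w \<noteq> Hub"

fun hub_prod :: "nat \<Rightarrow> letter list \<Rightarrow> int poly" where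
  "hub_prod k [] = 0"
| "hub_prod k (Hub # w) = gap_prod k 0 w"
| "hub_prod k (End # w) = hub_prod (Suc k) w"
| "hub_prod k (Join # w) = hub_prod k w"

lemma hub_prod_split: "Hub \<notin> set p \<Longrightarrow> hub_prod k (p @ Hub # w) = gap_prod (k + ends p) 0 w"
proof (induction p arbitrary: k)
  case (Cons a p)
  thus ?case by (cases a) auto
qed simp

lemma cyc_prod_hub_prod:
  assumes "Hub \<in> set w"
  shows "cyc_prod w = hub_prod 0 w"
proof -
  obtain p q where w: "w = p @ Hub # q" "Hub \<notin> set p" using assms by (metis split_list_first)
  thus ?thesis by (simp add: cyc_prod_split hub_prod_split gap_prod_no_hub)
qed

lemma hub_word_pos:
  "0 < k \<Longrightarrow> hub_word k w \<longleftrightarrow> Hub \<in> set w \<and> up End (replicate (length w) End) w"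
proof (induction k w rule: hub_word.induct)
  case (4 k w)
  thus ?case by (cases w) (auto simp: letter_le_def)
qed (auto simp: letter_le_def last_letter_def)

lemma hub_word_0:
  "hd w \<noteq> Hub \<Longrightarrow> hub_word 0 w \<longleftrightarrow> Hub \<in> set w \<and> up End (replicate (length w) End) w"
proof (induction w)
  case (Cons a w)
  show ?case
  proof (cases a)
    case Join
    thus ?thesis using Cons.IH by (cases w) (auto simp: letter_le_def)
  qed (use Cons.prems in \<open>auto simp: letter_le_def hub_word_pos\<close>)
qed simp

lemma hub_word_iff: "hub_word 0 w \<longleftrightarrow> Hub \<in> set w \<and> up (hd w) (replicate (length w) End) w"
proof (cases "hd w = Hub")
  case True
  thus ?thesis by (cases w) (auto simp: letter_le_def last_letter_def)
next
  case False
  thus ?thesis using hub_word_0[OF False] up_cong[of "hd w" End] by auto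
qed

definition hub_sum :: "real \<Rightarrow> nat \<Rightarrow> nat \<Rightarrow> real" where
  "hub_sum t k m = (\<Sum>w | length w = m \<and> hub_word k w. t ^ (m - ends w) * poly_val t (hub_prod k w))"

definition hub_sum' :: "real \<Rightarrow> nat \<Rightarrow> nat \<Rightarrow> real" where
  "hub_sum' t k m = (\<Sum>w | length w = m \<and> hub_word k w \<and> hd w \<noteq> Hub. t ^ (m - ends w) * poly_val t (hub_prod k w))"

lemma ends_le_length: "ends w \<le> length w"
  by (simp add: ends_def)

lemma hub_sum'_Suc: "hub_sum' t k (Suc m) = hub_sum t (Suc k) m + t * hub_sum' t k m"
proof -
  let ?A = "{w. length w = m \<and> hub_word (Suc k) w}" and ?B = "{w. length w = m \<and> hub_word k w \<and> hd w \<noteq> Hub}"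
  let ?g = "\<lambda>w. t ^ (Suc m - ends w) * poly_val t (hub_prod k w)"
  have "{w. length w = Suc m \<and> hub_word k w \<and> hd w \<noteq> Hub} = (#) End ` ?A \<union> (#) Join ` ?B"
  proof (rule set_eqI)
    fix w show "w \<in> {w. length w = Suc m \<and> hub_word k w \<and> hd w \<noteq> Hub} \<longleftrightarrow> w \<in> (#) End ` ?A \<union> (#) Join ` ?B"
      by (cases w; cases "hd w") auto
  qed
  hence "hub_sum' t k (Suc m) = sum ?g ((#) End ` ?A \<union> (#) Join ` ?B)" by (simp add: hub_sum'_def)
  also have "\<dots> = sum ?g ((#) End ` ?A) + sum ?g ((#) Join ` ?B)"
    by (rule sum.union_disjoint) (auto intro: finite_letter_lists)
  also have "sum ?g ((#) End ` ?A) = hub_sum t (Suc k) m" by (simp add: sum.reindex hub_sum_def)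
  also have "sum ?g ((#) Join ` ?B) = t * hub_sum' t k m"
    unfolding hub_sum'_def sum_distrib_left
    by (subst sum.reindex) (auto simp: Suc_diff_le ends_le_length intro!: sum.cong)
  finally show ?thesis .
qed

lemma hub_sum_Suc: "hub_sum t k (Suc m) = t * path_sum t k 0 m + hub_sum t (Suc k) m + t * hub_sum' t k m"
proof -
  let ?U = "ups (last_letter k) (replicate m End)"
  let ?A = "{w. length w = Suc m \<and> hub_word k w \<and> hd w \<noteq> Hub}"
  let ?g = "\<lambda>w. t ^ (Suc m - ends w) * poly_val t (hub_prod k w)"
  have "{w. length w = Suc m \<and> hub_word k w} = (#) Hub ` ?U \<union> ?A"
  proof (rule set_eqI)
    fix w show "w \<in> {w. length w = Suc m \<and> hub_word k w} \<longleftrightarrow> w \<in> (#) Hub ` ?U \<union> ?A"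
      using up_length[of "last_letter k" "replicate m End" "tl w"]
      by (cases w; cases "hd w") (auto simp: ups_def)
  qed
  hence "hub_sum t k (Suc m) = sum ?g ((#) Hub ` ?U \<union> ?A)" by (simp add: hub_sum_def)
  also have "\<dots> = sum ?g ((#) Hub ` ?U) + sum ?g ?A"
    by (rule sum.union_disjoint) (auto intro: finite_letter_lists)
  also have "sum ?g ?A = hub_sum' t k (Suc m)" by (simp add: hub_sum'_def)
  also have "sum ?g ((#) Hub ` ?U) = t * up_sum t k 0 (replicate m End)"
    unfolding up_sum_def sum_distrib_left
    using Suc_diff_ends[of _ "last_letter k" "replicate m End"]
    by (subst sum.reindex) (auto intro!: sum.cong)
  finally show ?thesis by (simp add: hub_sum'_Suc up_sum_replicate)
qed

lemma hub_sum_eq: "hub_sum t k m = cycle_sum t k m" "hub_sum' t k m = cycle_sum' t k m"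
proof (induction m arbitrary: k)
  case 0
  have e: "{w. length w = 0 \<and> hub_word k w} = {}" "{w. length w = 0 \<and> hub_word k w \<and> hd w \<noteq> Hub} = {}" for k
    by auto
  { case 1 show ?case by (simp only: hub_sum_def e sum.empty cycle_sum.simps) next
    case 2 show ?case by (simp only: hub_sum'_def e sum.empty cycle_sum'.simps) }
qed (simp_all add: hub_sum_Suc hub_sum'_Suc)

lemma rim_sum_eq:
  "rim_sum t k m = (\<Sum>w | length w = m \<and> Hub \<notin> set w. t ^ (m - ends w) * whirl_val t (k + ends w))"
proof (induction m arbitrary: k)
  case 0
  have "{w. length w = 0 \<and> Hub \<notin> set w} = {[]}" by auto
  thus ?case by simp
next
  case (Suc m)
  let ?A = "{w. length w = m \<and> Hub \<notin> set w}"
  let ?g = "\<lambda>w. t ^ (Suc m - ends w) * whirl_val t (k + ends w)"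
  have "{w. length w = Suc m \<and> Hub \<notin> set w} = (#) End ` ?A \<union> (#) Join ` ?A"
  proof (rule set_eqI)
    fix w show "w \<in> {w. length w = Suc m \<and> Hub \<notin> set w} \<longleftrightarrow> w \<in> (#) End ` ?A \<union> (#) Join ` ?A"
      by (cases w; cases "hd w") auto
  qed
  hence "sum ?g {w. length w = Suc m \<and> Hub \<notin> set w} = sum ?g ((#) End ` ?A \<union> (#) Join ` ?A)" by simp
  also have "\<dots> = sum ?g ((#) End ` ?A) + sum ?g ((#) Join ` ?A)"
    by (rule sum.union_disjoint) (auto intro: finite_letter_lists)
  also have "sum ?g ((#) End ` ?A) = rim_sum t (Suc k) m" by (simp add: sum.reindex Suc)
  also have "sum ?g ((#) Join ` ?A) = t * rim_sum t k m"
    unfolding Suc sum_distrib_left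
    by (subst sum.reindex) (auto simp: Suc_diff_le ends_le_length intro!: sum.cong)
  finally show ?case by simp
qed

lemma up_replicate_no_hub: "Hub \<notin> set w \<Longrightarrow> nx \<noteq> Hub \<Longrightarrow> up nx (replicate (length w) End) w"
proof (induction w)
  case (Cons a w)
  thus ?case by (cases w) (auto simp: letter_le_def)
qed simp

lemma ends_0_iff: "ends w = 0 \<longleftrightarrow> End \<notin> set w"
  by (auto simp: ends_def filter_empty_conv)

lemma cyc_sum_replicate:
  assumes "0 < m"
  shows "cyc_sum t (replicate m End) = rim_sum t 0 m + cycle_sum t 0 m"
proof -
  let ?H = "{w. length w = m \<and> hub_word 0 w}"
  let ?N = "{w. length w = m \<and> Hub \<notin> set w}"
  let ?N' = "{w. length w = m \<and> Hub \<notin> set w \<and> End \<in> set w}"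
  let ?g = "\<lambda>w. t ^ (m - ends w) * poly_val t (cyc_prod w)"
  have "cyc_ups (replicate m End) = ?N' \<union> ?H"
  proof (rule set_eqI)
    fix w
    show "w \<in> cyc_ups (replicate m End) \<longleftrightarrow> w \<in> ?N' \<union> ?H"
    proof (cases "length w = m")
      case True
      show ?thesis
      proof (cases "Hub \<in> set w")
        case H: True
        thus ?thesis using True by (auto simp: cyc_ups_def hub_word_iff)
      next
        case False
        have "w \<noteq> []" using True assms by auto
        hence "hd w \<noteq> Hub" using False hd_in_set by metis
        hence "up (hd w) (replicate m End) w" using up_replicate_no_hub[OF False] True by auto
        moreover have "(\<exists>a\<in>set w. a \<noteq> Join) \<longleftrightarrow> End \<in> set w" 
        proof -
          have "a \<noteq> Join \<longleftrightarrow> a = End" if "a \<in> set w" for a by (cases a) (use that False in auto)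
          thus ?thesis by auto
        qed
        ultimately show ?thesis using False True by (auto simp: cyc_ups_def hub_word_iff)
      qed
    qed (auto simp: cyc_ups_def dest: up_length)
  qed
  hence "cyc_sum t (replicate m End) = sum ?g (?N' \<union> ?H)" by (simp add: cyc_sum_def)
  also have "\<dots> = sum ?g ?N' + sum ?g ?H"
    by (rule sum.union_disjoint) (auto simp: hub_word_iff intro: finite_letter_lists)
  also have "sum ?g ?H = hub_sum t 0 m"
    unfolding hub_sum_def by (rule sum.cong) (auto simp: hub_word_iff cyc_prod_hub_prod)
  \<comment> \<open>\<open>rim_sum\<close> also counts the all-\<open>Join\<close> word, which
    \<open>cyc_ups\<close> excludes; it contributes nothing because
    \<open>whirl_poly 0 = 0\<close>.\<close>
  also have "sum ?g ?N' = sum ?g ?N"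
  proof (rule sum.mono_neutral_left)
    show "\<forall>w\<in>?N - ?N'. ?g w = 0"
    proof
      fix w assume "w \<in> ?N - ?N'"
      hence "Hub \<notin> set w" "ends w = 0" by (auto simp: ends_0_iff)
      thus "?g w = 0" by (simp add: cyc_prod_no_hub whirl_poly_0 ev.h_0)
    qed
  qed (auto simp: finite_letter_lists)
  also have "sum ?g ?N = rim_sum t 0 m"
    unfolding rim_sum_eq by (rule sum.cong) (auto simp: cyc_prod_no_hub)
  finally show ?thesis by (simp add: hub_sum_eq)
qed

text \<open>A \<open>Hub\<close> in \<open>v\<close> allows cutting and reduces to linear words;
  otherwise a \<open>Join\<close> is rotated to the front and deleted. What remains is the
  all-\<open>End\<close> word, settled by the generating function.\<close>

lemma cyc_sum_palindromic:
  assumes t: "t \<noteq> 0" and "v \<noteq> []" "\<exists>a\<in>set v. a \<noteq> Join"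
  shows "t ^ ends v * cyc_sum (1 / t) v = cyc_sum t v"
  using assms(2,3)
proof (induction v rule: length_induct)
  case (1 v)
  show ?case
  proof (cases "Hub \<in> set v")
    case True
    then obtain p q where v: "v = (p @ [Hub]) @ q" by (metis append.assoc append_Cons append_Nil split_list)
    have "cyc_sum s v = up_sum s 0 0 (q @ p)" for s
      using cyc_sum_append[of s "p @ [Hub]" q] cyc_sum_snoc_hub[of s "q @ p"] by (simp add: v)
    thus ?thesis using up_sum_palindromic[OF t, of "q @ p"] by (simp add: v add.commute)
  next
    case nH: False
    show ?thesis
    proof (cases "Join \<in> set v")
      case True
      then obtain p q where v: "v = p @ Join # q" by (metis split_list)
      have ne: "\<exists>a\<in>set (q @ p). a \<noteq> Join" using "1.prems"(2) v by auto
      hence ne': "q @ p \<noteq> []" by auto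
      have "cyc_sum s v = cyc_sum s (q @ p)" for s
        using cyc_sum_append[of s p "Join # q"] cyc_sum_Join[OF ne'] by (simp add: v)
      moreover have "length (q @ p) < length v" by (simp add: v)
      hence "t ^ ends (q @ p) * cyc_sum (1 / t) (q @ p) = cyc_sum t (q @ p)" using 1 ne ne' by blast
      ultimately show ?thesis by (simp add: v add.commute)
    next
      case False
      have "a = End" if "a \<in> set v" for a by (cases a) (use that nH False in auto)
      hence v: "replicate (length v) End = v" by (simp add: replicate_length_same)
      have "0 < length v" using "1.prems"(1) by simp
      hence "cyc_sum s v = rim_sum s 0 (length v) + cycle_sum s 0 (length v)" for s
        using cyc_sum_replicate[of "length v" s] by (simp only: v)
      moreover have "ends v = length v" using ends_replicate[of "length v"] by (simp only: v)
      ultimately show ?thesis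
        using whirl_sum_palindromic[OF t, of "length v"] by simp
    qed
  qed
qed

section \<open>The flats of the whirl as words\<close>

lemma up_iff_nth: "up nx v w \<longleftrightarrow> length w = length v \<and>
   (\<forall>i<length v. letter_le (v ! i) (w ! i) ((w @ [nx]) ! Suc i))"
proof (induction nx v w rule: up.induct)
  case (2 nx a v b w)
  thus ?case by (auto simp: less_Suc_eq_0_disj hd_conv_nth)
qed auto

lemma nth_snoc_hd: "i < length w \<Longrightarrow> (w @ [hd w]) ! Suc i = w ! (Suc i mod length w)"
  by (cases w; cases "Suc i = length w") (auto simp: nth_append)

text \<open>Position \<open>i\<close> stands for vertex \<open>i + 1\<close>. A rim edge between two
  hub vertices leaves no trace in the word, as flatness forces it.\<close>

definition word :: "nat \<Rightarrow> wheel_edge set \<Rightarrow> letter list" where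
  "word n F = map (\<lambda>i. if Spoke (Suc i) \<in> F then Hub else if Rim (Suc i) \<in> F then Join else End) [0..<n]"

lemma length_word [simp]: "length (word n F) = n"
  by (simp add: word_def)

lemma word_nth: "i < n \<Longrightarrow> word n F ! i =
  (if Spoke (Suc i) \<in> F then Hub else if Rim (Suc i) \<in> F then Join else End)"
  by (simp add: word_def)

lemma ends_word: "ends (word n F) = n - whirl_rank n F"
proof -
  have "ends (word n F) = length (filter (\<lambda>i. Spoke (Suc i) \<notin> F \<and> Rim (Suc i) \<notin> F) [0..<n])"
    unfolding ends_def word_def by (simp add: filter_map o_def) (rule arg_cong[where f = length], rule filter_cong, auto)
  also have "\<dots> = card {i. i < n \<and> Spoke (Suc i) \<notin> F \<and> Rim (Suc i) \<notin> F}"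
    by (subst distinct_card[symmetric]) (auto intro: arg_cong[where f = card])
  also have "{i. i < n \<and> Spoke (Suc i) \<notin> F \<and> Rim (Suc i) \<notin> F} =
    {..<n} - {i. i < n \<and> (Spoke (Suc i) \<in> F \<or> Rim (Suc i) \<in> F)}" by auto
  also have "card \<dots> = n - card {i. i < n \<and> (Spoke (Suc i) \<in> F \<or> Rim (Suc i) \<in> F)}"
    by (subst card_Diff_subset) auto
  also have "card {i. i < n \<and> (Spoke (Suc i) \<in> F \<or> Rim (Suc i) \<in> F)} = whirl_rank n F"
    unfolding whirl_rank_def
    by (rule bij_betw_same_card[of Suc], rule bij_betwI[of _ _ _ "\<lambda>i. i - 1"]) auto
  finally show ?thesis .
qed

lemma nxt_Suc: "i < n \<Longrightarrow> nxt n (Suc i) = Suc (Suc i mod n)"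
  by (auto simp: nxt_def)

lemma whirl_flat_Rim_iff:
  assumes F: "F \<in> whirl_flats n" and i: "i < n"
  shows "Rim (Suc i) \<in> F \<longleftrightarrow> word n F ! i = Join \<or> (word n F ! i = Hub \<and> word n F ! (Suc i mod n) = Hub)"
proof -
  have "Suc i mod n < n" using i by auto
  thus ?thesis using whirl_flatsD(2,3)[OF F, of "Suc i"] i by (auto simp: word_nth nxt_Suc)
qed

text \<open>In a flat, the letter of a vertex and the next letter decide whether the rim edge
  between them is present, so inclusion can be tested letter by letter.\<close>

lemma word_le_iff:
  assumes n: "1 \<le> n" and F: "F \<in> whirl_flats n" and G: "G \<in> whirl_flats n"
  shows "F \<subseteq> G \<longleftrightarrow> up (hd (word n G)) (word n F) (word n G)"
proof -
  have valid: "word n G ! (Suc i mod n) \<noteq> Hub" if "i < n" "word n G ! i = Join" for i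
  proof -
    have "Suc i mod n < n" using that by auto
    thus ?thesis using whirl_flatsD(3)[OF G, of "Suc i"] that by (auto simp: word_nth nxt_Suc split: if_splits)
  qed
  have "up (hd (word n G)) (word n F) (word n G) \<longleftrightarrow>
    (\<forall>i<n. letter_le (word n F ! i) (word n G ! i) (word n G ! (Suc i mod n)))"
    unfolding up_iff_nth using nth_snoc_hd[of _ "word n G"] by auto
  also have "\<dots> \<longleftrightarrow> (\<forall>i<n. (Spoke (Suc i) \<in> F \<longrightarrow> Spoke (Suc i) \<in> G) \<and> (Rim (Suc i) \<in> F \<longrightarrow> Rim (Suc i) \<in> G))"
  proof
    assume *: "\<forall>i<n. letter_le (word n F ! i) (word n G ! i) (word n G ! (Suc i mod n))"
    show "\<forall>i<n. (Spoke (Suc i) \<in> F \<longrightarrow> Spoke (Suc i) \<in> G) \<and> (Rim (Suc i) \<in> F \<longrightarrow> Rim (Suc i) \<in> G)"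
    proof (intro allI impI conjI)
      fix i assume i: "i < n"
      have si: "Suc i mod n < n" using i by auto
      show "Spoke (Suc i) \<in> G" if "Spoke (Suc i) \<in> F"
        using *[rule_format, OF i] that i by (auto simp: letter_le_def word_nth split: if_splits)
      assume "Rim (Suc i) \<in> F"
      hence "word n F ! i = Join \<or> (word n F ! i = Hub \<and> word n F ! (Suc i mod n) = Hub)"
        using whirl_flat_Rim_iff[OF F i] by blast
      thus "Rim (Suc i) \<in> G"
        using *[rule_format, OF i] *[rule_format, OF si] whirl_flat_Rim_iff[OF G i] unfolding letter_le_def by blast
    qed
  next
    assume *: "\<forall>i<n. (Spoke (Suc i) \<in> F \<longrightarrow> Spoke (Suc i) \<in> G) \<and> (Rim (Suc i) \<in> F \<longrightarrow> Rim (Suc i) \<in> G)"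
    show "\<forall>i<n. letter_le (word n F ! i) (word n G ! i) (word n G ! (Suc i mod n))"
    proof (intro allI impI)
      fix i assume i: "i < n"
      have 1: "word n F ! i = Hub \<longrightarrow> word n G ! i = Hub" using * i by (auto simp: word_nth)
      have 2: "word n F ! i = Join \<longrightarrow> Rim (Suc i) \<in> G" using * i by (auto simp: word_nth)
      show "letter_le (word n F ! i) (word n G ! i) (word n G ! (Suc i mod n))"
        unfolding letter_le_def using 1 2 valid[OF i] whirl_flat_Rim_iff[OF G i] by blast
    qed
  qed
  also have "\<dots> \<longleftrightarrow> F \<subseteq> G"
  proof
    assume *: "\<forall>i<n. (Spoke (Suc i) \<in> F \<longrightarrow> Spoke (Suc i) \<in> G) \<and> (Rim (Suc i) \<in> F \<longrightarrow> Rim (Suc i) \<in> G)"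
    show "F \<subseteq> G"
    proof
      fix x assume x: "x \<in> F"
      hence "x \<in> wheel_edges n" using whirl_flatsD(1)[OF F] by auto
      thus "x \<in> G" using *[rule_format, of "case x of Spoke i \<Rightarrow> i - 1 | Rim i \<Rightarrow> i - 1"] x by (cases x) auto
    qed
  qed auto
  finally show ?thesis by simp
qed

lemma word_inj:
  assumes "1 \<le> n" "F \<in> whirl_flats n" "G \<in> whirl_flats n" "word n F = word n G"
  shows "F = G"
proof -
  have "up (hd (word n F)) (word n F) (word n F)" using word_le_iff[OF assms(1,2,2)] by simp
  thus ?thesis using word_le_iff[OF assms(1,2,3)] word_le_iff[OF assms(1,3,2)] assms(4) by auto
qed

lemma word_not_all_Join:
  assumes n: "1 \<le> n" and F: "F \<in> whirl_flats n"
  shows "\<exists>a\<in>set (word n F). a \<noteq> Join"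
proof (rule ccontr)
  assume "\<not> ?thesis"
  hence J: "word n F ! i = Join" if "i < n" for i using that by (metis length_word nth_mem)
  have "Rim i \<in> F" if "i \<in> {1..n}" for i using whirl_flat_Rim_iff[OF F, of "i - 1"] J[of "i - 1"] that by auto
  hence "Spoke 1 \<in> F" using whirl_flatsD(4)[OF F] by (simp add: rim_subset_iff)
  thus False using J[of 0] n by (auto simp: word_nth)
qed

lemma word_surj:
  assumes n: "1 \<le> n" and w: "w \<in> cyc_ups v" "length w = n"
  shows "\<exists>G\<in>whirl_flats n. word n G = w"
proof -
  define G where "G = {Spoke (Suc i) |i. i < n \<and> w ! i = Hub} \<union>
    {Rim (Suc i) |i. i < n \<and> (w ! i = Join \<or> (w ! i = Hub \<and> w ! (Suc i mod n) = Hub))}"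
  have sp: "Spoke (Suc i) \<in> G \<longleftrightarrow> i < n \<and> w ! i = Hub" for i by (auto simp: G_def)
  have rm: "Rim (Suc i) \<in> G \<longleftrightarrow> i < n \<and> (w ! i = Join \<or> (w ! i = Hub \<and> w ! (Suc i mod n) = Hub))" for i
    by (auto simp: G_def)
  have valid: "w ! (Suc i mod n) \<noteq> Hub" if "i < n" "w ! i = Join" for i
  proof -
    have "up (hd w) v w" using w(1) by (simp add: cyc_ups_def)
    hence "length v = n" "letter_le (v ! i) (w ! i) ((w @ [hd w]) ! Suc i)"
      using that w(2) unfolding up_iff_nth by auto
    thus ?thesis using nth_snoc_hd[of i w] that w(2) by (auto simp: letter_le_def)
  qed
  have "Spoke 1 \<in> G" if r: "rim n \<subseteq> G"
  proof -
    \<comment> \<open>If the whole rim is present, every letter is \<open>Join\<close> or a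
      \<open>Hub\<close> followed by \<open>Hub\<close>. Some letter is not \<open>Join\<close>, so
      \<open>Hub\<close> spreads around the word.\<close>
    have R: "w ! i = Join \<or> (w ! i = Hub \<and> w ! (Suc i mod n) = Hub)" if "i < n" for i
    proof -
      have "Rim (Suc i) \<in> G" using r that by (simp add: rim_subset_iff)
      thus ?thesis by (simp only: rm)
    qed
    obtain a where "a \<in> set w" "a \<noteq> Join" using w(1) by (auto simp: cyc_ups_def)
    then obtain i where i: "i < n" "w ! i \<noteq> Join" using w(2) by (auto simp: in_set_conv_nth)
    hence "w ! i = Hub" using R by blast
    have "w ! (j - 1) = Hub" if "j \<in> {1..n}" for j
    proof (rule nxt_cycle_induct[of "Suc i" n "\<lambda>j. w ! (j - 1) = Hub"])
      fix j assume "j \<in> {1..n}" "w ! (j - 1) = Hub"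
      thus "w ! (nxt n j - 1) = Hub" using R[of "j - 1"] nxt_Suc[of "j - 1" n] by auto
    qed (use i \<open>w ! i = Hub\<close> that in auto)
    from this[of 1] show ?thesis using sp[of 0] n by auto
  qed
  moreover have "(Spoke j \<in> G \<and> Spoke (nxt n j) \<in> G \<longrightarrow> Rim j \<in> G) \<and>
      (Rim j \<in> G \<longrightarrow> (Spoke j \<in> G \<longleftrightarrow> Spoke (nxt n j) \<in> G))" if j: "j \<in> {1..n}" for j
  proof -
    obtain i where i: "j = Suc i" "i < n" using j by (cases j) auto
    have "Suc i mod n < n" using i by auto
    thus ?thesis using i valid[of i] by (auto simp: sp rm nxt_Suc)
  qed
  moreover have "G \<subseteq> wheel_edges n" by (auto simp: G_def)
  ultimately have "G \<in> whirl_flats n" unfolding whirl_flats_def by blast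
  moreover have "word n G = w"
  proof (rule nth_equalityI)
    fix i assume "i < length (word n G)"
    hence i: "i < n" by simp
    show "word n G ! i = w ! i" using i by (cases "w ! i") (auto simp: word_nth sp rm)
  qed (use w in simp)
  ultimately show ?thesis by blast
qed

lemma bij_betw_word:
  assumes n: "1 \<le> n" and F: "F \<in> whirl_flats n"
  shows "bij_betw (word n) {G \<in> whirl_flats n. F \<subseteq> G} (cyc_ups (word n F))"
proof (rule bij_betw_imageI)
  show "inj_on (word n) {G \<in> whirl_flats n. F \<subseteq> G}"
    by (rule inj_onI) (use word_inj[OF n] in auto)
  show "word n ` {G \<in> whirl_flats n. F \<subseteq> G} = cyc_ups (word n F)"
  proof (intro set_eqI iffI)
    fix w assume "w \<in> word n ` {G \<in> whirl_flats n. F \<subseteq> G}"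
    thus "w \<in> cyc_ups (word n F)"
      using word_le_iff[OF n F] word_not_all_Join[OF n] by (auto simp: cyc_ups_def)
  next
    fix w assume w: "w \<in> cyc_ups (word n F)"
    hence "length w = n" using up_length[of "hd w" "word n F" w] by (auto simp: cyc_ups_def)
    then obtain G where G: "G \<in> whirl_flats n" "word n G = w" using word_surj[OF n w] by blast
    moreover have "F \<subseteq> G" using word_le_iff[OF n F G(1)] w G(2) by (auto simp: cyc_ups_def)
    ultimately show "w \<in> word n ` {G \<in> whirl_flats n. F \<subseteq> G}" by blast
  qed
qed

section \<open>The Kazhdan--Lusztig polynomials of whirls\<close>

lemma poly_val_altdef: "degree p \<le> d \<Longrightarrow> poly_val t p = (\<Sum>i\<le>d. of_int (coeff p i) * t ^ i)"
proof -
  assume "degree p \<le> d"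
  hence "degree (map_poly real_of_int p) \<le> d" by (intro degree_le) (simp add: coeff_map_poly coeff_eq_0)
  from arg_cong[OF poly_as_sum_of_monoms'[OF this], of "\<lambda>q. poly q t"] show ?thesis
    by (simp add: poly_val_def poly_sum poly_monom coeff_map_poly)
qed

text \<open>The reversed polynomial agrees with \<open>p\<close> at all positive reals, hence
  coefficient by coefficient.\<close>

lemma palindromicI:
  assumes deg: "degree p \<le> d" and inv: "\<And>t. 0 < t \<Longrightarrow> t ^ d * poly_val (1 / t) p = poly_val t p"
  shows "palindromic d p"
proof -
  define q where "q = (\<Sum>i\<le>d. monom (real_of_int (coeff p (d - i))) i)"
  have "poly q t = poly (map_poly of_int p) t" if t: "0 < t" for t
  proof -
    have "poly q t = (\<Sum>i\<le>d. of_int (coeff p (d - i)) * t ^ i)" by (simp add: q_def poly_sum poly_monom)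
    also have "\<dots> = (\<Sum>i\<le>d. of_int (coeff p i) * t ^ (d - i))"
      by (rule sum.reindex_bij_witness[of _ "\<lambda>i. d - i" "\<lambda>i. d - i"]) auto
    also have "\<dots> = t ^ d * poly_val (1 / t) p"
      unfolding poly_val_altdef[OF deg] sum_distrib_left
      by (rule sum.cong) (use t in \<open>auto simp: power_diff power_one_over field_simps\<close>)
    finally show ?thesis using inv[OF t] by (simp add: poly_val_def)
  qed
  hence "{0<..} \<subseteq> {t. poly (q - map_poly of_int p) t = 0}" by auto
  hence "infinite {t. poly (q - map_poly of_int p) t = 0}"
    using infinite_super infinite_Ioi by blast
  hence "q = map_poly of_int p" using poly_roots_finite[of "q - map_poly of_int p"] by auto
  hence "coeff q i = of_int (coeff p i)" for i by (simp add: coeff_map_poly)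
  moreover have "coeff q i = of_int (coeff p (d - i))" if "i \<le> d" for i
    using that by (simp add: q_def coeff_sum)
  ultimately show ?thesis using deg unfolding palindromic_def by (metis of_int_eq_iff)
qed

lemma whirl_rank_le: "whirl_rank n F \<le> n"
  unfolding whirl_rank_def by (rule order.trans[OF card_mono[of "{1..n}"]]) auto

text \<open>\<open>word\<close> turns the sum over the flats above \<open>F\<close> into
  \<open>cyc_sum\<close>, with \<open>ends\<close> as corank. The claim is the case of the empty
  flat, whose word is all \<open>End\<close>.\<close>

lemma KL_whirl:
  assumes n: "2 \<le> n"
  shows "KL (whirl n) = whirl_poly n"
proof -
  have n1: "1 \<le> n" using n by simp
  note W = whirl_matroid[OF n]
  let ?q = "\<lambda>F. cyc_prod (word n F)" and ?r = "whirl_rank n"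
  have E: "{} \<in> whirl_flats n" by (rule empty_in_whirl_flats[OF n1])
  have full: "cyc_prod (replicate n Hub) = 1"
  proof -
    have "gap_prod 0 0 (replicate m Hub) = 1" for m by (induction m) (simp_all add: fan_poly_def)
    moreover have "replicate n Hub = replicate (n - 1) Hub @ [Hub]"
      using n replicate_append_same[of "n - 1" Hub] by (cases n) simp_all
    ultimately show ?thesis by (simp only: cyc_prod_snoc_hub)
  qed
  have "KL (contraction (whirl n) {}) = ?q {}"
  proof (rule KL_contraction_eqI[OF W(1,2)])
    have "word n (wheel_edges n) = replicate n Hub"
      by (rule nth_equalityI) (auto simp: word_nth)
    thus "?q (ground (whirl n)) = 1" by (simp add: W(3) full)
    fix F assume "F \<in> flats (whirl n)"
    hence F: "F \<in> whirl_flats n" by (simp add: W(4))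
    have d: "rk (whirl n) - rank_of (whirl n) F = ends (word n F)"
      using W(5)[OF F] by (simp add: W(6) ends_word)
    show "2 * degree (?q F) < rk (whirl n) - rank_of (whirl n) F" if "F \<noteq> ground (whirl n)"
    proof -
      have "F \<subset> wheel_edges n" using that whirl_flatsD(1)[OF F] by (auto simp: W(3))
      hence "0 < ends (word n F)"
        using whirl_rank_strict_mono[OF F wheel_edges_in_whirl_flats[OF n1]] by (simp add: ends_word whirl_rank_wheel_edges)
      thus ?thesis unfolding d by (rule degree_cyc_prod)
    qed
    let ?S = "\<Sum>G\<in>{G \<in> flats (whirl n). F \<subseteq> G}. monom 1 (rank_of (whirl n) G - rank_of (whirl n) F) * ?q G"
    have rG: "rank_of (whirl n) G - rank_of (whirl n) F = ends (word n F) - ends (word n G)"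
      if "G \<in> whirl_flats n" for G
      using W(5)[OF F] W(5)[OF that] whirl_rank_le[of n G] by (simp add: ends_word)
    have S: "?S = (\<Sum>G\<in>{G \<in> whirl_flats n. F \<subseteq> G}. monom 1 (ends (word n F) - ends (word n G)) * ?q G)"
      by (rule sum.cong) (auto simp: W(4) rG)
    have "poly_val t ?S = cyc_sum t (word n F)" for t
    proof -
      have "poly_val t (monom 1 k) = t ^ k" for k by (simp add: poly_val_def map_poly_monom poly_monom)
      hence "poly_val t ?S = (\<Sum>G\<in>{G \<in> whirl_flats n. F \<subseteq> G}. t ^ (ends (word n F) - ends (word n G)) * poly_val t (?q G))"
        unfolding S by (simp add: ev.h_sum ev.h_mult)
      also have "\<dots> = cyc_sum t (word n F)"
        unfolding cyc_sum_def by (rule sum.reindex_bij_betw[OF bij_betw_word[OF n1 F]])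
      finally show ?thesis .
    qed
    moreover have "t ^ ends (word n F) * cyc_sum (1 / t) (word n F) = cyc_sum t (word n F)" if "0 < t" for t
      by (rule cyc_sum_palindromic) (use that word_not_all_Join[OF n1 F] n1 in \<open>auto simp flip: length_0_conv\<close>)
    moreover have "degree ?S \<le> ends (word n F)"
      unfolding S
    proof (rule degree_sum_le)
      show "finite {G \<in> whirl_flats n. F \<subseteq> G}" using finite_flats[OF W(1)] by (simp add: W(4))
      fix G assume G: "G \<in> {G \<in> whirl_flats n. F \<subseteq> G}"
      hence "ends (word n G) \<le> ends (word n F)" using up_ends word_le_iff[OF n1 F] by blast
      thus "degree (monom 1 (ends (word n F) - ends (word n G)) * ?q G) \<le> ends (word n F)"
        using degree_cyc_prod_le[of "word n G"] by (intro degree_monom_mult_le) auto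
    qed
    ultimately show "palindromic (rk (whirl n) - rank_of (whirl n) F) ?S"
      unfolding d by (intro palindromicI) auto
  qed (simp add: W(4) E)
  moreover have "word n {} = replicate n End"
    by (rule nth_equalityI) (auto simp: word_nth)
  ultimately show ?thesis by (simp add: contraction_empty[OF W(1)] cyc_prod_no_hub)
qed

text \<open>The case \<open>n = 1\<close> has its own clause in the definition. Here the
  Z-polynomial is \<open>c + t\<close> with a constant \<open>c\<close>, and palindromicity forces
  \<open>c = 1\<close>.\<close>

lemma KL_whirl_1: "KL (whirl 1) = 1"
proof -
  let ?W = "whirl 1"
  have I: "indeps ?W = Pow {Spoke 1}" and g: "ground ?W = {Spoke 1}"
    by (simp_all only: whirl_1 matroid.select_convs)
  have M: "matroid ?W" unfolding matroid_def I g
  proof (intro conjI ballI allI impI)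
    fix I J :: "wheel_edge set" assume "I \<in> Pow {Spoke 1}" "J \<in> Pow {Spoke 1}" "card I < card J"
    moreover from this have "I = {} \<or> I = {Spoke 1}" "J = {} \<or> J = {Spoke 1}" by blast+
    ultimately have "I = {}" "J = {Spoke 1}" by auto
    thus "\<exists>x\<in>J - I. insert x I \<in> Pow {Spoke 1}" by auto
  qed auto
  have L: "loopless ?W" by (simp only: loopless_def I g) simp
  have r: "rank_of ?W {Spoke 1} = 1" using rank_of_indep[OF M, of "{Spoke 1}"] I by simp
  hence rk: "rk ?W = 1" by (simp only: rk_def g)
  have E: "{Spoke 1} \<in> flats ?W" using ground_in_flats[of ?W] g by simp
  have fl: "flats ?W - {{}} = {{Spoke 1}}" using E flatsD[of _ ?W] g by auto
  have "KL (contraction ?W {Spoke 1}) = 1"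
  proof (rule KL_rk_0)
    show "matroid (contraction ?W {Spoke 1})" "loopless (contraction ?W {Spoke 1})" "rk (contraction ?W {Spoke 1}) = 0"
      using matroid_contraction(1)[OF M, of "{Spoke 1}"] loopless_contraction[OF M E] rk_contraction[OF M, of "{Spoke 1}"] r rk g
      by auto
  qed
  hence Z: "KL_Z ?W = KL ?W + monom 1 1"
    unfolding KL_Z_eq[OF M L] fl using r by simp
  have "degree (KL ?W) = 0" using degree_KL[OF M L] rk by simp
  then obtain c where c: "KL ?W = [:c:]" by (metis degree_eq_zeroE)
  have "coeff (KL_Z ?W) 0 = coeff (KL_Z ?W) 1"
    using palindromic_KL_Z[OF M L] unfolding palindromic_def rk by (metis One_nat_def diff_zero zero_le)
  hence "coeff ([:c:] + monom 1 1) 0 = coeff ([:c:] + monom 1 1) 1" by (simp only: Z c)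
  hence "c = 1" by simp
  thus ?thesis using c by (simp add: one_pCons)
qed

lemma whirl_poly_1: "whirl_poly 1 = 1"
  by (simp add: whirl_poly_def whirl_fps_def fps_mult_nth power2_eq_square)

lemma KL_poly_whirl: "0 < n \<Longrightarrow> KL_poly (whirl n) = whirl_poly n"
  using KL_whirl[of n] KL_whirl_1 whirl_poly_1 by (cases "n = 1") (auto simp: KL_poly_eq_KL)

theorem theorem4p12:
  fixes t u :: "int poly fract fps"
  defines "t \<equiv> fps_const (to_fract [:0, 1:])"
    and "u \<equiv> fps_X"
  shows "Abs_fps (\<lambda>n. if n = 0 then 0 else to_fract (KL_poly (whirl n))) =
    (u + 1) / (2 * (t * u + 1) * fps_sqrt1 ((u - 1) ^ 2 - 4 * t * u ^ 2)) - 1 / (2 * (t * u + 1))"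
proof -
  define P where "P = Abs_fps (\<lambda>n. if n = 0 then 0 else to_fract (KL_poly (whirl n)))"
  have P: "P = fract.fps_map whirl_fps"
    by (rule fps_ext) (simp add: P_def fract.fps_map_def KL_poly_whirl whirl_poly_def[symmetric] whirl_poly_0)
  define y where "y = fract.Y"
  have Y: "y = u * (1 + y + t * y ^ 2)" using fract.Y_eq by (simp add: y_def t_def u_def)
  have y0: "y $ 0 = 0" by (simp add: y_def fract.Y_0)
  have PY: "u * P * ((1 + y) * (1 - t * y ^ 2)) = y ^ 2"
    using fract.whirl_fps_Y by (simp add: P y_def t_def u_def)
  \<comment> \<open>The equation \<open>t u y ^ 2 - (1 - u) y + u = 0\<close> has discriminant
    \<open>(1 - u) ^ 2 - 4 t u ^ 2\<close>; \<open>s\<close> is its square root belonging to the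
    solution without constant term.\<close>
  define s where "s = 1 - u - 2 * t * u * y"
  have s0: "s $ 0 = 1" by (simp add: s_def u_def fps_mult_nth)
  have "s ^ 2 = (u - 1) ^ 2 - 4 * t * u ^ 2 - 4 * t * u * (y - u * (1 + y + t * y ^ 2))"
    by (simp add: s_def algebra_simps power2_eq_square)
  hence s2: "s ^ 2 = (u - 1) ^ 2 - 4 * t * u ^ 2" using Y by simp
  have "fps_sqrt1 ((u - 1) ^ 2 - 4 * t * u ^ 2) = s"
    using fps_sqrt1_iff[of "s ^ 2" s] s0 s2 by (simp add: power2_eq_square)
  moreover have "P * (2 * (t * u + 1) * s) = u + 1 - s"
  proof -
    \<comment> \<open>\<open>w\<close> is the Motzkin series, as \<open>y = u w\<close>.
      Multiplication by it removes \<open>u\<close>: both \<open>s w\<close> and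
      \<open>(t u + 1) w\<close> are polynomials in \<open>y\<close> and \<open>t\<close>.\<close>
    define w where "w = 1 + y + t * y ^ 2"
    have uw: "u * w = y" using Y by (simp add: w_def)
    have w0: "w \<noteq> 0"
    proof
      assume "w = 0"
      hence "w $ 0 = 0" by simp
      thus False using y0 by (simp add: w_def power2_eq_square)
    qed
    have yne: "y \<noteq> 0" using uw w0 by (auto simp: u_def)
    have "y * (P * ((1 + y) * (1 - t * y ^ 2))) = w * (u * P * ((1 + y) * (1 - t * y ^ 2)))"
      by (subst uw[symmetric]) (simp only: mult_ac)
    hence "y * (P * ((1 + y) * (1 - t * y ^ 2))) = y * (y * w)"
      by (simp only: PY) (simp only: power2_eq_square mult_ac)
    hence Pw: "P * ((1 + y) * (1 - t * y ^ 2)) = y * w" using yne by simp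
    have sw: "s * w = 1 - t * y ^ 2"
    proof -
      have "s * w = w - u * w - 2 * t * y * (u * w)" by (simp add: s_def algebra_simps)
      thus ?thesis unfolding uw by (simp add: w_def algebra_simps power2_eq_square)
    qed
    have tw: "(t * u + 1) * w = (1 + y) * (1 + t * y)"
    proof -
      have "(t * u + 1) * w = t * (u * w) + w" by (simp add: algebra_simps)
      thus ?thesis unfolding uw by (simp add: w_def algebra_simps power2_eq_square)
    qed
    have "P * (2 * (t * u + 1) * s) * (w * w) = 2 * P * ((t * u + 1) * w) * (s * w)" by (simp only: mult_ac)
    also have "\<dots> = 2 * (1 + t * y) * (P * ((1 + y) * (1 - t * y ^ 2)))" unfolding sw tw by (simp only: mult_ac)
    also have "\<dots> = (y + w - (1 - t * y ^ 2)) * w"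
      unfolding Pw by (simp add: w_def algebra_simps power2_eq_square)
    also have "\<dots> = (u + 1 - s) * (w * w)"
      unfolding sw[symmetric] by (subst (1) uw[symmetric]) (simp add: algebra_simps)
    finally show ?thesis using w0 by simp
  qed
  moreover have "P = (u + 1) / (2 * (t * u + 1) * s) - 1 / (2 * (t * u + 1))"
    if "P * (2 * (t * u + 1) * s) = u + 1 - s"
  proof -
    \<comment> \<open>The constant term of \<open>A\<close> is 2, a unit of the fraction field, so
      both divisions are multiplications by inverses.\<close>
    define A where "A = 2 * (t * u + 1)"
    have A0: "A $ 0 \<noteq> 0" by (simp add: A_def u_def fps_numeral_nth_0)
    have As0: "(A * s) $ 0 \<noteq> 0" using A0 s0 by simp
    have "P = P * (A * s) * inverse (A * s)" using inverse_mult_eq_1'[OF As0] by (simp add: mult.assoc)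
    also have "\<dots> = (u + 1 - s) * inverse (A * s)" using that by (simp add: A_def)
    also have "\<dots> = (u + 1) * inverse (A * s) - (s * inverse s) * inverse A"
      by (simp add: fps_inverse_mult algebra_simps)
    also have "s * inverse s = 1" by (rule inverse_mult_eq_1') (simp add: s0)
    finally show ?thesis
      using fps_divide_unit[OF As0, of "u + 1"] fps_divide_unit[OF A0, of 1] by (simp add: A_def)
  qed
  ultimately show ?thesis by (simp add: P_def)
qed

end
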